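(* Let $n\ge 1$ and write $H=\mathrm{Hilb}^n(\mathrm{Bl}_{\mathbf 0}(\mathbb{C}^2))$. The following hold: 1. The total homogeneous coordinate ring $\bigoplus_{k,m\in\mathbb{Z}}H^0(H,\mathcal{O}(k,m))$ of $H$ is minimally generated by the sections of $\mathcal{O}(0,1),\mathcal{O}(1,1),\dots,\mathcal{O}(n-1,1)$, and $\mathcal{O}(1,0)$, plus the canonical sections $s_{E_n}$ and $s_B$ of $\mathcal{O}(-1,0)$ and $\mathcal{O}(0,-2)$ respectively. 2. For any two consecutive line bundles $\mathcal{L}_1$ and $\mathcal{L}_2$ from the list $\mathcal{O}(0,1),\mathcal{O}(1,1),\dots,\mathcal{O}(n-1,1),\mathcal{O}(1,0)$, the bigraded ring of sections $$\bigoplus_{d_1,d_2\geq 0} H^0(H,\mathcal{L}_1^{\otimes d_1}\otimes \mathcal{L}_2^{\otimes d_2})$$ is generated by the sections of $\mathcal{L}_1$ and $\mathcal{L}_2$. 3. For any integers $k,m\geq 0$ the ring of sections $$\bigoplus_{d\geq 0} H^0(H,\mathcal{O}(k,m)^{\otimes d})$$ is generated by the sections of $\mathcal{O}(k,m)$.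
   Context: Everything is over $\mathbb{C}$. $\mathrm{Hilb}^n(S)$ is the Hilbert scheme of length $n$ zero-dimensional subschemes of a smooth quasi-projective surface $S$. $\mathrm{Bl}_{\mathbf 0}(\mathbb{C}^2)$ is the blowup of the affine plane at the origin $\mathbf 0$, with exceptional curve $E$. On $\mathrm{Hilb}^n(\mathrm{Bl}_{\mathbf 0}(\mathbb{C}^2))$, $E_n$ is the divisor of subschemes whose support meets $E$, $B$ is the divisor of nonreduced subschemes, $\mathcal{O}(\frac12 B)$ is the line bundle whose square is $\mathcal{O}(B)$, and $\mathcal{O}(k,m):=\mathcal{O}(-kE_n-\frac m2 B)$ for $k,m\in\mathbb{Z}$. The canonical sections $s_{E_n}$ of $\mathcal{O}(E_n)=\mathcal{O}(-1,0)$ and $s_B$ of $\mathcal{O}(B)=\mathcal{O}(0,-2)$ are those vanishing exactly along $E_n$ and $B$. "Generated" always means generated as an algebra over the ring of global functions $H^0(H,\mathcal{O})=A^0(n)$ (the ring of symmetric polynomials described below); "minimally" refers to the list of generating bidegrees: none of them can be omitted. Known identification: $H^0(H,\mathcal{O}(k,m))=A^m_{\ge k}(n)$ for all $k,m\in\mathbb{Z}$, compatibly with multiplication, where: $S_n$ acts diagonally on $\mathbb{C}[x_1,y_1,\dots,x_n,y_n]$; $A$ is the space of antisymmetric polynomials; for $m>0$, $A^m(n)$ is the span of products of $m$-tuples of elements of $A$; for $m\le0$, $A^m(n)$ is the space of symmetric (if $m$ is even) or antisymmetric (if $m$ is odd) polynomials; and $A^m_{\ge k}(n)\subseteq A^m(n)$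 is the subspace of polynomials all of whose terms $x_1^{a_1}y_1^{b_1}\cdots x_n^{a_n}y_n^{b_n}$ satisfy $a_i+b_i\ge k$ for all $i$. *)

theory Defs
  imports
    Complex_Main
    "HOL-Library.Poly_Mapping"
    "HOL-Library.Product_Plus"
    "HOL-Combinatorics.Permutations"
begin

text \<open>
  Write \<open>H\<close> for the Hilbert scheme of \<open>n\<close> points on the blowup of the affine plane at the origin,
  and \<open>O(k,m) = O(- k E\<^sub>n - (m/2) B)\<close>.  The spaces of global sections enter through the known
  identification of \<open>H\<^sup>0(H, O(k,m))\<close> with a space \<open>A\<^sup>m\<^bsub>\<ge>k\<^esub>(n)\<close> of polynomials in
  \<open>x\<^sub>1, y\<^sub>1, ..., x\<^sub>n, y\<^sub>n\<close>, under which the multiplication of sections is the multiplication of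
  polynomials.
\<close>

subsection \<open>Polynomials in the coordinates of \<open>n\<close> points of the plane\<close>

datatype coord = X nat | Y nat

type_synonym monom = "coord \<Rightarrow>\<^sub>0 nat"
type_synonym cpoly = "monom \<Rightarrow>\<^sub>0 complex"

definition coords :: "nat \<Rightarrow> coord set" where
  "coords n = X ` {1..n} \<union> Y ` {1..n}"

definition poly_ring :: "nat \<Rightarrow> cpoly set" where
  "poly_ring n = {p. \<forall>t \<in> Poly_Mapping.keys p. Poly_Mapping.keys t \<subseteq> coords n}"

definition cscale :: "complex \<Rightarrow> cpoly \<Rightarrow> cpoly" where
  "cscale c p = Poly_Mapping.single 0 c * p"

interpretation cpoly: vector_space cscale
proof -
  have one: "Poly_Mapping.single 0 1 * p = p" for p :: cpoly
    by (metis single_one mult_1_left)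
  show "vector_space cscale"
  proof
    show "cscale a (cscale b p) = cscale (a * b) p" for a b p
      unfolding cscale_def by (subst mult.assoc[symmetric]) (simp add: mult_single)
  qed (simp_all only: cscale_def one distrib_left distrib_right single_add)
qed

primrec rename_coord :: "(nat \<Rightarrow> nat) \<Rightarrow> coord \<Rightarrow> coord" where
  "rename_coord \<sigma> (X i) = X (\<sigma> i)"
| "rename_coord \<sigma> (Y i) = Y (\<sigma> i)"

text \<open>
  The diagonal action, substituting \<open>x\<^bsub>\<sigma>(i)\<^esub>\<close> for \<open>x\<^sub>i\<close> and \<open>y\<^bsub>\<sigma>(i)\<^esub>\<close> for \<open>y\<^sub>i\<close>.
  Note that \<^const>\<open>Poly_Mapping.map_key\<close> is composition with its first argument, provided that
  this is injective; composing with \<open>\<sigma>\<close> both on exponents and on coefficients gives the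
  substitution by \<open>\<sigma>\<close> itself rather than by its inverse, see \<open>act_X\<close> and \<open>act_Y\<close>.
\<close>

definition act :: "(nat \<Rightarrow> nat) \<Rightarrow> cpoly \<Rightarrow> cpoly" where
  "act \<sigma> = Poly_Mapping.map_key (Poly_Mapping.map_key (rename_coord \<sigma>))"

definition symmetric_polys :: "nat \<Rightarrow> cpoly set" where
  "symmetric_polys n = {p \<in> poly_ring n. \<forall>\<sigma>. \<sigma> permutes {1..n} \<longrightarrow> act \<sigma> p = p}"

definition antisymmetric_polys :: "nat \<Rightarrow> cpoly set" where
  "antisymmetric_polys n =
    {p \<in> poly_ring n. \<forall>\<sigma>. \<sigma> permutes {1..n} \<longrightarrow> act \<sigma> p = of_int (sign \<sigma>) * p}"

lemma inj_rename_coord: "inj \<sigma> \<Longrightarrow> inj (rename_coord \<sigma>)"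
proof (rule injI)
  fix v w
  assume "inj \<sigma>" "rename_coord \<sigma> v = rename_coord \<sigma> w"
  then show "v = w" by (cases v; cases w) (auto dest: injD)
qed

lemma surj_rename_coord: "surj \<sigma> \<Longrightarrow> surj (rename_coord \<sigma>)"
proof -
  assume "surj \<sigma>"
  then have "\<exists>w. v = rename_coord \<sigma> w" for v
    by (cases v) (metis rename_coord.simps surjD)+
  then show ?thesis by (simp add: surj_def)
qed

lemma inj_map_key_rename_coord:
  assumes "bij \<sigma>"
  shows "inj (Poly_Mapping.map_key (rename_coord \<sigma>) :: monom \<Rightarrow> monom)"
proof (rule injI)
  fix s t :: monom
  assume eq: "Poly_Mapping.map_key (rename_coord \<sigma>) s = Poly_Mapping.map_key (rename_coord \<sigma>) t"
  have "Poly_Mapping.lookup s v = Poly_Mapping.lookup t v" for v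
  proof -
    obtain w where "v = rename_coord \<sigma> w"
      using surj_rename_coord[OF bij_is_surj[OF assms]] by (metis surjD)
    then show ?thesis
      using arg_cong[OF eq, of "\<lambda>r. Poly_Mapping.lookup r w"]
        inj_rename_coord[OF bij_is_inj[OF assms]]
      by (simp add: map_key.rep_eq)
  qed
  then show "s = t" by (rule poly_mapping_eqI)
qed

lemma
  assumes "bij \<sigma>"
  shows act_X: "act \<sigma> (Poly_Mapping.single (Poly_Mapping.single (X i) 1) c) =
      Poly_Mapping.single (Poly_Mapping.single (X (\<sigma> i)) 1) c"
    and act_Y: "act \<sigma> (Poly_Mapping.single (Poly_Mapping.single (Y i) 1) c) =
      Poly_Mapping.single (Poly_Mapping.single (Y (\<sigma> i)) 1) c"
proof -
  have *: "act \<sigma> (Poly_Mapping.single (Poly_Mapping.single v 1) c) =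
      Poly_Mapping.single (Poly_Mapping.single (rename_coord \<sigma> v) 1) c" for v
    using map_key_single[OF inj_map_key_rename_coord[OF assms],
        of "Poly_Mapping.single (rename_coord \<sigma> v) 1" c]
      map_key_single[OF inj_rename_coord[OF bij_is_inj[OF assms]], of v "1::nat"]
    by (simp add: act_def)
  show "act \<sigma> (Poly_Mapping.single (Poly_Mapping.single (X i) 1) c) =
      Poly_Mapping.single (Poly_Mapping.single (X (\<sigma> i)) 1) c"
    using *[of "X i"] by simp
  show "act \<sigma> (Poly_Mapping.single (Poly_Mapping.single (Y i) 1) c) =
      Poly_Mapping.single (Poly_Mapping.single (Y (\<sigma> i)) 1) c"
    using *[of "Y i"] by simp
qed

subsection \<open>Global sections of the line bundles\<close>

definition A_pow :: "nat \<Rightarrow> int \<Rightarrow> cpoly set" where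
  "A_pow n m =
    (if m > 0 then
       cpoly.span {prod_list ps | ps. length ps = nat m \<and> set ps \<subseteq> antisymmetric_polys n}
     else if even m then symmetric_polys n
     else antisymmetric_polys n)"

definition A_pow_ge :: "nat \<Rightarrow> int \<Rightarrow> int \<Rightarrow> cpoly set" where
  "A_pow_ge n m k =
    {p \<in> A_pow n m. \<forall>t \<in> Poly_Mapping.keys p. \<forall>i \<in> {1..n}.
       int (Poly_Mapping.lookup t (X i)) + int (Poly_Mapping.lookup t (Y i)) \<ge> k}"

text \<open>
  The pair \<open>(k, m)\<close> stands for \<open>O(k,m)\<close>; the tensor product of line bundles is then the addition of
  pairs.
\<close>

type_synonym line_bundle = "int \<times> int"

definition tensor_power :: "line_bundle \<Rightarrow> nat \<Rightarrow> line_bundle" where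
  "tensor_power L d = (int d * fst L, int d * snd L)"

definition H0 :: "nat \<Rightarrow> line_bundle \<Rightarrow> cpoly set" where
  "H0 n L = A_pow_ge n (snd L) (fst L)"

text \<open>
  For a monoid homomorphism \<open>\<phi>\<close> from a grading monoid to line bundles, the external direct sum of
  the \<open>H0 n (\<phi> d)\<close> over all \<open>d\<close>.  It sits inside the monoid algebra of the grading monoid over
  polynomials, whose convolution product is the multiplication of sections.
\<close>

definition section_ring :: "nat \<Rightarrow> ('g::monoid_add \<Rightarrow> line_bundle) \<Rightarrow> ('g \<Rightarrow>\<^sub>0 cpoly) set" where
  "section_ring n \<phi> = {F. \<forall>d. Poly_Mapping.lookup F d \<in> H0 n (\<phi> d)}"

definition sections_in_degree :: "nat \<Rightarrow> ('g::monoid_add \<Rightarrow> line_bundle) \<Rightarrow> 'g \<Rightarrow> ('g \<Rightarrow>\<^sub>0 cpoly) set" where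
  "sections_in_degree n \<phi> d = Poly_Mapping.single d ` H0 n (\<phi> d)"

definition subring_containing :: "'r::ring_1 set \<Rightarrow> 'r set \<Rightarrow> bool" where
  "subring_containing C T \<longleftrightarrow> C \<subseteq> T \<and> 0 \<in> T \<and> 1 \<in> T \<and>
    (\<forall>a \<in> T. - a \<in> T) \<and> (\<forall>a \<in> T. \<forall>b \<in> T. a + b \<in> T) \<and> (\<forall>a \<in> T. \<forall>b \<in> T. a * b \<in> T)"

definition generated_algebra :: "'r::ring_1 set \<Rightarrow> 'r set \<Rightarrow> 'r set" where
  "generated_algebra C G = subring_containing C hull G"

text \<open>Generation is as an algebra over the ring of global functions, placed in degree \<open>0\<close>.\<close>

definition generates_section_ring ::
    "nat \<Rightarrow> ('g::monoid_add \<Rightarrow> line_bundle) \<Rightarrow> ('g \<Rightarrow>\<^sub>0 cpoly) set \<Rightarrow> bool" where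
  "generates_section_ring n \<phi> G \<longleftrightarrow>
    generated_algebra (Poly_Mapping.single 0 ` H0 n (0, 0)) G = section_ring n \<phi>"

subsection \<open>The total coordinate ring and its generators\<close>

definition main_bundles :: "nat \<Rightarrow> line_bundle list" where
  "main_bundles n = map (\<lambda>i. (int i, 1)) [0..<n] @ [(1, 0)]"

text \<open>
  Multiplication by the canonical section of \<open>O(E\<^sub>n)\<close>, respectively \<open>O(B)\<close>, is the inclusion of
  \<open>A\<^sup>m\<^bsub>\<ge>k\<^esub>(n)\<close> into \<open>A\<^sup>m\<^bsub>\<ge>k-1\<^esub>(n)\<close>, respectively \<open>A\<^bsup>m-2\<^esup>\<^bsub>\<ge>k\<^esub>(n)\<close>.  So both canonical sections are the
  polynomial \<open>1\<close>, in the bidegree of the respective line bundle.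
\<close>

definition s_E :: "line_bundle \<Rightarrow>\<^sub>0 cpoly" where
  "s_E = Poly_Mapping.single (-1, 0) 1"

definition s_B :: "line_bundle \<Rightarrow>\<^sub>0 cpoly" where
  "s_B = Poly_Mapping.single (0, -2) 1"

definition generating_bidegrees :: "nat \<Rightarrow> line_bundle set" where
  "generating_bidegrees n = set (main_bundles n) \<union> {(-1, 0), (0, -2)}"

definition cox_generators :: "nat \<Rightarrow> line_bundle \<Rightarrow> (line_bundle \<Rightarrow>\<^sub>0 cpoly) set" where
  "cox_generators n L =
    (if L = (-1, 0) then {s_E}
     else if L = (0, -2) then {s_B}
     else sections_in_degree n (\<lambda>L. L) L)"

text \<open>
  A family of sets of generators indexed by bidegrees in \<open>D\<close> generates minimally if no bidegree can
  be omitted from \<open>D\<close>.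
\<close>

definition minimally_generates_total_ring ::
    "nat \<Rightarrow> line_bundle set \<Rightarrow> (line_bundle \<Rightarrow> (line_bundle \<Rightarrow>\<^sub>0 cpoly) set) \<Rightarrow> bool" where
  "minimally_generates_total_ring n D gens \<longleftrightarrow>
    generates_section_ring n (\<lambda>L. L) (\<Union>L \<in> D. gens L) \<and>
    (\<forall>L \<in> D. \<not> generates_section_ring n (\<lambda>L. L) (\<Union>L' \<in> D - {L}. gens L'))"

end

theory Submission
  imports Defs
begin

text \<open>
  The proof compares leading monomials.  Read a monomial
  \<open>x\<^sub>1\<^bsup>a\<^sub>1\<^esup>y\<^sub>1\<^bsup>b\<^sub>1\<^esup> \<dots> x\<^sub>n\<^bsup>a\<^sub>n\<^esup>y\<^sub>n\<^bsup>b\<^sub>n\<^esup>\<close> as a sequence of \<open>n\<close> points \<open>(a\<^sub>i, b\<^sub>i)\<close>, and order the monomials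
  lexicographically with \<open>x\<^sub>1 > \<dots> > x\<^sub>n > y\<^sub>1 > \<dots> > y\<^sub>n\<close>.  Write \<open>u\<^sup>+\<close> for \<open>max u 0\<close>, \<open>A\<^bsub>\<ge>k\<^esub>\<close> for
  \<open>A\<^sup>1\<^bsub>\<ge>k\<^esub>(n)\<close> and \<open>S\<^bsub>\<ge>k\<^esub>\<close> for \<open>A\<^sup>0\<^bsub>\<ge>k\<^esub>(n)\<close>.

  \<^emph>\<open>Restrictions on leading monomials.\<close>  Let \<open>(a, b)\<close> be the leading monomial of an element \<open>p\<close> of
  \<open>A\<^sup>m\<^bsub>\<ge>k\<^esub>(n)\<close>, where \<open>k, m \<ge> 0\<close>, and let \<open>q(y)\<close> be the coefficient of \<open>x\<^sup>a\<close> in \<open>p\<close>.  Symmetry makes \<open>a\<close>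
  weakly decreasing.  For \<open>i < j\<close>, look at the terms of \<open>p\<close> that differ from those in \<open>x\<^sup>a q\<close> only in how the
  exponent \<open>a\<^sub>i + a\<^sub>j\<close> is shared between \<open>x\<^sub>i\<close> and \<open>x\<^sub>j\<close>.  As \<open>a\<close> is extremal and \<open>p\<close> is symmetric up to sign, the
  exponent of \<open>x\<^sub>i\<close> in such a term is one of the \<open>a\<^sub>i - a\<^sub>j + 1\<close> numbers \<open>a\<^sub>j, \<dots>, a\<^sub>i\<close>; and as \<open>p\<close> vanishes
  to order \<open>m\<close> where the points \<open>i\<close> and \<open>j\<close> coincide, \<open>q\<close> must be divisible by the power of \<open>y\<^sub>i - y\<^sub>j\<close> with
  exponent \<open>(m - (a\<^sub>i - a\<^sub>j))\<^sup>+\<close> (\<open>ydiff_power_dvd_xcoeff_lead\<close>).  Moreover \<open>q\<close> is divisible by the power of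
  \<open>y\<^sub>i\<close> with exponent \<open>(k - a\<^sub>i)\<^sup>+\<close>.  These factors are pairwise coprime, which yields (\<open>lead_bound\<close>)
  \<open>b\<^sub>i \<ge> (k - a\<^sub>i)\<^sup>+ + \<Sum>\<^bsub>l > i\<^esub> (m - (a\<^sub>i - a\<^sub>l))\<^sup>+\<close>; and if \<open>a\<^sub>i = a\<^sub>j\<close> for some \<open>i < j\<close>, then \<open>b\<^sub>i \<ge> b\<^sub>j + m\<close>
  (\<open>lead_block_bound\<close>).

  \<^emph>\<open>Realisation by products.\<close>  For \<open>m > 0\<close> every sequence of points with these properties is a sum of \<open>m\<close> sequences,
  the columns \<open>c = 0, \<dots>, m - 1\<close>, with first coordinates \<open>\<lfloor>(a\<^sub>i + c) / m\<rfloor>\<close>, such that column \<open>c\<close> is strictly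
  decreasing and all its points have degree at least \<open>k\<^sub>c = \<lfloor>(k + c) / m\<rfloor>\<close> (\<open>column_decomposition\<close>).
  Column \<open>c\<close> is therefore the leading monomial of an alternant in \<open>A\<^bsub>\<ge>k\<^sub>c\<^esub>\<close>, and subduction shows that
  \<open>A\<^sup>m\<^bsub>\<ge>k\<^esub>(n)\<close> is spanned by the products of elements of \<open>A\<^bsub>\<ge>k\<^sub>c\<^esub>\<close> (\<open>A_pow_ge_span_columns\<close>).  In the same
  way \<open>S\<^bsub>\<ge>k\<^esub>\<close> is spanned by products of \<open>k\<close> elements of \<open>S\<^bsub>\<ge>1\<^esub>\<close>, and \<open>A\<^bsub>\<ge>k+1\<^esub>\<close> is spanned by
  \<open>A\<^bsub>\<ge>k\<^esub> S\<^bsub>\<ge>1\<^esub>\<close> as soon as \<open>k \<ge> n - 1\<close> (\<open>antisymmetric_ge_span_shift\<close>).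

  \<^emph>\<open>Generation.\<close>  The \<open>k\<^sub>c\<close> take at most two values, and these are consecutive; this is the statement about
  consecutive line bundles, and grouping the columns into blocks with equal sums gives the statement about the powers of
  one line bundle.  Negative \<open>k\<close> and \<open>m\<close> are reached by the canonical sections.

  \<^emph>\<open>Minimality.\<close>  For \<open>n \<ge> 2\<close> a product of two or more antisymmetric polynomials vanishes to second order where the first two
  points coincide.  To see that the degree \<open>(i, 1)\<close> cannot be omitted it is therefore enough to find an element of
  \<open>A\<^bsub>\<ge>i\<^esub>\<close> with a suitable first derivative there.  An alternant with \<open>i + 1\<close> points of degree \<open>i\<close> will do: the points
  in \<open>A\<^bsub>\<ge>i+1\<^esub>\<close> have larger degrees, and if it came from \<open>A\<^bsub>\<ge>i-l\<^esub> S\<^bsub>\<ge>l\<^esub>\<close> with \<open>l > 0\<close>, there would be \<open>i + 1\<close> distinct points of degree \<open>i - l\<close>.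
\<close>

abbreviation lookup :: "('a \<Rightarrow>\<^sub>0 'b::zero) \<Rightarrow> 'a \<Rightarrow> 'b" where "lookup \<equiv> Poly_Mapping.lookup"
abbreviation keys :: "('a \<Rightarrow>\<^sub>0 'b::zero) \<Rightarrow> 'a set" where "keys \<equiv> Poly_Mapping.keys"
abbreviation single :: "'a \<Rightarrow> 'b::zero \<Rightarrow> 'a \<Rightarrow>\<^sub>0 'b" where "single \<equiv> Poly_Mapping.single"

section \<open>The monomial order\<close>

text \<open>
  Two monomials are compared at the smallest coordinate where they differ.  So the coordinates that matter
  most, the \<open>x\<^sub>i\<close> before the \<open>y\<^sub>i\<close> and small indices before large ones, are the smallest.
\<close>

instantiation coord :: linorder
begin

definition less_coord :: "coord \<Rightarrow> coord \<Rightarrow> bool" where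
  "less_coord u v = (case (u, v) of (X i, X j) \<Rightarrow> i < j | (X i, Y j) \<Rightarrow> True
     | (Y i, X j) \<Rightarrow> False | (Y i, Y j) \<Rightarrow> i < j)"

definition less_eq_coord :: "coord \<Rightarrow> coord \<Rightarrow> bool" where
  "less_eq_coord u v \<longleftrightarrow> u < v \<or> u = v"

instance
proof
  fix u v w :: coord
  show "u < v \<longleftrightarrow> u \<le> v \<and> \<not> v \<le> u" "u \<le> u" "u \<le> v \<or> v \<le> u"
    by (auto simp: less_eq_coord_def less_coord_def split: coord.splits)
  show "u \<le> v \<Longrightarrow> v \<le> w \<Longrightarrow> u \<le> w" "u \<le> v \<Longrightarrow> v \<le> u \<Longrightarrow> u = v"
    by (auto simp: less_eq_coord_def less_coord_def split: coord.splits)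
qed

end

lemma less_coord_simps [simp]:
  "X i < X j \<longleftrightarrow> i < j" "X i < Y j" "\<not> Y i < X j" "Y i < Y j \<longleftrightarrow> i < j"
  by (simp_all add: less_coord_def)

lemma monom_less_iff:
  fixes s t :: monom
  shows "s < t \<longleftrightarrow> (\<exists>v. lookup s v < lookup t v \<and> (\<forall>w<v. lookup s w = lookup t w))"
  by transfer (simp add: less_fun_def)

definition lead :: "('a::linorder \<Rightarrow>\<^sub>0 'b::zero) \<Rightarrow> 'a" where
  "lead p = Max (keys p)"

lemma lead_in_keys: "p \<noteq> 0 \<Longrightarrow> lead p \<in> keys p"
  by (simp add: lead_def)

lemma le_lead: "t \<in> keys p \<Longrightarrow> t \<le> lead p"
  by (simp add: lead_def)

lemma lookup_lead: "p \<noteq> 0 \<Longrightarrow> lookup p (lead p) \<noteq> 0"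
  using lead_in_keys[of p] by (simp add: in_keys_iff)

lemma lead_eqI: "t \<in> keys p \<Longrightarrow> (\<And>s. s \<in> keys p \<Longrightarrow> s \<le> t) \<Longrightarrow> lead p = t"
  by (auto simp: lead_def intro: Max_eqI)

lemma lead_single [simp]: "c \<noteq> 0 \<Longrightarrow> lead (single t c) = t"
  by (simp add: lead_def)

lemma poly_eq_sum_single: "p = (\<Sum>t\<in>keys p. single t (lookup p t))"
  by (rule poly_mapping_eqI)
    (auto simp: lookup_sum lookup_single when_def in_keys_iff)

lemma poly_induct [case_names single add]:
  fixes p :: "'a \<Rightarrow>\<^sub>0 'b::comm_monoid_add"
  assumes single: "\<And>t c. P (single t c)"
    and add: "\<And>p q. P p \<Longrightarrow> P q \<Longrightarrow> P (p + q)"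
  shows "P p"
proof -
  have "P (\<Sum>t\<in>A. single t (lookup p t))" if "finite A" for A
    using that
  proof induction
    case empty
    show ?case using single[of undefined 0] by simp
  qed (auto intro: add single)
  from this[of "keys p"] show ?thesis
    by (simp flip: poly_eq_sum_single)
qed

lemma lookup_mult_keys:
  fixes p q :: "'a::monoid_add \<Rightarrow>\<^sub>0 'b::semiring_0"
  shows "lookup (p * q) t = (\<Sum>s\<in>keys p. \<Sum>r\<in>keys q. lookup p s * lookup q r when s + r = t)"
proof -
  have "p * q = (\<Sum>s\<in>keys p. \<Sum>r\<in>keys q. single (s + r) (lookup p s * lookup q r))"
    by (subst (1) poly_eq_sum_single[of p], subst (1) poly_eq_sum_single[of q])
      (simp add: sum_product mult_single)
  then show ?thesis
    by (simp add: lookup_sum lookup_single when_def eq_commute)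
qed

lemma lookup_mult_lead:
  fixes p q :: cpoly
  assumes "p \<noteq> 0" "q \<noteq> 0"
  shows "lookup (p * q) (lead p + lead q) = lookup p (lead p) * lookup q (lead q)"
proof -
  have *: "s + r = lead p + lead q \<longleftrightarrow> s = lead p \<and> r = lead q"
    if "s \<in> keys p" "r \<in> keys q" for s r
    using le_lead[OF that(1)] le_lead[OF that(2)]
    by (metis add_less_le_mono add_le_less_mono order_le_less order_less_irrefl)
  have "lookup (p * q) (lead p + lead q) =
      (\<Sum>s\<in>keys p. \<Sum>r\<in>keys q. lookup p s * lookup q r when s = lead p \<and> r = lead q)"
    unfolding lookup_mult_keys by (intro sum.cong refl) (simp add: *)
  also have "\<dots> = (\<Sum>s\<in>keys p. if s = lead p then \<Sum>r\<in>keys q. (if r = lead q then lookup p s * lookup q r else 0) else 0)"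
    by (intro sum.cong refl) (auto simp: when_def)
  also have "\<dots> = lookup p (lead p) * lookup q (lead q)"
    using assms by (simp add: lead_in_keys)
  finally show ?thesis .
qed

lemma lead_mult:
  fixes p q :: cpoly
  assumes "p \<noteq> 0" "q \<noteq> 0"
  shows "lead (p * q) = lead p + lead q"
proof (rule lead_eqI)
  show "lead p + lead q \<in> keys (p * q)"
    using lookup_mult_lead[OF assms] lookup_lead[OF assms(1)] lookup_lead[OF assms(2)]
    by (simp add: in_keys_iff)
  fix s assume "s \<in> keys (p * q)"
  then show "s \<le> lead p + lead q"
    using keys_mult[of p q] by (auto intro!: add_mono le_lead)
qed

lemma lead_minus_less:
  fixes p q :: cpoly
  assumes "lead p = lead q" "lookup p (lead p) = lookup q (lead q)" "p - q \<noteq> 0"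
  shows "lead (p - q) < lead p"
proof -
  have "lead (p - q) \<in> keys (p - q)" by (rule lead_in_keys[OF assms(3)])
  then have "lead (p - q) \<noteq> lead p" "lead (p - q) \<in> keys p \<union> keys q"
    using assms keys_diff[of p q] by (auto simp: in_keys_iff lookup_minus)
  then show ?thesis
    using le_lead[of "lead (p - q)" p] le_lead[of "lead (p - q)" q] assms(1) by auto
qed

text \<open>
  Monomials in the finitely many coordinates of \<open>n\<close> points are well-ordered: on their exponent
  vectors the order is the lexicographic order of lists of a fixed length.
\<close>

lemma wf_monom_less: "wf {(s, t :: monom). s < t \<and> keys s \<subseteq> coords n \<and> keys t \<subseteq> coords n}"
proof -
  define cs where "cs = map X [1..<Suc n] @ map Y [1..<Suc n]"
  have set_cs: "set cs = coords n" by (auto simp: cs_def coords_def)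
  have sorted: "sorted_wrt (<) cs" by (auto simp: cs_def sorted_wrt_append sorted_wrt_map)
  have "(map (lookup s) cs, map (lookup t) cs) \<in> lexn less_than (length cs)"
    if st: "s < t" "keys s \<subseteq> coords n" "keys t \<subseteq> coords n" for s t :: monom
  proof -
    obtain v where v: "lookup s v < lookup t v" "\<forall>w<v. lookup s w = lookup t w"
      using st(1) by (auto simp: monom_less_iff)
    then have "v \<in> set cs" using st(3) set_cs by (auto simp: in_keys_iff)
    then obtain us ws where cs: "cs = us @ v # ws" by (auto simp: in_set_conv_decomp)
    have "\<forall>w\<in>set us. w < v" using sorted cs by (auto simp: sorted_wrt_append)
    then have "map (lookup s) us = map (lookup t) us" using v(2) by auto
    then have "map (lookup s) cs = map (lookup t) us @ lookup s v # map (lookup s) ws"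
      "map (lookup t) cs = map (lookup t) us @ lookup t v # map (lookup t) ws"
      by (simp_all add: cs)
    then show ?thesis
      unfolding lexn_conv using v(1)
      by (intro CollectI case_prodI conjI exI[of _ "map (lookup t) us"] exI) (auto simp: cs)
  qed
  then have "{(s, t :: monom). s < t \<and> keys s \<subseteq> coords n \<and> keys t \<subseteq> coords n}
      \<subseteq> inv_image (lexn less_than (length cs)) (\<lambda>t. map (lookup t) cs)"
    by (auto simp: inv_image_def)
  then show ?thesis
    by (rule wf_subset[rotated]) (intro wf_inv_image wf_lexn wf_less_than)
qed

text \<open>
  Subduction: subtracting a multiple of \<open>w\<close> lowers the leading monomial of \<open>p\<close> and stays inside \<open>V\<close>, so the
  well-order forces the process to end at \<open>0\<close>.
\<close>

lemma subspace_eqI_lead: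
  assumes V: "cpoly.subspace V" "V \<subseteq> poly_ring n" and W: "cpoly.subspace W"
    and lead: "\<And>p. p \<in> V \<Longrightarrow> p \<noteq> 0 \<Longrightarrow> \<exists>w\<in>V \<inter> W. w \<noteq> 0 \<and> lead w = lead p"
  shows "V \<subseteq> W"
proof
  fix p assume "p \<in> V"
  then show "p \<in> W"
  proof (induction "lead p" arbitrary: p rule: wf_induct_rule[OF wf_monom_less[of n]])
    case (1 p)
    show ?case
    proof (cases "p = 0")
      case False
      then obtain w where w: "w \<in> V" "w \<in> W" "w \<noteq> 0" "lead w = lead p"
        using lead 1(2) by blast
      define c where "c = lookup p (lead p) / lookup w (lead w)"
      define w' where "w' = cscale c w"
      have c: "c \<noteq> 0" using lookup_lead[OF False] lookup_lead[OF w(3)] by (simp add: c_def)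
      have look: "lookup w' t = c * lookup w t" for t
        unfolding w'_def cscale_def
        by (subst mult_map_scale_conv_mult[symmetric])
          (simp add: Poly_Mapping.map.rep_eq when_def)
      have keys': "keys w' = keys w" using c by (auto simp: in_keys_iff look)
      then have lead': "lead w' = lead w" by (simp add: lead_def)
      have w'V: "w' \<in> V" "w' \<in> W"
        using w V(1) W by (auto simp: w'_def cpoly.subspace_scale)
      have "lookup w' (lead w') = lookup p (lead p)"
        using lookup_lead[OF w(3)] by (simp add: look lead' c_def)
      have V': "p - w' \<in> V" using V(1) 1(2) w'V cpoly.subspace_diff by blast
      have "p - w' \<in> W"
      proof (cases "p - w' = 0")
        case True
        then show ?thesis using W by (simp add: cpoly.subspace_0)
      next
        case nz: False
        have less: "lead (p - w') < lead p"
          by (rule lead_minus_less) (use nz lead' w(4) \<open>lookup w' (lead w') = lookup p (lead p)\<close> in auto)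
        have "keys (lead (p - w')) \<subseteq> coords n" "keys (lead p) \<subseteq> coords n"
          using V(2) V' 1(2) lead_in_keys[OF nz] lead_in_keys[OF False]
          by (auto simp: poly_ring_def)
        then show ?thesis using 1(1)[OF _ V'] less by auto
      qed
      then have "(p - w') + w' \<in> W" using W w'V cpoly.subspace_add by blast
      then show ?thesis by simp
    qed (use W in \<open>simp add: cpoly.subspace_0\<close>)
  qed
qed

section \<open>Weighted monomial substitutions\<close>

text \<open>
  For additive \<open>g\<close> the unweighted map \<open>push g\<close> is a ring homomorphism that substitutes monomials for the variables.
  The weights encode both the selection of some terms of a polynomial, when they are \<open>0\<close> or \<open>1\<close>, and Euler
  derivations such as \<open>x\<^sub>i \<partial>/\<partial>x\<^sub>i\<close>, when they are exponents.
\<close>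

definition wpush :: "(monom \<Rightarrow> complex) \<Rightarrow> (monom \<Rightarrow> monom) \<Rightarrow> cpoly \<Rightarrow> cpoly" where
  "wpush \<omega> g p = (\<Sum>t\<in>keys p. single (g t) (\<omega> t * lookup p t))"

abbreviation push :: "(monom \<Rightarrow> monom) \<Rightarrow> cpoly \<Rightarrow> cpoly" where
  "push \<equiv> wpush (\<lambda>_. 1)"

lemma wpush_superset:
  assumes "finite A" "keys p \<subseteq> A"
  shows "wpush \<omega> g p = (\<Sum>t\<in>A. single (g t) (\<omega> t * lookup p t))"
  unfolding wpush_def using assms by (intro sum.mono_neutral_left) (auto simp: in_keys_iff)

lemma wpush_add: "wpush \<omega> g (p + q) = wpush \<omega> g p + wpush \<omega> g q"
proof -
  let ?A = "keys p \<union> keys q"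
  have "wpush \<omega> g r = (\<Sum>t\<in>?A. single (g t) (\<omega> t * lookup r t))" if "r \<in> {p, q, p + q}" for r
    using that keys_add[of p q] by (intro wpush_superset) auto
  then have "wpush \<omega> g (p + q) = (\<Sum>t\<in>?A. single (g t) (\<omega> t * lookup (p + q) t))"
    "wpush \<omega> g p = (\<Sum>t\<in>?A. single (g t) (\<omega> t * lookup p t))"
    "wpush \<omega> g q = (\<Sum>t\<in>?A. single (g t) (\<omega> t * lookup q t))"
    by blast+
  then show ?thesis
    by (simp only: lookup_add distrib_left single_add sum.distrib)
qed

lemma wpush_single [simp]: "wpush \<omega> g (single t c) = single (g t) (\<omega> t * c)"
  by (cases "c = 0") (simp_all add: wpush_def)

lemma wpush_0 [simp]: "wpush \<omega> g 0 = 0"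
  by (simp add: wpush_def)

lemma wpush_uminus: "wpush \<omega> g (- p) = - wpush \<omega> g p"
  by (rule minus_unique[symmetric]) (simp flip: wpush_add)

lemma wpush_diff: "wpush \<omega> g (p - q) = wpush \<omega> g p - wpush \<omega> g q"
  using wpush_add[of \<omega> g p "- q"] by (simp add: wpush_uminus)

lemma wpush_sum: "wpush \<omega> g (\<Sum>x\<in>A. f x) = (\<Sum>x\<in>A. wpush \<omega> g (f x))"
  by (induction A rule: infinite_finite_induct) (simp_all add: wpush_add)

lemma wpush_wpush: "wpush \<omega>' g' (wpush \<omega> g p) = wpush (\<lambda>t. \<omega>' (g t) * \<omega> t) (g' \<circ> g) p"
  by (induction p rule: poly_induct) (simp_all add: wpush_add mult.assoc)

lemma wpush_cong:
  assumes "\<And>t. t \<in> keys p \<Longrightarrow> \<omega> t = \<omega>' t" "\<And>t. t \<in> keys p \<Longrightarrow> g t = g' t"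
  shows "wpush \<omega> g p = wpush \<omega>' g' p"
  unfolding wpush_def using assms by (intro sum.cong) auto

lemma wpush_weight_add:
  "wpush (\<lambda>t. \<omega> t + \<omega>' t) g p = wpush \<omega> g p + wpush \<omega>' g p"
  by (induction p rule: poly_induct) (simp_all add: wpush_add distrib_right single_add)

lemma wpush_weight_scale:
  "wpush (\<lambda>t. c * \<omega> t) g p = single 0 c * wpush \<omega> g p"
  by (induction p rule: poly_induct) (simp_all add: wpush_add distrib_left mult_single mult.assoc)

lemma lookup_wpush: "lookup (wpush \<omega> g p) w = (\<Sum>t | t \<in> keys p \<and> g t = w. \<omega> t * lookup p t)"
  unfolding wpush_def lookup_sum lookup_single when_def
  by (simp add: sum.inter_filter)

lemma keys_wpush: "keys (wpush \<omega> g p) \<subseteq> {g t | t. t \<in> keys p \<and> \<omega> t \<noteq> 0}"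
proof
  fix w assume "w \<in> keys (wpush \<omega> g p)"
  then have "(\<Sum>t | t \<in> keys p \<and> g t = w. \<omega> t * lookup p t) \<noteq> 0"
    by (simp add: in_keys_iff lookup_wpush)
  then obtain t where "t \<in> keys p" "g t = w" "\<omega> t * lookup p t \<noteq> 0"
    by (metis (mono_tags, lifting) mem_Collect_eq sum.neutral)
  then show "w \<in> {g t | t. t \<in> keys p \<and> \<omega> t \<noteq> 0}" by auto
qed

lemma single_sum: "single t (\<Sum>x\<in>A. f x) = (\<Sum>x\<in>A. single t (f x))"
  by (induction A rule: infinite_finite_induct) (simp_all add: single_add)

text \<open>
  The Leibniz rule for the \<open>s\<close>-th power of an Euler derivation followed by a substitution: on exponents, it is the
  binomial theorem for \<open>h (s + t) = h s + h t\<close>.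
\<close>

lemma wpush_Leibniz:
  assumes g: "\<And>s t. g (s + t) = g s + g t" and h: "\<And>s t. h (s + t) = h s + h t"
  shows "wpush (\<lambda>t. of_nat (h t) ^ s) g (p * q) =
    (\<Sum>u\<le>s. of_nat (s choose u) *
      (wpush (\<lambda>t. of_nat (h t) ^ u) g p * wpush (\<lambda>t. of_nat (h t) ^ (s - u)) g q))"
proof (induction p rule: poly_induct)
  case (single t c)
  show ?case
  proof (induction q rule: poly_induct)
    case (single r d)
    have *: "of_nat (s choose u) * (single (g t) (of_nat (h t) ^ u * c) *
        single (g r) (of_nat (h r) ^ (s - u) * d)) =
      single (g t + g r) (of_nat (s choose u) * of_nat (h t) ^ u * of_nat (h r) ^ (s - u) * (c * d))"
      for u
    proof -
      have "of_nat (s choose u) = single (0 :: monom) (of_nat (s choose u) :: complex)" by simp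
      then show ?thesis by (simp only: mult_single ac_simps add_0_left)
    qed
    have "single (g t + g r) (complex_of_nat (h t + h r) ^ s * (c * d)) =
      (\<Sum>u\<le>s. single (g t + g r)
        (of_nat (s choose u) * of_nat (h t) ^ u * of_nat (h r) ^ (s - u) * (c * d)))"
      by (simp only: of_nat_add binomial_ring sum_distrib_right single_sum)
    then show ?case
      by (subst mult_single) (simp only: wpush_single g h *)
  next
    case (add p q)
    then show ?case by (simp only: distrib_left wpush_add sum.distrib)
  qed
next
  case (add p q)
  then show ?case by (simp only: distrib_left distrib_right wpush_add sum.distrib)
qed

lemma push_mult:
  assumes "\<And>s t. g (s + t) = g s + g t"
  shows "push g (p * q) = push g p * push g q"
  using wpush_Leibniz[where h = "\<lambda>_. 0" and s = 0 and g = g] assms by simp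

section \<open>Identifying variables\<close>

text \<open>
  On monomials, the substitution of the variable \<open>v\<close> for the variable \<open>u\<close>.
\<close>

definition move :: "coord \<Rightarrow> coord \<Rightarrow> monom \<Rightarrow> monom" where
  "move u v t = t + single v (lookup t u) - single u (lookup t u)"

lemma lookup_move:
  "u \<noteq> v \<Longrightarrow> lookup (move u v t) w =
    (if w = u then 0 else if w = v then lookup t v + lookup t u else lookup t w)"
  by (auto simp: move_def minus_poly_mapping.rep_eq lookup_add lookup_single when_def)

lemma move_add: "u \<noteq> v \<Longrightarrow> move u v (s + t) = move u v s + move u v t"
  by (rule poly_mapping_eqI) (simp add: lookup_move lookup_add)

text \<open>
  A monomial is the product of its \<open>xpart\<close> and its \<open>ypart\<close>; both are monomials in all coordinates again, so that
  coefficients with respect to the \<open>x\<^sub>i\<close> live in the same polynomial ring.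
\<close>

lift_definition xpart :: "monom \<Rightarrow> monom" is "\<lambda>t v. case v of X i \<Rightarrow> t v | Y i \<Rightarrow> 0"
  by (erule rev_finite_subset) (auto split: coord.split_asm)

lift_definition ypart :: "monom \<Rightarrow> monom" is "\<lambda>t v. case v of X i \<Rightarrow> 0 | Y i \<Rightarrow> t v"
  by (erule rev_finite_subset) (auto split: coord.split_asm)

lemma lookup_xpart [simp]: "lookup (xpart t) (X i) = lookup t (X i)" "lookup (xpart t) (Y i) = 0"
  by (transfer; simp)+

lemma lookup_ypart [simp]: "lookup (ypart t) (X i) = 0" "lookup (ypart t) (Y i) = lookup t (Y i)"
  by (transfer; simp)+

lemma monom_eqI:
  fixes s t :: monom
  assumes "\<And>i. lookup s (X i) = lookup t (X i)" "\<And>i. lookup s (Y i) = lookup t (Y i)"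
  shows "s = t"
proof (rule poly_mapping_eqI)
  fix v show "lookup s v = lookup t v" using assms by (cases v) auto
qed

lemma xpart_xpart [simp]: "xpart (xpart t) = xpart t"
  by (rule monom_eqI) simp_all

lemma ypart_ypart [simp]: "ypart (ypart t) = ypart t"
  by (rule monom_eqI) simp_all

lemma xpart_add_ypart: "xpart t + ypart t = t"
  by (rule monom_eqI) (simp_all add: lookup_add)

lemma xpart_add: "xpart (s + t) = xpart s + xpart t"
  by (rule monom_eqI) (simp_all add: lookup_add)

lemma ypart_add: "ypart (s + t) = ypart s + ypart t"
  by (rule monom_eqI) (simp_all add: lookup_add)

section \<open>Symmetric and antisymmetric polynomials\<close>

definition perm :: "(nat \<Rightarrow> nat) \<Rightarrow> monom \<Rightarrow> monom" where
  "perm \<sigma> = Poly_Mapping.map_key (rename_coord \<sigma>)"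

lemma lookup_perm [simp]:
  assumes "inj \<sigma>"
  shows "lookup (perm \<sigma> t) (X i) = lookup t (X (\<sigma> i))" "lookup (perm \<sigma> t) (Y i) = lookup t (Y (\<sigma> i))"
  using assms by (simp_all add: perm_def map_key.rep_eq inj_rename_coord)

lemma perm_add: "inj \<sigma> \<Longrightarrow> perm \<sigma> (s + t) = perm \<sigma> s + perm \<sigma> t"
  by (rule monom_eqI) (simp_all add: lookup_add)

lemma perm_perm: "inj \<sigma> \<Longrightarrow> inj \<tau> \<Longrightarrow> perm \<sigma> (perm \<tau> t) = perm (\<tau> \<circ> \<sigma>) t"
  by (rule monom_eqI) (simp_all add: inj_compose)

lemma perm_id [simp]: "perm id t = t"
  by (rule monom_eqI) simp_all

lemma perm_inv: "bij \<sigma> \<Longrightarrow> perm \<sigma> (perm (inv \<sigma>) t) = t" "bij \<sigma> \<Longrightarrow> perm (inv \<sigma>) (perm \<sigma> t) = t"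
  by (simp_all add: perm_perm bij_is_inj bij_imp_bij_inv bij_is_surj surj_iff[THEN iffD1])

lemma lookup_act: "bij \<sigma> \<Longrightarrow> lookup (act \<sigma> p) t = lookup p (perm \<sigma> t)"
  by (simp add: act_def perm_def map_key.rep_eq inj_map_key_rename_coord)

lemma act_eq_push:
  assumes "bij \<sigma>"
  shows "act \<sigma> p = push (perm (inv \<sigma>)) p"
proof (rule poly_mapping_eqI)
  fix w
  have "perm (inv \<sigma>) t = w \<longleftrightarrow> t = perm \<sigma> w" for t
    using perm_inv[OF assms] by metis
  then have "{t. t \<in> keys p \<and> perm (inv \<sigma>) t = w} = {perm \<sigma> w} \<inter> keys p" by auto
  then show "lookup (act \<sigma> p) w = lookup (push (perm (inv \<sigma>)) p) w"
    using assms by (auto simp: lookup_act lookup_wpush in_keys_iff Int_insert_left)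
qed

lemma act_mult: "bij \<sigma> \<Longrightarrow> act \<sigma> (p * q) = act \<sigma> p * act \<sigma> q"
  by (simp add: act_eq_push push_mult perm_add bij_imp_bij_inv bij_is_inj)

lemma lookup_single_0_mult: "lookup (single 0 c * p) t = c * lookup p t" for p :: cpoly
  by (subst mult_map_scale_conv_mult[symmetric]) (simp add: Poly_Mapping.map.rep_eq when_def)

lemma lookup_cscale: "lookup (cscale c p) t = c * lookup p t"
  by (simp add: cscale_def lookup_single_0_mult)

lemma lookup_of_int_mult: "lookup (of_int z * p) t = of_int z * lookup p t" for p :: cpoly
  using lookup_single_0_mult[of "of_int z" p t] by simp

text \<open>
  Only the parity of \<open>e\<close> matters: these are the symmetric polynomials for even \<open>e\<close> and the antisymmetric ones for
  odd \<open>e\<close>.  The parameter treats the two cases together and adds up under multiplication.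
\<close>

definition skew :: "nat \<Rightarrow> nat \<Rightarrow> cpoly set" where
  "skew n e = {p \<in> poly_ring n. \<forall>\<sigma>. \<sigma> permutes {1..n} \<longrightarrow> act \<sigma> p = of_int (sign \<sigma> ^ e) * p}"

lemma skew_0: "skew n 0 = symmetric_polys n"
  by (simp add: skew_def symmetric_polys_def)

lemma skew_1: "skew n (Suc 0) = antisymmetric_polys n"
  by (simp add: skew_def antisymmetric_polys_def)

lemma sign_power_cong: "even e = even e' \<Longrightarrow> sign \<sigma> ^ e = sign \<sigma> ^ e'"
  by (auto simp: sign_def)

lemma skew_cong:
  assumes "even e = even e'"
  shows "skew n e = skew n e'"
proof -
  have "sign \<sigma> ^ e = sign \<sigma> ^ e'" for \<sigma> :: "nat \<Rightarrow> nat" using assms by (rule sign_power_cong)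
  then show ?thesis by (simp only: skew_def)
qed

lemma lookup_skew:
  assumes "p \<in> skew n e" "\<sigma> permutes {1..n}"
  shows "lookup p (perm \<sigma> t) = of_int (sign \<sigma> ^ e) * lookup p t"
proof -
  have "act \<sigma> p = of_int (sign \<sigma> ^ e) * p" using assms by (simp add: skew_def)
  then have "lookup (act \<sigma> p) t = lookup (of_int (sign \<sigma> ^ e) * p) t" by simp
  then show ?thesis
    using assms(2) by (simp only: lookup_act permutes_bij lookup_of_int_mult)
qed

lemma skewI:
  assumes "p \<in> poly_ring n"
    "\<And>\<sigma> t. \<sigma> permutes {1..n} \<Longrightarrow> lookup p (perm \<sigma> t) = of_int (sign \<sigma> ^ e) * lookup p t"
  shows "p \<in> skew n e"
  unfolding skew_def using assms
  by (auto intro!: poly_mapping_eqI simp: lookup_act permutes_bij lookup_of_int_mult simp del: of_int_power)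

lemma perm_in_keys:
  assumes "p \<in> skew n e" "\<sigma> permutes {1..n}" "t \<in> keys p"
  shows "perm \<sigma> t \<in> keys p"
  using lookup_skew[OF assms(1,2), of t] assms(3) by (simp add: in_keys_iff sign_def)

lemma keys_perm_coords:
  assumes "\<sigma> permutes {1..n}" "keys t \<subseteq> coords n"
  shows "keys (perm \<sigma> t) \<subseteq> coords n"
proof
  fix v assume v: "v \<in> keys (perm \<sigma> t)"
  have inj: "inj \<sigma>" using assms(1) by (rule permutes_inj)
  have "rename_coord \<sigma> v \<in> coords n"
    using v assms(2) inj by (cases v) (auto simp: in_keys_iff)
  then show "v \<in> coords n"
    using permutes_in_image[OF assms(1)] by (cases v) (auto simp: coords_def)
qed

lemma coords_iff [simp]: "X i \<in> coords n \<longleftrightarrow> i \<in> {1..n}" "Y i \<in> coords n \<longleftrightarrow> i \<in> {1..n}"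
  by (auto simp: coords_def)

lemma poly_ring_mult: "p \<in> poly_ring n \<Longrightarrow> q \<in> poly_ring n \<Longrightarrow> p * q \<in> poly_ring n"
proof -
  assume "p \<in> poly_ring n" "q \<in> poly_ring n"
  moreover have "keys (s + t) \<subseteq> keys s \<union> keys t" for s t :: monom by (rule keys_add)
  ultimately have "keys t \<subseteq> coords n" if "t \<in> keys (p * q)" for t
    using keys_mult[of p q] that unfolding poly_ring_def by blast
  then show ?thesis by (simp add: poly_ring_def)
qed

lemma subspace_poly_ring: "cpoly.subspace (poly_ring n)"
proof (rule cpoly.subspaceI)
  show "p + q \<in> poly_ring n" if "p \<in> poly_ring n" "q \<in> poly_ring n" for p q
    using that keys_add[of p q] by (auto simp: poly_ring_def)
  show "cscale c p \<in> poly_ring n" if "p \<in> poly_ring n" for c p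
    using that by (auto simp: poly_ring_def in_keys_iff lookup_cscale)
qed (simp add: poly_ring_def)

lemma subspace_skew: "cpoly.subspace (skew n e)"
proof (rule cpoly.subspaceI)
  have sub: "skew n e \<subseteq> poly_ring n" by (auto simp: skew_def)
  show "0 \<in> skew n e" by (rule skewI) (simp_all add: poly_ring_def)
  show "p + q \<in> skew n e" if "p \<in> skew n e" "q \<in> skew n e" for p q
    using that sub lookup_skew[OF that(1)] lookup_skew[OF that(2)]
    by (intro skewI cpoly.subspace_add[OF subspace_poly_ring]) (auto simp: lookup_add distrib_left)
  show "cscale c p \<in> skew n e" if "p \<in> skew n e" for c p
    using that sub lookup_skew[OF that(1)]
    by (intro skewI cpoly.subspace_scale[OF subspace_poly_ring]) (auto simp: lookup_cscale)
qed

lemma skew_mult: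
  assumes "p \<in> skew n e" "q \<in> skew n e'"
  shows "p * q \<in> skew n (e + e')"
  using assms by (auto simp: skew_def poly_ring_mult act_mult permutes_bij power_add ac_simps)

lemma perm_eq_0_iff: "bij \<sigma> \<Longrightarrow> perm \<sigma> t = 0 \<longleftrightarrow> t = 0"
  by (metis perm_inv(2) perm_def map_key_zero inj_rename_coord bij_is_inj bij_imp_bij_inv)

lemma one_skew: "1 \<in> skew n 0"
  by (rule skewI) (auto simp: poly_ring_def lookup_one when_def perm_eq_0_iff permutes_bij)

section \<open>Leading monomials of the powers of the antisymmetric polynomials\<close>

subsection \<open>The linear forms \<open>y\<^sub>i - y\<^sub>j\<close>\<close>

definition ydiff :: "nat \<Rightarrow> nat \<Rightarrow> cpoly" where
  "ydiff i j = single (single (Y i) 1) 1 - single (single (Y j) 1) 1"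

lemma lookup_ydiff: "i \<noteq> j \<Longrightarrow> lookup (ydiff i j) t =
    (if t = single (Y i) 1 then 1 else if t = single (Y j) 1 then -1 else 0)"
proof -
  assume "i \<noteq> j"
  then have "single (Y i) (1::nat) \<noteq> single (Y j) 1"
    by (metis coord.inject(2) lookup_single_eq lookup_single_not_eq zero_neq_one)
  then show ?thesis by (auto simp: ydiff_def lookup_minus lookup_single when_def)
qed

lemma keys_ydiff: "i \<noteq> j \<Longrightarrow> keys (ydiff i j) = {single (Y i) 1, single (Y j) 1}"
  by (auto simp: in_keys_iff lookup_ydiff split: if_splits)

lemma ydiff_nonzero: "i \<noteq> j \<Longrightarrow> ydiff i j \<noteq> 0"
  using keys_ydiff[of i j] by auto

lemma lead_ydiff: "i < j \<Longrightarrow> lead (ydiff i j) = single (Y i) 1"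
proof -
  assume "i < j"
  moreover from this have "single (Y j) 1 < (single (Y i) 1 :: monom)"
    unfolding monom_less_iff by (intro exI[of _ "Y i"]) (auto simp: lookup_single when_def)
  ultimately show ?thesis by (intro lead_eqI) (auto simp: keys_ydiff)
qed

lemma single_single_power: "single (single v d) (1::complex) = single (single v (1::nat)) 1 ^ d"
proof (induction d)
  case (Suc d)
  have "single v (Suc d) = single v 1 + single v d" by (simp flip: single_add)
  then have "single (single v (Suc d)) (1::complex) = single (single v 1) 1 * single (single v d) 1"
    by (simp add: mult_single)
  then show ?case using Suc by simp
qed simp

lemma diff_dvd_power_diff: "(x - y :: 'a::comm_ring_1) dvd x ^ d - y ^ d"
proof (induction d)
  case (Suc d)
  have "x ^ Suc d - y ^ Suc d = x * (x ^ d - y ^ d) + (x - y) * y ^ d" by (simp add: algebra_simps)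
  then show ?case using Suc by simp
qed simp

lemma ydiff_dvd_diff_push:
  assumes "i \<noteq> j"
  shows "ydiff i j dvd f - push (move (Y j) (Y i)) f"
proof (induction f rule: poly_induct)
  case (single t c)
  define d where "d = lookup t (Y j)"
  define r where "r = t - single (Y j) d"
  have "t = r + single (Y j) d" "move (Y j) (Y i) t = r + single (Y i) d"
    using assms
    by (auto intro!: poly_mapping_eqI
        simp: lookup_move r_def d_def lookup_add minus_poly_mapping.rep_eq lookup_single when_def)
  then have "single t c - push (move (Y j) (Y i)) (single t c) =
      single r c * (single (single (Y j) d) 1 - single (single (Y i) d) 1)"
    by (simp add: mult_single right_diff_distrib)
  moreover have "ydiff i j dvd single (single (Y j) d) 1 - single (single (Y i) d) 1"
    unfolding single_single_power[of _ d] ydiff_def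
    using diff_dvd_power_diff[of "single (single (Y i) (1::nat)) (1::complex)"]
    by (metis dvd_minus_iff minus_diff_eq)
  ultimately show ?case by simp
next
  case (add p q)
  then show ?case
    using dvd_add[OF add] by (simp add: wpush_add algebra_simps)
qed

lemma push_ydiff: "i \<noteq> j \<Longrightarrow> push (move (Y j) (Y i)) (ydiff i j) = 0"
proof -
  assume "i \<noteq> j"
  then have "move (Y j) (Y i) (single (Y i) 1) = move (Y j) (Y i) (single (Y j) 1)"
    by (intro poly_mapping_eqI) (simp add: lookup_move lookup_single when_def)
  then show ?thesis by (simp add: ydiff_def wpush_diff)
qed

text \<open>
  Modulo \<open>y\<^sub>i - y\<^sub>j\<close> every polynomial equals the one obtained by putting \<open>y\<^sub>j = y\<^sub>i\<close>.  Hence divisibility by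
  \<open>y\<^sub>i - y\<^sub>j\<close> is the vanishing of a ring homomorphism into an integral domain, and \<open>y\<^sub>i - y\<^sub>j\<close> is prime.
\<close>

lemma ydiff_dvd_iff:
  assumes "i \<noteq> j"
  shows "ydiff i j dvd f \<longleftrightarrow> push (move (Y j) (Y i)) f = 0"
proof
  assume "ydiff i j dvd f"
  then obtain g where "f = ydiff i j * g" by (auto simp: dvd_def)
  then show "push (move (Y j) (Y i)) f = 0"
    using assms by (simp add: push_mult move_add push_ydiff)
next
  assume "push (move (Y j) (Y i)) f = 0"
  then show "ydiff i j dvd f" using ydiff_dvd_diff_push[OF assms, of f] by simp
qed

lemma ydiff_prime:
  "i \<noteq> j \<Longrightarrow> ydiff i j dvd f * g \<longleftrightarrow> ydiff i j dvd f \<or> ydiff i j dvd g"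
  by (simp add: ydiff_dvd_iff push_mult move_add)

lemma not_ydiff_dvd_1: "i \<noteq> j \<Longrightarrow> \<not> ydiff i j dvd 1"
proof -
  assume ij: "i \<noteq> j"
  have "push (move (Y j) (Y i)) (single 0 1) = single 0 1"
    using ij by (subst wpush_single) (auto intro!: arg_cong2[where f = single] monom_eqI simp: lookup_move simp del: single_one)
  then show ?thesis using ij by (simp add: ydiff_dvd_iff)
qed

lemma ydiff_prime_prod:
  assumes "finite L" "i \<noteq> j" "ydiff i j dvd (\<Prod>l\<in>L. f l)"
  shows "\<exists>l\<in>L. ydiff i j dvd f l"
  using assms
proof (induction L rule: finite_induct)
  case empty
  then show ?case by (simp add: not_ydiff_dvd_1)
next
  case (insert l L)
  then show ?case by (auto simp: ydiff_prime)
qed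

lemma ydiff_prime_power: "i \<noteq> j \<Longrightarrow> ydiff i j dvd f ^ e \<Longrightarrow> ydiff i j dvd f"
proof (induction e)
  case 0
  then show ?case by (simp add: not_ydiff_dvd_1)
qed (auto simp: ydiff_prime)

lemma ydiff_power_dvd_cancel:
  assumes "i \<noteq> j" "\<not> ydiff i j dvd f" "ydiff i j ^ e dvd f * g"
  shows "ydiff i j ^ e dvd g"
  using assms(3)
proof (induction e)
  case (Suc e)
  then have "ydiff i j ^ e dvd f * g" by (simp add: dvd_mult_right)
  then obtain h where h: "g = ydiff i j ^ e * h" using Suc by (auto simp: dvd_def)
  from Suc(2) have "ydiff i j ^ e * ydiff i j dvd ydiff i j ^ e * (f * h)"
    by (simp add: h ac_simps)
  then have "ydiff i j dvd f * h"
    using ydiff_nonzero[OF assms(1)] by (simp only: dvd_mult_cancel_left) simp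
  then have "ydiff i j dvd h" using assms by (simp add: ydiff_prime)
  then show ?case by (simp add: h mult.commute mult_dvd_mono)
qed simp

text \<open>
  For fixed \<open>i\<close> the primes \<open>y\<^sub>i - y\<^sub>l\<close> are pairwise coprime, because putting \<open>y\<^sub>l = y\<^sub>i\<close> does not annihilate the
  others.
\<close>

lemma ydiff_prod_dvd:
  assumes "finite L" "i \<notin> L" and dvd: "\<And>l. l \<in> L \<Longrightarrow> ydiff i l ^ e l dvd f"
  shows "(\<Prod>l\<in>L. ydiff i l ^ e l) dvd f"
  using assms
proof (induction L rule: finite_induct)
  case (insert l L)
  then obtain g where g: "f = (\<Prod>l\<in>L. ydiff i l ^ e l) * g" by (auto simp: dvd_def)
  have il: "i \<noteq> l" using insert by auto
  have "\<not> ydiff i l dvd (\<Prod>l\<in>L. ydiff i l ^ e l)"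
  proof
    assume "ydiff i l dvd (\<Prod>l\<in>L. ydiff i l ^ e l)"
    then obtain l' where l': "l' \<in> L" "ydiff i l dvd ydiff i l'"
      using ydiff_prime_prod[OF insert(1) il] ydiff_prime_power[OF il] by blast
    then have "l' \<noteq> l" "l' \<noteq> i" using insert by auto
    then have "move (Y l) (Y i) (single (Y i) 1) = single (Y i) 1"
      "move (Y l) (Y i) (single (Y l') 1) = single (Y l') 1"
      using il by (auto intro!: poly_mapping_eqI simp: lookup_move lookup_single when_def)
    then have "push (move (Y l) (Y i)) (ydiff i l') = ydiff i l'"
      by (simp add: ydiff_def wpush_diff)
    then show False using l'(2) il \<open>l' \<noteq> i\<close> ydiff_nonzero by (simp add: ydiff_dvd_iff)
  qed
  moreover have "ydiff i l ^ e l dvd (\<Prod>l\<in>L. ydiff i l ^ e l) * g"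
    using insert.prems(2)[of l] by (simp add: g)
  ultimately have "ydiff i l ^ e l dvd g"
    by (rule ydiff_power_dvd_cancel[OF il])
  then have "(\<Prod>l\<in>L. ydiff i l ^ e l) * ydiff i l ^ e l dvd f"
    unfolding g by (rule mult_dvd_mono[OF dvd_refl])
  then show ?case using insert(1,2) by (simp add: mult.commute)
qed simp

subsection \<open>Order of vanishing where two points coincide\<close>

lemma double_eq_0_cpoly: "p + p = 0 \<Longrightarrow> p = 0" for p :: cpoly
  by (simp flip: mult_2)

text \<open>
  An antisymmetric polynomial vanishes where two points coincide: exchanging the two points changes its sign, but not
  its restriction to that locus.
\<close>

lemma push_merge_antisymmetric:
  assumes f: "f \<in> antisymmetric_polys n" and ij: "i \<in> {1..n}" "j \<in> {1..n}" "i \<noteq> j"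
  shows "push (move (Y j) (Y i) \<circ> move (X j) (X i)) f = 0"
proof -
  let ?G = "move (Y j) (Y i) \<circ> move (X j) (X i)" and ?\<tau> = "Transposition.transpose i j"
  have \<tau>: "?\<tau> permutes {1..n}" using ij by (intro permutes_swap_id) auto
  have "push ?G (- f) = push ?G (act ?\<tau> f)"
    using f \<tau> ij by (simp add: antisymmetric_polys_def sign_swap_id)
  also have "\<dots> = push (?G \<circ> perm (inv ?\<tau>)) f"
    using \<tau> by (simp only: act_eq_push permutes_bij wpush_wpush mult_1)
  also have "?G \<circ> perm (inv ?\<tau>) = ?G"
  proof
    fix t
    have "inj ?\<tau>" using \<tau> permutes_inj by blast
    then show "(?G \<circ> perm (inv ?\<tau>)) t = ?G t"
      using ij by (intro monom_eqI) (auto simp: lookup_move transpose_def)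
  qed
  finally have "- push ?G f = push ?G f" unfolding wpush_uminus .
  then have "push ?G f + push ?G f = 0" by (metis add.right_inverse)
  then show ?thesis by (rule double_eq_0_cpoly)
qed

lemma ydiff_dvd_push_antisymmetric:
  assumes "f \<in> antisymmetric_polys n" "i \<in> {1..n}" "j \<in> {1..n}" "i \<noteq> j"
  shows "ydiff i j dvd push (move (X j) (X i)) f"
  unfolding ydiff_dvd_iff[OF assms(4)] wpush_wpush mult_1 by (rule push_merge_antisymmetric[OF assms])

text \<open>
  After putting \<open>x\<^sub>j = x\<^sub>i\<close> each antisymmetric factor is divisible by \<open>y\<^sub>i - y\<^sub>j\<close>.  By the Leibniz rule, \<open>s\<close>
  derivatives with respect to \<open>x\<^sub>i\<close> spare all but at most \<open>s\<close> of the factors.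
\<close>

lemma ydiff_power_dvd_wpush_prod:
  assumes "set ps \<subseteq> antisymmetric_polys n" and ij: "i \<in> {1..n}" "j \<in> {1..n}" "i \<noteq> j"
  shows "ydiff i j ^ (length ps - s) dvd
    wpush (\<lambda>t. of_nat (lookup t (X i)) ^ s) (move (X j) (X i)) (prod_list ps)"
  using assms(1)
proof (induction ps arbitrary: s)
  case (Cons f ps)
  let ?W = "\<lambda>s. wpush (\<lambda>t. of_nat (lookup t (X i)) ^ s) (move (X j) (X i))"
  have "ydiff i j ^ (length (f # ps) - s) dvd ?W u f * ?W (s - u) (prod_list ps)" if "u \<le> s" for u
  proof (cases "u = 0")
    case True
    \<comment> \<open>No derivative falls on \<open>f\<close>, which contributes one factor \<open>y\<^sub>i - y\<^sub>j\<close>.\<close>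
    have "ydiff i j dvd ?W 0 f"
      using ydiff_dvd_push_antisymmetric[OF _ ij, of f] Cons(2) by simp
    moreover have "ydiff i j ^ (length ps - s) dvd ?W s (prod_list ps)" using Cons by simp
    ultimately have "ydiff i j * ydiff i j ^ (length ps - s) dvd ?W 0 f * ?W s (prod_list ps)"
      by (rule mult_dvd_mono)
    moreover have "ydiff i j ^ (length (f # ps) - s) dvd ydiff i j * ydiff i j ^ (length ps - s)"
      unfolding power_Suc[symmetric] by (rule le_imp_power_dvd) simp
    ultimately show ?thesis using True dvd_trans by simp
  next
    case False
    \<comment> \<open>The derivatives lost to \<open>f\<close> are not applied to the remaining factors.\<close>
    then have "ydiff i j ^ (length (f # ps) - s) dvd ydiff i j ^ (length ps - (s - u))"
      using that by (intro le_imp_power_dvd) simp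
    also have "\<dots> dvd ?W (s - u) (prod_list ps)" using Cons by simp
    finally show ?thesis by simp
  qed
  then have "ydiff i j ^ (length (f # ps) - s) dvd
      (\<Sum>u\<le>s. of_nat (s choose u) * (?W u f * ?W (s - u) (prod_list ps)))"
    by (intro dvd_sum dvd_mult[of _ "_ * _"]) simp
  moreover have "?W s (prod_list (f # ps)) =
      (\<Sum>u\<le>s. of_nat (s choose u) * (?W u f * ?W (s - u) (prod_list ps)))"
    unfolding prod_list.Cons
    by (rule wpush_Leibniz) (use ij in \<open>simp_all add: move_add lookup_add\<close>)
  ultimately show ?case by simp
qed simp

lemma A_pow_0: "A_pow n 0 = skew n 0"
  by (simp add: A_pow_def skew_0)

lemma ydiff_power_dvd_wpush:
  assumes "p \<in> A_pow n (int m)" and ij: "i \<in> {1..n}" "j \<in> {1..n}" "i \<noteq> j"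
  shows "ydiff i j ^ (m - s) dvd wpush (\<lambda>t. of_nat (lookup t (X i)) ^ s) (move (X j) (X i)) p"
proof (cases "m = 0")
  case False
  let ?W = "wpush (\<lambda>t. of_nat (lookup t (X i)) ^ s) (move (X j) (X i))"
  let ?V = "{p. ydiff i j ^ (m - s) dvd ?W p}"
  have scale: "?W (cscale c p) = single 0 c * ?W p" for c p
    unfolding wpush_weight_scale[symmetric]
    by (induction p rule: poly_induct) (simp_all add: cscale_def distrib_left wpush_add distrib_right mult_single mult.assoc mult.left_commute)
  have "cpoly.subspace ?V"
    by (rule cpoly.subspaceI) (simp_all add: wpush_add dvd_add scale)
  moreover have "{prod_list ps | ps. length ps = m \<and> set ps \<subseteq> antisymmetric_polys n} \<subseteq> ?V"
    using ydiff_power_dvd_wpush_prod[OF _ ij] by auto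
  ultimately have "cpoly.span {prod_list ps | ps. length ps = m \<and> set ps \<subseteq> antisymmetric_polys n} \<subseteq> ?V"
    by (rule cpoly.span_minimal[rotated])
  then show ?thesis using assms False by (auto simp: A_pow_def)
qed simp

lemma A_pow_subset_skew: "A_pow n (int m) \<subseteq> skew n m"
proof (cases "m = 0")
  case False
  have "prod_list ps \<in> skew n (length ps)" if "set ps \<subseteq> antisymmetric_polys n" for ps
    using that
  proof (induction ps)
    case (Cons p ps)
    then show ?case using skew_mult[of p n 1 "prod_list ps" "length ps"] by (simp add: skew_1)
  qed (simp add: one_skew)
  then have "{prod_list ps | ps. length ps = m \<and> set ps \<subseteq> antisymmetric_polys n} \<subseteq> skew n m"
    by blast
  then have "cpoly.span {prod_list ps | ps. length ps = m \<and> set ps \<subseteq> antisymmetric_polys n} \<subseteq> skew n m"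
    by (rule cpoly.span_minimal[OF _ subspace_skew])
  then show ?thesis using False by (simp add: A_pow_def)
qed (simp add: A_pow_0)

subsection \<open>The coefficient of a monomial in the \<open>x\<^sub>i\<close>\<close>

definition xcoeff :: "monom \<Rightarrow> cpoly \<Rightarrow> cpoly" where
  "xcoeff a p = wpush (\<lambda>t. of_bool (xpart t = a)) ypart p"

lemma lookup_xcoeff:
  "lookup (xcoeff a p) b = (if xpart a = a \<and> ypart b = b then lookup p (a + b) else 0)"
proof -
  have "lookup (xcoeff a p) b = (\<Sum>t\<in>{t \<in> keys p. ypart t = b}. if xpart t = a then lookup p t else 0)"
    unfolding xcoeff_def lookup_wpush by (intro sum.cong) auto
  also have "\<dots> = (\<Sum>t\<in>{t \<in> keys p. ypart t = b \<and> xpart t = a}. lookup p t)"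
    by (rule sum.mono_neutral_cong_right) (auto intro: finite_subset[OF _ finite_keys])
  also have "{t \<in> keys p. ypart t = b \<and> xpart t = a} =
      (if xpart a = a \<and> ypart b = b then {a + b} \<inter> keys p else {})"
  proof -
    have "ypart t = b \<and> xpart t = a \<longleftrightarrow> xpart a = a \<and> ypart b = b \<and> t = a + b" for t
    proof
      assume "ypart t = b \<and> xpart t = a"
      then show "xpart a = a \<and> ypart b = b \<and> t = a + b"
        using xpart_add_ypart[of t] xpart_xpart[of t] ypart_ypart[of t] by metis
    next
      assume *: "xpart a = a \<and> ypart b = b \<and> t = a + b"
      have "lookup a (Y i) = 0" "lookup b (X i) = 0" for i
        using * lookup_xpart(2)[of a i] lookup_ypart(1)[of b i] by auto
      then show "ypart t = b \<and> xpart t = a" using * by (auto intro!: monom_eqI simp: lookup_add)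
    qed
    then show ?thesis by auto
  qed
  finally show ?thesis by (simp add: Int_insert_left in_keys_iff)
qed

lemma xcoeff_mult_ypoly:
  assumes "\<And>s. s \<in> keys e \<Longrightarrow> xpart s = 0"
  shows "xcoeff a (e * f) = e * xcoeff a f"
proof -
  have *: "xcoeff a (single s c * f) = single s c * xcoeff a f" if "xpart s = 0" for s c
  proof -
    have "ypart s = s" using that xpart_add_ypart[of s] by simp
    then show ?thesis using that
      by (induction f rule: poly_induct)
        (simp_all add: xcoeff_def distrib_left wpush_add mult_single xpart_add ypart_add mult.left_commute)
  qed
  have "xcoeff a (e * f) = xcoeff a (\<Sum>s\<in>keys e. single s (lookup e s) * f)"
    by (simp flip: sum_distrib_right poly_eq_sum_single)
  also have "\<dots> = (\<Sum>s\<in>keys e. xcoeff a (single s (lookup e s) * f))"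
    by (simp add: xcoeff_def wpush_sum)
  also have "\<dots> = (\<Sum>s\<in>keys e. single s (lookup e s) * xcoeff a f)"
    using assms by (intro sum.cong) (simp_all add: *)
  also have "\<dots> = e * xcoeff a f"
    by (simp flip: sum_distrib_right poly_eq_sum_single)
  finally show ?thesis .
qed

lemma xcoeff_ydiff_power: "i \<noteq> j \<Longrightarrow> xcoeff a (ydiff i j ^ e * f) = ydiff i j ^ e * xcoeff a f"
proof (induction e arbitrary: f)
  case (Suc e)
  have "xcoeff a (ydiff i j * f) = ydiff i j * xcoeff a f" for f
    by (rule xcoeff_mult_ypoly)
      (use Suc in \<open>auto simp: keys_ydiff lookup_single intro!: monom_eqI\<close>)
  then show ?case using Suc by (simp add: mult.assoc)
qed simp

text \<open>
  Group the terms of \<open>p\<close> by the exponent \<open>u\<close> of \<open>x\<^sub>i\<close>, the other exponents of the \<open>x\<^sub>l\<close> and the sum of the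
  exponents of \<open>x\<^sub>i\<close> and \<open>x\<^sub>j\<close> being those of \<open>a\<close>, and let \<open>q\<^sub>u\<close> be the coefficients.  Vanishing to order \<open>m\<close> says
  that \<open>\<Sum>\<^sub>u u\<^sup>s q\<^sub>u\<close> is divisible by \<open>(y\<^sub>i - y\<^sub>j)\<^bsup>m-s\<^esup>\<close> for all \<open>s\<close>.  If \<open>u\<close> ranges over a finite set \<open>U\<close>, a
  Lagrange polynomial of degree \<open>card U - 1\<close> in \<open>u\<close> isolates a single coefficient.
\<close>

lemma ydiff_power_dvd_xcoeff:
  assumes p: "p \<in> A_pow n (int m)" and ij: "i \<in> {1..n}" "j \<in> {1..n}" "i \<noteq> j"
    and a: "xpart a = a" and U: "finite U" "lookup a (X i) \<in> U"
    and range: "\<And>t. t \<in> keys p \<Longrightarrow> xpart (move (X j) (X i) t) = xpart (move (X j) (X i) a)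
      \<Longrightarrow> lookup t (X i) \<in> U"
  shows "ydiff i j ^ (m - (card U - 1)) dvd xcoeff a p"
proof -
  let ?g = "move (X j) (X i)"
  let ?h = "\<lambda>t. of_nat (lookup t (X i)) :: complex"
  define W where "W \<omega> = wpush (\<lambda>t. of_bool (xpart (?g t) = xpart (?g a)) * \<omega> t) ypart p" for \<omega>
  have power: "ydiff i j ^ (m - s) dvd W (\<lambda>t. ?h t ^ s)" for s
  proof -
    obtain r where r: "wpush (\<lambda>t. ?h t ^ s) ?g p = ydiff i j ^ (m - s) * r"
      using ydiff_power_dvd_wpush[OF p ij, of s] by (auto simp: dvd_def)
    have "ypart \<circ> ?g = ypart"
      using ij by (intro ext monom_eqI) (simp_all add: lookup_move)
    then have "W (\<lambda>t. ?h t ^ s) = xcoeff (xpart (?g a)) (wpush (\<lambda>t. ?h t ^ s) ?g p)"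
      unfolding xcoeff_def wpush_wpush by (simp only: W_def)
    also have "\<dots> = ydiff i j ^ (m - s) * xcoeff (xpart (?g a)) r"
      by (simp only: r xcoeff_ydiff_power[OF ij(3)])
    finally show ?thesis by simp
  qed
  \<comment> \<open>From powers of the exponent to products of linear polynomials in it.\<close>
  have prod: "ydiff i j ^ (m - (s + card V)) dvd W (\<lambda>t. ?h t ^ s * (\<Prod>v\<in>V. ?h t - of_nat v))"
    if "finite V" for V s
    using that
  proof (induction V arbitrary: s rule: finite_induct)
    case empty
    then show ?case using power by simp
  next
    case (insert v V)
    let ?P = "\<lambda>t. \<Prod>v\<in>V. ?h t - of_nat v"
    have "W (\<lambda>t. ?h t ^ s * (\<Prod>v\<in>insert v V. ?h t - of_nat v)) =
        W (\<lambda>t. ?h t ^ Suc s * ?P t) + single 0 (- of_nat v) * W (\<lambda>t. ?h t ^ s * ?P t)"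
      unfolding W_def wpush_weight_scale[symmetric] wpush_weight_add[symmetric]
      using insert(1,2) by (intro wpush_cong) (simp_all add: algebra_simps)
    moreover have "ydiff i j ^ (m - (s + card (insert v V))) dvd W (\<lambda>t. ?h t ^ Suc s * ?P t)"
      using insert.IH[of "Suc s"] insert(1,2) by simp
    moreover have "ydiff i j ^ (m - (s + card (insert v V))) dvd W (\<lambda>t. ?h t ^ s * ?P t)"
      by (rule dvd_trans[OF le_imp_power_dvd insert.IH[of s]]) (use insert(1,2) in simp)
    ultimately show ?case by (simp only: dvd_add dvd_mult)
  qed
  define V where "V = U - {lookup a (X i)}"
  define c where "c = (\<Prod>v\<in>V. ?h a - of_nat v)"
  have c: "c \<noteq> 0" using U by (auto simp: c_def V_def)
  have "W (\<lambda>t. \<Prod>v\<in>V. ?h t - of_nat v) = wpush (\<lambda>t. c * of_bool (xpart t = a)) ypart p"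
    unfolding W_def
  proof (rule wpush_cong)
    fix t assume t: "t \<in> keys p"
    show "of_bool (xpart (?g t) = xpart (?g a)) * (\<Prod>v\<in>V. ?h t - of_nat v) = c * of_bool (xpart t = a)"
    proof (cases "xpart (?g t) = xpart (?g a)")
      case True
      have merged: "lookup (?g t) (X l) = lookup (?g a) (X l)" for l
        using arg_cong[OF True, of "\<lambda>r. lookup r (X l)"] by simp
      show ?thesis
      proof (cases "lookup t (X i) = lookup a (X i)")
        case eq: True
        have "xpart t = xpart a"
        proof (rule monom_eqI)
          fix l show "lookup (xpart t) (X l) = lookup (xpart a) (X l)"
            using merged[of l] merged[of i] eq ij(3)
            by (cases "l = j"; cases "l = i") (simp_all add: lookup_move)
        qed simp
        then show ?thesis using True eq a by (simp add: c_def)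
      next
        case neq: False
        then have "lookup t (X i) \<in> V" using range[OF t True] by (simp add: V_def)
        moreover have "xpart t \<noteq> a" using neq by auto
        ultimately show ?thesis using U by (auto simp: V_def)
      qed
    next
      case False
      have "xpart (?g t) = xpart (?g a)" if "xpart t = a"
      proof (rule monom_eqI)
        fix l show "lookup (xpart (?g t)) (X l) = lookup (xpart (?g a)) (X l)"
          using ij(3) unfolding that[symmetric] by (simp add: lookup_move)
      qed simp
      then show ?thesis using False by auto
    qed
  qed simp
  also have "\<dots> = single 0 c * xcoeff a p"
    by (simp only: wpush_weight_scale xcoeff_def)
  finally have "ydiff i j ^ (m - card V) dvd single 0 c * xcoeff a p"
    using prod[of V 0] U by (simp add: V_def)
  then have "ydiff i j ^ (m - card V) dvd single 0 (1 / c) * (single 0 c * xcoeff a p)"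
    by (rule dvd_mult)
  moreover have "single 0 (1 / c) * (single 0 c * xcoeff a p) = xcoeff a p"
    using c by (simp add: mult_single flip: mult.assoc)
  ultimately show ?thesis using U by (simp add: V_def)
qed

subsection \<open>Bounds for the leading monomial\<close>

text \<open>
  Small indices and the \<open>x\<close>-coordinates matter most, so moving the lexicographically larger of two points to the
  smaller index increases the monomial.
\<close>

lemma perm_transpose_less:
  assumes "i < j"
  shows "lookup t (X i) < lookup t (X j) \<or>
      lookup t (X i) = lookup t (X j) \<and> lookup t (Y i) < lookup t (Y j)
    \<Longrightarrow> t < perm (Transposition.transpose i j) t"
proof -
  let ?\<tau> = "Transposition.transpose i j"
  have inj: "inj ?\<tau>" by (rule bij_is_inj[OF bij_swap_iff[THEN iffD2, OF bij_id, unfolded id_def comp_def]])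
  assume "lookup t (X i) < lookup t (X j) \<or>
      lookup t (X i) = lookup t (X j) \<and> lookup t (Y i) < lookup t (Y j)"
  then show ?thesis
  proof
    assume *: "lookup t (X i) < lookup t (X j)"
    show ?thesis
      unfolding monom_less_iff
    proof (intro exI[of _ "X i"] conjI allI impI)
      fix w assume "w < X i"
      then show "lookup t w = lookup (perm ?\<tau> t) w"
        using inj assms by (cases w) (auto simp: transpose_def)
    qed (use * inj in simp)
  next
    assume *: "lookup t (X i) = lookup t (X j) \<and> lookup t (Y i) < lookup t (Y j)"
    show ?thesis
      unfolding monom_less_iff
    proof (intro exI[of _ "Y i"] conjI allI impI)
      fix w assume "w < Y i"
      then show "lookup t w = lookup (perm ?\<tau> t) w"
        using inj assms * by (cases w) (auto simp: transpose_def)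
    qed (use * inj in simp)
  qed
qed

text \<open>
  The points of \<open>t\<close> decrease lexicographically, and points with the same first coordinate differ by at least \<open>e\<close> in
  the second one: for \<open>e = 0\<close> this is a weakly, for \<open>e = 1\<close> a strictly decreasing sequence of points.
\<close>

definition gap_sorted :: "nat \<Rightarrow> nat \<Rightarrow> monom \<Rightarrow> bool" where
  "gap_sorted n e t \<longleftrightarrow> (\<forall>i\<in>{1..n}. \<forall>j\<in>{1..n}. i < j \<longrightarrow> lookup t (X j) < lookup t (X i) \<or>
     lookup t (X j) = lookup t (X i) \<and> lookup t (Y j) + e \<le> lookup t (Y i))"

lemma lead_gap_sorted:
  assumes p: "p \<in> skew n e" "p \<noteq> 0"
  shows "gap_sorted n 0 (lead p)"
  unfolding gap_sorted_def add_0_right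
proof (intro ballI impI)
  fix i j assume ij: "i \<in> {1..n}" "j \<in> {1..n}" "i < j"
  have "perm (Transposition.transpose i j) (lead p) \<in> keys p"
    using ij p by (intro perm_in_keys[OF p(1)] permutes_swap_id lead_in_keys)
  then have "\<not> lead p < perm (Transposition.transpose i j) (lead p)"
    using le_lead by (simp add: not_less)
  then show "lookup (lead p) (X j) < lookup (lead p) (X i) \<or>
     lookup (lead p) (X j) = lookup (lead p) (X i) \<and> lookup (lead p) (Y j) \<le> lookup (lead p) (Y i)"
    using perm_transpose_less[OF ij(3), of "lead p"] by linarith
qed

text \<open>
  The upper bound on the exponent of \<open>x\<^sub>i\<close> is the maximality of the leading monomial.  Exchanging the points \<open>i\<close> and
  \<open>j\<close> turns it into an upper bound for the exponent of \<open>x\<^sub>j\<close>, hence a lower bound for that of \<open>x\<^sub>i\<close>.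
\<close>

lemma lead_merge_range:
  assumes p: "p \<in> skew n e" "p \<noteq> 0" and ij: "i \<in> {1..n}" "j \<in> {1..n}" "i < j"
    and t: "t \<in> keys p" "xpart (move (X j) (X i) t) = xpart (move (X j) (X i) (lead p))"
  shows "lookup t (X i) \<in> {lookup (lead p) (X j)..lookup (lead p) (X i)}"
proof -
  let ?g = "move (X j) (X i)" and ?\<tau> = "Transposition.transpose i j"
  have \<tau>: "?\<tau> permutes {1..n}" using ij by (intro permutes_swap_id) auto
  have le: "lookup s (X i) \<le> lookup (lead p) (X i)"
    if s: "s \<in> keys p" "xpart (?g s) = xpart (?g (lead p))" for s
  proof (rule ccontr)
    assume "\<not> ?thesis"
    moreover have "lookup s w = lookup (lead p) w" if w: "w < X i" for w
    proof (cases w)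
      case (X l)
      then show ?thesis
        using arg_cong[OF s(2), of "\<lambda>r. lookup r (X l)"] w ij by (simp add: lookup_move)
    qed (use w in simp)
    ultimately have "lead p < s" unfolding monom_less_iff by (intro exI[of _ "X i"]) auto
    then show False using le_lead[OF s(1)] by simp
  qed
  have inj: "inj ?\<tau>" using \<tau> permutes_inj by blast
  have "xpart (?g (perm ?\<tau> t)) = xpart (?g t)"
    using ij inj by (intro monom_eqI) (auto simp: lookup_move transpose_def)
  then have "lookup (perm ?\<tau> t) (X i) \<le> lookup (lead p) (X i)"
    using t(2) perm_in_keys[OF p(1) \<tau> t(1)] by (intro le) simp_all
  then have "lookup t (X j) \<le> lookup (lead p) (X i)" using inj by simp
  moreover have "lookup t (X i) + lookup t (X j) = lookup (lead p) (X i) + lookup (lead p) (X j)"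
    using arg_cong[OF t(2), of "\<lambda>r. lookup r (X i)"] ij by (simp add: lookup_move)
  ultimately show ?thesis using le[OF t] by simp
qed

lemma ydiff_power_dvd_xcoeff_lead:
  assumes p: "p \<in> A_pow n (int m)" "p \<noteq> 0" and ij: "i \<in> {1..n}" "j \<in> {1..n}" "i < j"
  shows "ydiff i j ^ (m - (lookup (lead p) (X i) - lookup (lead p) (X j)))
    dvd xcoeff (xpart (lead p)) p"
proof -
  have skew: "p \<in> skew n m" using p A_pow_subset_skew by auto
  let ?U = "{lookup (lead p) (X j)..lookup (lead p) (X i)}"
  have le: "lookup (lead p) (X j) \<le> lookup (lead p) (X i)"
    using lead_gap_sorted[OF skew p(2)] ij unfolding gap_sorted_def by force
  have "xpart (move (X j) (X i) (xpart (lead p))) = xpart (move (X j) (X i) (lead p))"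
    using ij by (intro monom_eqI) (simp_all add: lookup_move)
  then have "ydiff i j ^ (m - (card ?U - 1)) dvd xcoeff (xpart (lead p)) p"
    using ij le lead_merge_range[OF skew p(2) ij]
    by (intro ydiff_power_dvd_xcoeff[OF p(1)]) simp_all
  then show ?thesis using le by (simp add: Suc_diff_le)
qed

lemma keys_xcoeff_lead:
  assumes "b \<in> keys (xcoeff (xpart (lead p)) p)"
  shows "xpart (lead p) + b \<in> keys p" "ypart b = b"
  using assms by (auto simp: in_keys_iff lookup_xcoeff split: if_splits)

lemma lead_xcoeff_lead:
  assumes "p \<noteq> 0"
  shows "xcoeff (xpart (lead p)) p \<noteq> 0" "lead (xcoeff (xpart (lead p)) p) = ypart (lead p)"
proof -
  have in_keys: "ypart (lead p) \<in> keys (xcoeff (xpart (lead p)) p)"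
    using lookup_lead[OF assms] by (simp add: in_keys_iff lookup_xcoeff xpart_add_ypart)
  then show "xcoeff (xpart (lead p)) p \<noteq> 0" by auto
  show "lead (xcoeff (xpart (lead p)) p) = ypart (lead p)"
  proof (rule lead_eqI[OF in_keys])
    fix b assume "b \<in> keys (xcoeff (xpart (lead p)) p)"
    then have "xpart (lead p) + b \<le> xpart (lead p) + ypart (lead p)"
      unfolding xpart_add_ypart by (intro le_lead keys_xcoeff_lead)
    then show "b \<le> ypart (lead p)" by simp
  qed
qed

lemma single_dvd:
  fixes q :: cpoly
  assumes "\<And>b. b \<in> keys q \<Longrightarrow> f \<le> lookup b v"
  shows "single (single v f) 1 dvd q"
proof -
  have "single (single v f) 1 dvd (\<Sum>b\<in>keys q. single b (lookup q b))"
  proof (rule dvd_sum)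
    fix b assume "b \<in> keys q"
    then have "b = single v f + (b - single v f)"
      using assms[of b]
      by (intro poly_mapping_eqI) (auto simp: lookup_add minus_poly_mapping.rep_eq lookup_single when_def)
    then have "single b (lookup q b) = single (single v f) 1 * single (b - single v f) (lookup q b)"
      by (simp add: mult_single)
    then show "single (single v f) 1 dvd single b (lookup q b)" by simp
  qed
  then show ?thesis by (simp flip: poly_eq_sum_single)
qed

lemma lead_1 [simp]: "lead (1 :: cpoly) = 0"
  by (simp add: lead_def)

lemma lookup_lead_power:
  fixes p :: cpoly
  assumes "p \<noteq> 0"
  shows "lookup (lead (p ^ e)) v = e * lookup (lead p) v"
  using assms by (induction e) (simp_all add: lead_mult lookup_add)

lemma lookup_lead_prod:
  fixes f :: "'i \<Rightarrow> cpoly"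
  assumes "\<And>l. l \<in> L \<Longrightarrow> f l \<noteq> 0"
  shows "lookup (lead (\<Prod>l\<in>L. f l)) v = (\<Sum>l\<in>L. lookup (lead (f l)) v)"
  using assms
  by (induction L rule: infinite_finite_induct) (simp_all add: lead_mult lookup_add)

text \<open>
  The coefficient of the leading monomial in the \<open>x\<^sub>l\<close> is divisible by \<open>y\<^sub>i\<^bsup>k-a\<^sub>i\<^esup>\<close> and by the powers of
  \<open>y\<^sub>i - y\<^sub>l\<close>, for \<open>l > i\<close>, found above.  These are pairwise coprime, and each has a power of \<open>y\<^sub>i\<close> as its leading
  monomial, so their exponents add up.
\<close>

lemma lead_bound:
  assumes p: "p \<in> A_pow n (int m)" "p \<noteq> 0" and i: "i \<in> {1..n}"
    and k: "\<And>t. t \<in> keys p \<Longrightarrow> k \<le> lookup t (X i) + lookup t (Y i)"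
  shows "(k - lookup (lead p) (X i)) +
      (\<Sum>l\<in>{i<..n}. m - (lookup (lead p) (X i) - lookup (lead p) (X l))) \<le> lookup (lead p) (Y i)"
proof -
  define q where "q = xcoeff (xpart (lead p)) p"
  define f where "f = k - lookup (lead p) (X i)"
  define e where "e l = m - (lookup (lead p) (X i) - lookup (lead p) (X l))" for l
  define y :: cpoly where "y = single (single (Y i) f) 1"
  define L where "L = {i<..n}"
  have "y dvd q"
    unfolding y_def
  proof (rule single_dvd)
    fix b assume "b \<in> keys q"
    then have "xpart (lead p) + b \<in> keys p" "ypart b = b"
      using keys_xcoeff_lead by (auto simp: q_def)
    moreover from this have "lookup b (X i) = 0" using lookup_ypart(1)[of b i] by simp
    ultimately show "f \<le> lookup b (Y i)" using k by (fastforce simp: f_def lookup_add)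
  qed
  then obtain q' where q': "q = y * q'" by (auto simp: dvd_def)
  have "(\<Prod>l\<in>L. ydiff i l ^ e l) dvd q'"
  proof (rule ydiff_prod_dvd)
    fix l assume l: "l \<in> L"
    then have il: "i < l" "l \<in> {1..n}" using i by (auto simp: L_def)
    have "move (Y l) (Y i) (single (Y i) f) = single (Y i) f"
      using il by (intro poly_mapping_eqI) (simp add: lookup_move lookup_single when_def)
    then have "\<not> ydiff i l dvd y"
      using il by (simp add: ydiff_dvd_iff y_def) (metis lookup_single_eq lookup_zero zero_neq_one)
    moreover have "ydiff i l ^ e l dvd y * q'"
      using ydiff_power_dvd_xcoeff_lead[OF p i il(2,1)] by (simp add: e_def q_def flip: q')
    ultimately show "ydiff i l ^ e l dvd q'"
      by (rule ydiff_power_dvd_cancel[OF less_imp_neq[OF il(1)]])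
  qed (auto simp: L_def)
  then obtain h where h: "q = y * ((\<Prod>l\<in>L. ydiff i l ^ e l) * h)" using q' by (auto simp: dvd_def)
  have nz: "q \<noteq> 0" "lead q = ypart (lead p)" using lead_xcoeff_lead[OF p(2)] by (auto simp: q_def)
  have e: "lookup (lead (\<Prod>l\<in>L. ydiff i l ^ e l)) (Y i) = (\<Sum>l\<in>L. e l)"
  proof -
    have "ydiff i l \<noteq> 0" "lookup (lead (ydiff i l)) (Y i) = 1" if "l \<in> L" for l
      using that by (simp_all add: L_def ydiff_nonzero lead_ydiff)
    then show ?thesis by (subst lookup_lead_prod) (auto simp: lookup_lead_power)
  qed
  have "lookup (lead q) (Y i) = lookup (lead y) (Y i) +
      (lookup (lead (\<Prod>l\<in>L. ydiff i l ^ e l)) (Y i) + lookup (lead h) (Y i))"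
    using nz(1) unfolding h by (subst lead_mult | simp add: lookup_add)+
  then show ?thesis
    unfolding e nz(2) by (simp add: y_def f_def e_def L_def)
qed

lemma act_power: "bij \<sigma> \<Longrightarrow> act \<sigma> (p ^ e) = act \<sigma> p ^ e"
proof (induction e)
  case 0
  then have "act \<sigma> 1 = 1"
    by (intro poly_mapping_eqI) (simp add: lookup_act lookup_one when_def perm_eq_0_iff)
  then show ?case by simp
qed (simp add: act_mult)

lemma act_ydiff: "bij \<sigma> \<Longrightarrow> act \<sigma> (ydiff i j) = ydiff (\<sigma> i) (\<sigma> j)"
  by (simp only: ydiff_def act_Y[symmetric]) (simp add: act_eq_push wpush_diff)

text \<open>
  If \<open>a\<^sub>i = a\<^sub>j\<close>, the coefficient \<open>q\<close> is divisible by \<open>(y\<^sub>i - y\<^sub>j)\<^sup>m\<close>, and exchanging \<open>i\<close> and \<open>j\<close> multiplies both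
  by \<open>(-1)\<^sup>m\<close>.  So the quotient is symmetric in \<open>i\<close> and \<open>j\<close>, and its leading exponent of \<open>y\<^sub>i\<close> is at least that of
  \<open>y\<^sub>j\<close>; the factor contributes \<open>m\<close> more to \<open>y\<^sub>i\<close>.
\<close>

lemma lead_block_bound:
  assumes p: "p \<in> A_pow n (int m)" "p \<noteq> 0" and ij: "i \<in> {1..n}" "j \<in> {1..n}" "i < j"
    and eq: "lookup (lead p) (X i) = lookup (lead p) (X j)"
  shows "lookup (lead p) (Y j) + m \<le> lookup (lead p) (Y i)"
proof -
  define q where "q = xcoeff (xpart (lead p)) p"
  let ?\<tau> = "Transposition.transpose i j"
  have \<tau>: "?\<tau> permutes {1..n}" using ij by (intro permutes_swap_id) auto
  then have bij: "bij ?\<tau>" by (rule permutes_bij)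
  then have inj: "inj ?\<tau>" by (rule bij_is_inj)
  have skew: "p \<in> skew n m" using p A_pow_subset_skew by auto
  obtain h where h: "q = ydiff i j ^ m * h"
    using ydiff_power_dvd_xcoeff_lead[OF p ij] eq by (auto simp: q_def dvd_def)
  have nz: "q \<noteq> 0" "lead q = ypart (lead p)" using lead_xcoeff_lead[OF p(2)] by (auto simp: q_def)
  have "act ?\<tau> q = of_int ((-1) ^ m) * q"
  proof (rule poly_mapping_eqI)
    fix b
    have a: "perm ?\<tau> (xpart (lead p)) = xpart (lead p)"
      using inj eq by (intro monom_eqI) (auto simp: transpose_def)
    have "ypart (perm ?\<tau> b) = perm ?\<tau> (ypart b)"
      using inj by (intro monom_eqI) simp_all
    then have "ypart (perm ?\<tau> b) = perm ?\<tau> b \<longleftrightarrow> ypart b = b"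
      using perm_inv(2)[OF bij] by metis
    moreover have "lookup p (xpart (lead p) + perm ?\<tau> b) = (-1) ^ m * lookup p (xpart (lead p) + b)"
      using lookup_skew[OF skew \<tau>, of "xpart (lead p) + b"] ij
      by (simp add: perm_add[OF inj] a sign_swap_id)
    ultimately show "lookup (act ?\<tau> q) b = lookup (of_int ((-1) ^ m) * q) b"
      using bij by (simp only: lookup_act lookup_of_int_mult q_def lookup_xcoeff) simp
  qed
  moreover have "act ?\<tau> q = (-1) ^ m * (ydiff i j ^ m * act ?\<tau> h)"
  proof -
    have "act ?\<tau> (ydiff i j) = - ydiff i j" using bij by (simp add: act_ydiff) (simp add: ydiff_def)
    then show ?thesis
      unfolding h act_mult[OF bij] act_power[OF bij] by (simp add: power_minus[of "ydiff i j"] mult.assoc)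
  qed
  ultimately have "ydiff i j ^ m * act ?\<tau> h = ydiff i j ^ m * h"
    unfolding h by simp
  then have act_h: "act ?\<tau> h = h" using ydiff_nonzero[of i j] ij by simp
  have "h \<noteq> 0" using h nz by auto
  then have "perm ?\<tau> (lead h) \<in> keys h"
    using lookup_lead[of h] lookup_act[OF bij, of h "lead h"] by (simp add: act_h in_keys_iff)
  then have "\<not> lead h < perm ?\<tau> (lead h)" using le_lead by (simp add: not_less)
  moreover have lead_q: "lead q = lead (ydiff i j ^ m) + lead h"
    unfolding h using \<open>h \<noteq> 0\<close> ydiff_nonzero[of i j] ij by (intro lead_mult) auto
  have "lookup (lead h) (X l) = 0" for l
    using arg_cong[OF lead_q, of "\<lambda>r. lookup r (X l)"] by (simp add: nz lookup_add)
  ultimately have "lookup (lead h) (Y j) \<le> lookup (lead h) (Y i)"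
    using perm_transpose_less[OF ij(3), of "lead h"] by (metis not_le)
  moreover have "lookup (lead q) (Y i) = m + lookup (lead h) (Y i)" "lookup (lead q) (Y j) = lookup (lead h) (Y j)"
    unfolding lead_q using ij ydiff_nonzero[of i j]
    by (simp_all add: lookup_add lookup_lead_power lead_ydiff lookup_single)
  ultimately show ?thesis using nz by simp
qed

section \<open>Distributing a leading monomial over columns\<close>

text \<open>
  Hermite's identity: the numbers \<open>\<lfloor>(a + c) / M\<rfloor>\<close> distribute \<open>a\<close> over \<open>M\<close> columns as evenly as possible.
\<close>

lemma sum_div_shift:
  fixes a M :: nat
  assumes "M > 0"
  shows "(\<Sum>c<M. (a + c) div M) = a"
proof (induction a)
  case (Suc a)
  have "(\<Sum>c<M. (Suc a + c) div M) + a div M = (\<Sum>c<Suc M. (a + c) div M)"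
    by (simp only: sum.lessThan_Suc_shift) simp
  also have "\<dots> = a + (a div M + 1)" using Suc assms by simp
  finally show ?case by simp
qed (use assms in simp)

lemma sum_div_shift_diff:
  fixes a a' M :: nat
  assumes "M > 0"
  shows "(\<Sum>c<M. (a + c) div M - (a' + c) div M) = a - a'"
proof (cases "a' \<le> a")
  case True
  then have "(\<Sum>c<M. (a + c) div M - (a' + c) div M) = (\<Sum>c<M. (a + c) div M) - (\<Sum>c<M. (a' + c) div M)"
    by (intro sum_subtractf_nat div_le_mono) simp
  then show ?thesis using assms by (simp add: sum_div_shift)
next
  case False
  then have "(a + c) div M - (a' + c) div M = 0" for c by (simp add: div_le_mono)
  then show ?thesis using False by simp
qed

text \<open>
  The number of columns in which \<open>a\<close> and \<open>a'\<close> receive the same value.  It accounts for the exponents of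
  \<open>y\<^sub>i - y\<^sub>l\<close> in \<open>lead_bound\<close>.
\<close>

lemma sum_div_shift_eq:
  fixes a a' M :: nat
  assumes "M > 0" "a' \<le> a"
  shows "(\<Sum>c<M. of_bool ((a' + c) div M = (a + c) div M)) = M - (a - a')"
proof (cases "a - a' < M")
  case True
  have *: "of_bool ((a' + c) div M = (a + c) div M) = 1 - ((a + c) div M - (a' + c) div M)"
    "(a + c) div M - (a' + c) div M \<le> 1" for c
  proof -
    have "(a + c) div M \<le> (a' + c + M) div M" using True by (intro div_le_mono) simp
    then have "(a + c) div M \<le> (a' + c) div M + 1" using assms by simp
    moreover have "(a' + c) div M \<le> (a + c) div M" using assms by (intro div_le_mono) simp
    ultimately show "of_bool ((a' + c) div M = (a + c) div M) = 1 - ((a + c) div M - (a' + c) div M)"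
      "(a + c) div M - (a' + c) div M \<le> 1" by auto
  qed
  show ?thesis
    unfolding *(1) by (subst sum_subtractf_nat) (use *(2) assms in \<open>simp_all add: sum_div_shift_diff\<close>)
next
  case False
  have "(a' + c) div M \<noteq> (a + c) div M" for c
  proof -
    have "(a' + c + M) div M \<le> (a + c) div M" using False assms(2) by (intro div_le_mono) simp
    then show ?thesis using assms by simp
  qed
  then show ?thesis using False by simp
qed

text \<open>
  In column \<open>c\<close> the points with the same first coordinate \<open>A c i\<close> must have second coordinates that decrease in
  steps of at least \<open>e\<close> and respect the degree bound \<open>\<lfloor>(k + c) / M\<rfloor>\<close>.  The smallest such choice adds up to the
  lower bound for \<open>b\<close>.  The excess of \<open>b i\<close> over that bound goes entirely into the one column where \<open>a i\<close> is the
  largest number with quotient \<open>A c i\<close> (there the weight \<open>w c i\<close> is \<open>1\<close>): the other points \<open>l > i\<close> with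
  the same \<open>A c l\<close> have smaller \<open>a l\<close>, so they get no excess there, or the same \<open>a l\<close> and then, by the
  hypothesis on blocks, no larger excess.
\<close>

lemma column_decomposition:
  fixes a b :: "nat \<Rightarrow> nat"
  assumes M: "M > 0"
    and anti: "\<And>i j. i \<in> {1..n} \<Longrightarrow> j \<in> {1..n} \<Longrightarrow> i < j \<Longrightarrow> a j \<le> a i"
    and bound: "\<And>i. i \<in> {1..n} \<Longrightarrow> (k - a i) + e * (\<Sum>l\<in>{i<..n}. M - (a i - a l)) \<le> b i"
    and block: "\<And>i j. i \<in> {1..n} \<Longrightarrow> j \<in> {1..n} \<Longrightarrow> i < j \<Longrightarrow> a i = a j \<Longrightarrow> b j + e * M \<le> b i"
  obtains A B :: "nat \<Rightarrow> nat \<Rightarrow> nat"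
  where "\<And>i. i \<in> {1..n} \<Longrightarrow> (\<Sum>c<M. A c i) = a i" "\<And>i. i \<in> {1..n} \<Longrightarrow> (\<Sum>c<M. B c i) = b i"
    "\<And>c i. i \<in> {1..n} \<Longrightarrow> (k + c) div M \<le> A c i + B c i"
    "\<And>c i. i \<in> {1..n} \<Longrightarrow> Suc i \<in> {1..n} \<Longrightarrow>
      A c (Suc i) < A c i \<or> A c (Suc i) = A c i \<and> B c (Suc i) + e \<le> B c i"
proof -
  define base where "base i = (k - a i) + e * (\<Sum>l\<in>{i<..n}. M - (a i - a l))" for i
  define A where "A c i = (a i + c) div M" for c i
  define N where "N c i = (\<Sum>l\<in>{i<..n}. of_bool (A c l = A c i) :: nat)" for c i
  define w where "w c i = (Suc (a i) + c) div M - A c i" for c i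
  define B where "B c i = ((k + c) div M - A c i) + e * N c i + (b i - base i) * w c i" for c i
  have "(\<Sum>c<M. A c i) = a i" for i
    using M by (simp add: A_def sum_div_shift)
  moreover have "(\<Sum>c<M. B c i) = b i" if i: "i \<in> {1..n}" for i
  proof -
    have "(\<Sum>c<M. N c i) = (\<Sum>l\<in>{i<..n}. \<Sum>c<M. of_bool (A c l = A c i))"
      unfolding N_def by (rule sum.swap)
    also have "\<dots> = (\<Sum>l\<in>{i<..n}. M - (a i - a l))"
      unfolding A_def using M anti i by (intro sum.cong refl sum_div_shift_eq) auto
    finally have N: "(\<Sum>c<M. N c i) = (\<Sum>l\<in>{i<..n}. M - (a i - a l))" .
    have "(\<Sum>c<M. w c i) = 1"
      unfolding w_def A_def using M sum_div_shift_diff[of M "Suc (a i)" "a i"] by simp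
    then have "(\<Sum>c<M. B c i) = base i + (b i - base i)"
      using M sum_div_shift_diff[of M k "a i"]
      by (simp add: B_def sum.distrib N base_def A_def flip: sum_distrib_left)
    then show ?thesis using bound[OF i] by (simp add: base_def)
  qed
  moreover have "(k + c) div M \<le> A c i + B c i" for c i
    by (simp add: B_def)
  moreover have "A c (Suc i) < A c i \<or> A c (Suc i) = A c i \<and> B c (Suc i) + e \<le> B c i"
    if i: "i \<in> {1..n}" "Suc i \<in> {1..n}" for c i
  proof (cases "A c (Suc i) = A c i")
    case True
    have le: "a (Suc i) \<le> a i" using anti i by simp
    have ins: "{i<..n} = insert (Suc i) {Suc i<..n}" using i by auto
    have "N c i = Suc (N c (Suc i))"
      unfolding N_def ins using True by simp
    moreover have "(b (Suc i) - base (Suc i)) * w c (Suc i) \<le> (b i - base i) * w c i"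
    proof (cases "a (Suc i) = a i")
      case eq: True
      have "base i = base (Suc i) + e * M"
        unfolding base_def ins by (simp add: eq algebra_simps)
      moreover have "b (Suc i) + e * M \<le> b i" using block i eq by simp
      ultimately have "b (Suc i) - base (Suc i) \<le> b i - base i" by simp
      moreover have "w c (Suc i) = w c i" by (simp add: w_def A_def eq)
      ultimately show ?thesis by simp
    next
      case False
      then have "(Suc (a (Suc i)) + c) div M \<le> A c i"
        unfolding A_def using le by (intro div_le_mono) simp
      then show ?thesis using True by (simp add: w_def)
    qed
    ultimately show ?thesis using True by (simp add: B_def)
  next
    case False
    have "A c (Suc i) \<le> A c i" unfolding A_def using anti i by (intro div_le_mono) simp
    then show ?thesis using False by simp
  qed
  ultimately show thesis by (rule that)
qed

section \<open>Orbit sums\<close>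

lemma gap_sortedI:
  assumes "\<And>i. i \<in> {1..n} \<Longrightarrow> Suc i \<in> {1..n} \<Longrightarrow> lookup t (X (Suc i)) < lookup t (X i) \<or>
     lookup t (X (Suc i)) = lookup t (X i) \<and> lookup t (Y (Suc i)) + e \<le> lookup t (Y i)"
  shows "gap_sorted n e t"
  unfolding gap_sorted_def
proof (intro ballI impI)
  fix i j assume i: "i \<in> {1..n}" and j: "j \<in> {1..n}" and ij: "i < j"
  from ij have "Suc i \<le> j" by simp
  then show "lookup t (X j) < lookup t (X i) \<or>
     lookup t (X j) = lookup t (X i) \<and> lookup t (Y j) + e \<le> lookup t (Y i)"
    using j
  proof (induction j rule: dec_induct)
    case base
    then show ?case using assms[of i] i by simp
  next
    case (step j)
    then have "lookup t (X j) < lookup t (X i) \<or>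
      lookup t (X j) = lookup t (X i) \<and> lookup t (Y j) + e \<le> lookup t (Y i)" by simp
    moreover have "lookup t (X (Suc j)) < lookup t (X j) \<or>
      lookup t (X (Suc j)) = lookup t (X j) \<and> lookup t (Y (Suc j)) + e \<le> lookup t (Y j)"
      using assms[of j] step by simp
    ultimately show ?case by linarith
  qed
qed

lemma gap_sorted_mono: "gap_sorted n e t \<Longrightarrow> e' \<le> e \<Longrightarrow> gap_sorted n e' t"
  unfolding gap_sorted_def by (meson add_left_mono le_trans)

text \<open>
  A finite sequence has only one weakly decreasing rearrangement.
\<close>

lemma perm_sorted_unique:
  fixes f :: "nat \<Rightarrow> nat"
  assumes \<sigma>: "\<sigma> permutes {1..n}"
    and f: "\<And>i j. i \<in> {1..n} \<Longrightarrow> j \<in> {1..n} \<Longrightarrow> i < j \<Longrightarrow> f j \<le> f i"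
    and f\<sigma>: "\<And>i j. i \<in> {1..n} \<Longrightarrow> j \<in> {1..n} \<Longrightarrow> i < j \<Longrightarrow> f (\<sigma> j) \<le> f (\<sigma> i)"
    and i: "i \<in> {1..n}"
  shows "f (\<sigma> i) = f i"
proof -
  let ?is = "[1..<Suc n]"
  have sorted: "sorted (map (\<lambda>i. - int (g i)) ?is)"
    if "\<And>i j. i \<in> {1..n} \<Longrightarrow> j \<in> {1..n} \<Longrightarrow> i < j \<Longrightarrow> g j \<le> g i" for g :: "nat \<Rightarrow> nat"
    unfolding sorted_map using that
    by (intro sorted_wrt_mono_rel[OF _ sorted_wrt_upt]) auto
  have "mset (map (\<lambda>i. - int (f (\<sigma> i))) ?is) =
      image_mset (\<lambda>i. - int (f i)) (image_mset \<sigma> (mset_set {1..<Suc n}))"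
    by (simp only: mset_map mset_upt multiset.map_comp comp_def)
  also have "image_mset \<sigma> (mset_set {1..<Suc n}) = mset_set {1..<Suc n}"
    using permutes_image_mset[OF \<sigma>] by (simp only: atLeastLessThanSuc_atLeastAtMost)
  finally have m: "mset (map (\<lambda>i. - int (f (\<sigma> i))) ?is) = mset (map (\<lambda>i. - int (f i)) ?is)"
    by (simp only: mset_map mset_upt)
  have "sorted (map (\<lambda>i. - int (f (\<sigma> i))) ?is)"
    by (rule sorted[of "\<lambda>i. f (\<sigma> i)"]) (rule f\<sigma>)
  moreover have "sorted (map (\<lambda>i. - int (f i)) ?is)"
    by (rule sorted[of f]) (rule f)
  ultimately have "map (\<lambda>i. - int (f (\<sigma> i))) ?is = map (\<lambda>i. - int (f i)) ?is"
    by (rule trans[OF properties_for_sort[OF m, symmetric] sorted_sort_id])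
  then show ?thesis using i by (auto simp: map_eq_conv simp del: upt_Suc)
qed

lemma gap_sorted_perm_unique:
  assumes \<sigma>: "\<sigma> permutes {1..n}" and t: "gap_sorted n 0 t" "gap_sorted n 0 (perm \<sigma> t)"
  shows "perm \<sigma> t = t"
proof -
  \<comment> \<open>Writing points as two-digit numbers in a large base \<open>N\<close> turns their lexicographic order into that of \<open>nat\<close>.\<close>
  define N where "N = Suc (\<Sum>i\<in>{1..n}. lookup t (Y i))"
  define f where "f i = lookup t (X i) * N + lookup t (Y i)" for i
  have inj: "inj \<sigma>" using \<sigma> by (rule permutes_inj)
  have lt: "lookup t (Y i) < N" if "i \<in> {1..n}" for i
    using member_le_sum[of i "{1..n}" "\<lambda>i. lookup t (Y i)"] that by (simp add: N_def)
  have le: "x * N + y \<le> x' * N + y'" if "x < x' \<or> x = x' \<and> y \<le> y'" "y < N" for x x' y y' :: nat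
  proof -
    have "x * N + N \<le> x' * N" if "x < x'"
      using mult_le_mono1[of "Suc x" x' N] that by simp
    then show ?thesis using that by fastforce
  qed
  have \<sigma>_in: "\<sigma> i \<in> {1..n}" if "i \<in> {1..n}" for i using permutes_in_image[OF \<sigma>] that by blast
  have "f (\<sigma> i) = f i" if i: "i \<in> {1..n}" for i
  proof (rule perm_sorted_unique[OF \<sigma> _ _ i])
    fix i j assume ij: "i \<in> {1..n}" "j \<in> {1..n}" "i < j"
    show "f j \<le> f i"
      unfolding f_def by (rule le) (use t(1) ij lt in \<open>auto simp: gap_sorted_def\<close>)
    show "f (\<sigma> j) \<le> f (\<sigma> i)"
      unfolding f_def
      by (rule le) (use t(2) ij lt[OF \<sigma>_in] inj in \<open>auto simp: gap_sorted_def\<close>)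
  qed
  then have eq: "lookup t (X (\<sigma> i)) = lookup t (X i) \<and> lookup t (Y (\<sigma> i)) = lookup t (Y i)"
    if i: "i \<in> {1..n}" for i
  proof -
    have "f (\<sigma> i) div N = lookup t (X (\<sigma> i))" "f i div N = lookup t (X i)"
      "f (\<sigma> i) mod N = lookup t (Y (\<sigma> i))" "f i mod N = lookup t (Y i)"
      using lt[OF i] lt[OF \<sigma>_in[OF i]] by (simp_all add: f_def)
    then show ?thesis using \<open>\<And>i. i \<in> {1..n} \<Longrightarrow> f (\<sigma> i) = f i\<close>[OF i] by simp
  qed
  then have "lookup t (X (\<sigma> i)) = lookup t (X i) \<and> lookup t (Y (\<sigma> i)) = lookup t (Y i)" for i
    using permutes_not_in[OF \<sigma>, of i] by (cases "i \<in> {1..n}") auto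
  then show ?thesis using inj by (intro monom_eqI) simp_all
qed

text \<open>
  An alternant for \<open>e = 1\<close> and a multiple of a monomial symmetric polynomial for \<open>e = 0\<close>.
\<close>

definition orbit_sum :: "nat \<Rightarrow> nat \<Rightarrow> monom \<Rightarrow> cpoly" where
  "orbit_sum n e t = (\<Sum>\<sigma> | \<sigma> permutes {1..n}. single (perm \<sigma> t) (of_int (sign \<sigma> ^ e)))"

lemma keys_orbit_sum: "keys (orbit_sum n e t) \<subseteq> {perm \<sigma> t | \<sigma>. \<sigma> permutes {1..n}}"
  unfolding orbit_sum_def by (rule order_trans[OF keys_sum]) (auto split: if_splits)

lemma orbit_sum_skew:
  assumes "keys t \<subseteq> coords n"
  shows "orbit_sum n e t \<in> skew n e"
proof (rule skewI)
  show "orbit_sum n e t \<in> poly_ring n"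
    using keys_orbit_sum[of n e t] keys_perm_coords[OF _ assms] by (fastforce simp: poly_ring_def)
  fix \<tau> s assume \<tau>: "\<tau> permutes {1..n}"
  have "lookup (orbit_sum n e t) (perm \<tau> s) =
      (\<Sum>\<sigma> | \<sigma> permutes {1..n}. of_int (sign (\<sigma> \<circ> \<tau>) ^ e) when perm (\<sigma> \<circ> \<tau>) t = perm \<tau> s)"
    unfolding orbit_sum_def lookup_sum lookup_single
    by (rule sum_permutations_compose_right[OF \<tau>])
  also have "\<dots> = (\<Sum>\<sigma> | \<sigma> permutes {1..n}. of_int (sign \<tau> ^ e) * (of_int (sign \<sigma> ^ e) when perm \<sigma> t = s))"
  proof (rule sum.cong[OF refl])
    fix \<sigma> assume "\<sigma> \<in> {\<sigma>. \<sigma> permutes {1..n}}"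
    then have \<sigma>: "\<sigma> permutes {1..n}" by simp
    have "perm (\<sigma> \<circ> \<tau>) t = perm \<tau> (perm \<sigma> t)"
      using \<sigma> \<tau> by (simp add: perm_perm permutes_inj)
    then have "perm (\<sigma> \<circ> \<tau>) t = perm \<tau> s \<longleftrightarrow> perm \<sigma> t = s"
      using perm_inv(2)[OF permutes_bij[OF \<tau>]] by metis
    moreover have "sign (\<sigma> \<circ> \<tau>) = sign \<sigma> * sign \<tau>"
      using \<sigma> \<tau> by (intro sign_compose) (auto intro: permutation_permutes[THEN iffD2])
    ultimately show "(of_int (sign (\<sigma> \<circ> \<tau>) ^ e) when perm (\<sigma> \<circ> \<tau>) t = perm \<tau> s) =
        of_int (sign \<tau> ^ e) * (of_int (sign \<sigma> ^ e) when perm \<sigma> t = s :: complex)"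
      by (simp add: when_def power_mult_distrib mult.commute)
  qed
  also have "\<dots> = of_int (sign \<tau> ^ e) * lookup (orbit_sum n e t) s"
    unfolding orbit_sum_def lookup_sum lookup_single sum_distrib_left ..
  finally show "lookup (orbit_sum n e t) (perm \<tau> s) = of_int (sign \<tau> ^ e) * lookup (orbit_sum n e t) s" .
qed

text \<open>
  The leading monomial is a sorted rearrangement of \<open>t\<close>, and there is only one.  That \<open>t\<close> does occur in the sum is a
  matter of the permutations that fix \<open>t\<close>: for \<open>e = 1\<close> the points are distinct, so only the identity does, and for
  \<open>e = 0\<close> all signs are positive.
\<close>

lemma lead_orbit_sum:
  assumes t: "keys t \<subseteq> coords n" "gap_sorted n e t" and e: "e \<le> 1"
  shows "orbit_sum n e t \<noteq> 0" "lead (orbit_sum n e t) = t"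
proof -
  have sgn: "sign \<sigma> ^ e = 1" if \<sigma>: "\<sigma> permutes {1..n}" "perm \<sigma> t = t" for \<sigma>
  proof (cases "e = 0")
    case False
    then have e1: "e = 1" using e by simp
    have inj: "inj \<sigma>" using \<sigma>(1) by (rule permutes_inj)
    have "\<sigma> i = i" for i
    proof (cases "i \<in> {1..n}")
      case True
      then have "\<sigma> i \<in> {1..n}" using permutes_in_image[OF \<sigma>(1)] by blast
      moreover have "lookup t (X (\<sigma> i)) = lookup t (X i)" "lookup t (Y (\<sigma> i)) = lookup t (Y i)"
        using arg_cong[OF \<sigma>(2), of "\<lambda>r. lookup r (X i)"] arg_cong[OF \<sigma>(2), of "\<lambda>r. lookup r (Y i)"] inj
        by simp_all
      ultimately show ?thesis
        using t(2) True unfolding gap_sorted_def e1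
        by (cases "\<sigma> i" i rule: linorder_cases) force+
    qed (use permutes_not_in[OF \<sigma>(1)] in simp)
    then have "\<sigma> = id" by auto
    then show ?thesis by (simp add: sign_id)
  qed simp
  have "lookup (orbit_sum n e t) t = (\<Sum>\<sigma> | \<sigma> permutes {1..n}. of_bool (perm \<sigma> t = t))"
    unfolding orbit_sum_def lookup_sum lookup_single
    by (intro sum.cong refl) (auto simp: when_def sgn simp flip: of_int_power)
  also have "\<dots> = of_nat (card {\<sigma>. \<sigma> permutes {1..n} \<and> perm \<sigma> t = t})"
    by (simp add: finite_permutations Collect_conj_eq flip: sum.inter_filter)
  also have "\<dots> \<noteq> 0"
  proof -
    have "id \<in> {\<sigma>. \<sigma> permutes {1..n} \<and> perm \<sigma> t = t}" by (simp add: permutes_id)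
    moreover have "finite {\<sigma>. \<sigma> permutes {1..n} \<and> perm \<sigma> t = t}"
      using finite_permutations[of "{1..n}"] by simp
    ultimately have "card {\<sigma>. \<sigma> permutes {1..n} \<and> perm \<sigma> t = t} \<noteq> 0" by (metis card_eq_0_iff empty_iff)
    then show ?thesis by simp
  qed
  finally show nz: "orbit_sum n e t \<noteq> 0" by auto
  obtain \<sigma> where \<sigma>: "\<sigma> permutes {1..n}" "lead (orbit_sum n e t) = perm \<sigma> t"
    using lead_in_keys[OF nz] keys_orbit_sum by blast
  have "gap_sorted n 0 (perm \<sigma> t)"
    using lead_gap_sorted[OF orbit_sum_skew[OF t(1)] nz] \<sigma>(2) by simp
  then show "lead (orbit_sum n e t) = t"
    using gap_sorted_perm_unique[OF \<sigma>(1)] gap_sorted_mono[OF t(2)] \<sigma>(2) by simp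
qed

definition point_monom :: "nat \<Rightarrow> (nat \<Rightarrow> nat) \<Rightarrow> (nat \<Rightarrow> nat) \<Rightarrow> monom" where
  "point_monom n a b = (\<Sum>i\<in>{1..n}. single (X i) (a i) + single (Y i) (b i))"

lemma lookup_point_monom [simp]:
  "lookup (point_monom n a b) (X i) = (if i \<in> {1..n} then a i else 0)"
  "lookup (point_monom n a b) (Y i) = (if i \<in> {1..n} then b i else 0)"
  by (simp_all add: point_monom_def lookup_sum lookup_add lookup_single when_def)

lemma keys_point_monom: "keys (point_monom n a b) \<subseteq> coords n"
proof
  fix v assume "v \<in> keys (point_monom n a b)"
  then show "v \<in> coords n" by (cases v) (auto simp: in_keys_iff split: if_splits)
qed

section \<open>The spaces of sections\<close>

lemma A_pow_nonpos: "m \<le> 0 \<Longrightarrow> A_pow n m = skew n (nat (- m))"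
proof -
  assume m: "m \<le> 0"
  then have "even (nat (- m)) \<longleftrightarrow> even m" by (simp add: even_nat_iff)
  then show ?thesis
    using m skew_cong[of "nat (- m)" 0 n] skew_cong[of "nat (- m)" 1 n]
    by (simp add: A_pow_def skew_0 skew_1)
qed

lemma A_pow_pos:
  "m > 0 \<Longrightarrow> A_pow n (int m) = cpoly.span {prod_list ps | ps. length ps = m \<and> set ps \<subseteq> skew n 1}"
  by (simp add: A_pow_def skew_1)

lemma subspace_A_pow: "cpoly.subspace (A_pow n m)"
proof (cases "m \<le> 0")
  case True
  then show ?thesis by (simp add: A_pow_nonpos subspace_skew)
qed (simp add: A_pow_def)

lemma prod_list_skew: "set ps \<subseteq> skew n e \<Longrightarrow> prod_list ps \<in> skew n (e * length ps)"
proof (induction ps)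
  case (Cons p ps)
  then show ?case using skew_mult[of p n e "prod_list ps" "e * length ps"] by simp
qed (simp add: one_skew)

text \<open>
  Multiplicativity \<open>A\<^sup>m A\<^bsup>m'\<^esup> \<subseteq> A\<^bsup>m+m'\<^esup>\<close> is awkward for exponents of different sign.  It becomes obvious in this uniform
  description, where surplus antisymmetric factors are allowed: an even number of them, together with the symmetric
  factor, can be absorbed in another antisymmetric factor.
\<close>

lemma A_pow_eq_span:
  "A_pow n m = cpoly.span {s * prod_list ps | s ps. s \<in> skew n 0 \<and> set ps \<subseteq> skew n 1 \<and>
     m \<le> int (length ps) \<and> even (int (length ps) - m)}" (is "_ = cpoly.span ?G")
proof
  show "A_pow n m \<subseteq> cpoly.span ?G"
  proof (cases "m > 0")
    case True
    then have "A_pow n m = cpoly.span {prod_list ps | ps. length ps = nat m \<and> set ps \<subseteq> skew n 1}"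
      using A_pow_pos[of "nat m"] by simp
    moreover have "{prod_list ps | ps. length ps = nat m \<and> set ps \<subseteq> skew n 1} \<subseteq> ?G"
    proof
      fix p assume "p \<in> {prod_list ps | ps. length ps = nat m \<and> set ps \<subseteq> skew n 1}"
      then obtain ps where ps: "p = prod_list ps" "length ps = nat m" "set ps \<subseteq> skew n 1" by blast
      show "p \<in> ?G"
        unfolding mem_Collect_eq
        by (rule exI[of _ 1], rule exI[of _ ps]) (use ps one_skew True in simp)
    qed
    ultimately show ?thesis by (simp add: cpoly.span_mono)
  next
    case False
    then have A: "A_pow n m = skew n (nat (- m))" by (simp add: A_pow_nonpos)
    have "p \<in> ?G" if p: "p \<in> A_pow n m" for p
    proof (cases "even m")
      case True
      then have "p \<in> skew n 0"
        using p False skew_cong[of "nat (- m)" 0 n] unfolding A by (simp add: even_nat_iff)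
      then show ?thesis
        unfolding mem_Collect_eq
        by (intro exI[of _ p] exI[of _ "[]"]) (use False True in simp)
    next
      case odd: False
      then have "p \<in> skew n 1"
        using p False skew_cong[of "nat (- m)" 1 n] unfolding A by (simp add: even_nat_iff)
      then show ?thesis
        unfolding mem_Collect_eq
        by (intro exI[of _ 1] exI[of _ "[p]"]) (use False odd one_skew in simp)
    qed
    then show ?thesis using cpoly.span_superset[of ?G] by blast
  qed
  show "cpoly.span ?G \<subseteq> A_pow n m"
  proof (rule cpoly.span_minimal[OF _ subspace_A_pow])
    show "?G \<subseteq> A_pow n m"
    proof
      fix p assume "p \<in> ?G"
      then obtain s ps where p: "p = s * prod_list ps" and s: "s \<in> skew n 0" "set ps \<subseteq> skew n 1"
        and len: "m \<le> int (length ps)" "even (int (length ps) - m)" by blast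
      show "p \<in> A_pow n m"
      proof (cases "m > 0")
        case False
        have "p \<in> skew n (length ps)" using skew_mult[OF s(1) prod_list_skew[OF s(2)]] by (simp add: p)
        moreover have "skew n (length ps) = skew n (nat (- m))"
          by (rule skew_cong) (use False len in \<open>auto simp: even_nat_iff\<close>)
        ultimately show ?thesis using False by (simp add: A_pow_nonpos)
      next
        case True
        define j where "j = length ps - nat m"
        have "int j = int (length ps) - m" using len True by (simp add: j_def)
        then have "even (int j)" using len(2) by simp
        then have "even j" by (simp only: even_of_nat)
        moreover have "length ps = j + nat m" using len True by (simp add: j_def)
        ultimately have j: "even j" "length ps = j + nat m" .
        define u where "u = s * prod_list (take (Suc j) ps)"
        have "set (take (Suc j) ps) \<subseteq> skew n 1" by (rule order_trans[OF set_take_subset s(2)])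
        from skew_mult[OF s(1) prod_list_skew[OF this]]
        have "u \<in> skew n (length (take (Suc j) ps))" by (simp only: u_def add_0_left mult_1)
        moreover have "length (take (Suc j) ps) = Suc j" using j(2) True by simp
        moreover have "skew n (Suc j) = skew n 1" by (rule skew_cong) (use j(1) in simp)
        ultimately have u: "u \<in> skew n 1" by metis
        have "prod_list ps = prod_list (take (Suc j) ps) * prod_list (drop (Suc j) ps)"
          by (simp only: append_take_drop_id flip: prod_list.append)
        then have p': "p = prod_list (u # drop (Suc j) ps)"
          by (simp only: p u_def mult.assoc prod_list.Cons)
        have "set (u # drop (Suc j) ps) \<subseteq> skew n 1"
          using s(2) set_drop_subset[of "Suc j" ps] u by auto
        moreover have "length (u # drop (Suc j) ps) = nat m" using j(2) True by simp
        ultimately have "p \<in> cpoly.span {prod_list ps | ps. length ps = nat m \<and> set ps \<subseteq> skew n 1}"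
          using p' by (blast intro: cpoly.span_base)
        then show ?thesis using A_pow_pos[of "nat m" n] True by simp
      qed
    qed
  qed
qed

lemma span_mult:
  assumes "p \<in> cpoly.span G" "q \<in> cpoly.span G'" and sub: "cpoly.subspace V"
    and GG': "\<And>f g. f \<in> G \<Longrightarrow> g \<in> G' \<Longrightarrow> f * g \<in> V"
  shows "p * q \<in> V"
proof -
  have scale: "cscale c f * g = cscale c (f * g)" "f * cscale c g = cscale c (f * g)" for c f g
    by (simp_all add: cscale_def ac_simps)
  have "cpoly.subspace {q. f * q \<in> V}" for f
    by (rule cpoly.subspaceI)
      (simp_all add: distrib_left scale cpoly.subspace_0[OF sub] cpoly.subspace_add[OF sub] cpoly.subspace_scale[OF sub])
  then have "cpoly.span G' \<subseteq> {q. f * q \<in> V}" if "f \<in> G" for f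
    using GG' that by (intro cpoly.span_minimal) auto
  then have "G \<subseteq> {p. p * q \<in> V}" using assms(2) by blast
  moreover have "cpoly.subspace {p. p * q \<in> V}"
    by (rule cpoly.subspaceI)
      (simp_all add: distrib_right scale cpoly.subspace_0[OF sub] cpoly.subspace_add[OF sub] cpoly.subspace_scale[OF sub])
  ultimately have "cpoly.span G \<subseteq> {p. p * q \<in> V}" by (rule cpoly.span_minimal)
  then show ?thesis using assms(1) by blast
qed

lemma A_pow_mult:
  assumes "p \<in> A_pow n m" "q \<in> A_pow n m'"
  shows "p * q \<in> A_pow n (m + m')"
proof (rule span_mult[OF assms[unfolded A_pow_eq_span] subspace_A_pow])
  fix f g
  assume f: "f \<in> {s * prod_list ps | s ps. s \<in> skew n 0 \<and> set ps \<subseteq> skew n 1 \<and>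
      m \<le> int (length ps) \<and> even (int (length ps) - m)}"
    and g: "g \<in> {s * prod_list ps | s ps. s \<in> skew n 0 \<and> set ps \<subseteq> skew n 1 \<and>
      m' \<le> int (length ps) \<and> even (int (length ps) - m')}"
  obtain s ps where f': "f = s * prod_list ps" "s \<in> skew n 0" "set ps \<subseteq> skew n 1"
    "m \<le> int (length ps)" "even (int (length ps) - m)" using f by blast
  obtain r qs where g': "g = r * prod_list qs" "r \<in> skew n 0" "set qs \<subseteq> skew n 1"
    "m' \<le> int (length qs)" "even (int (length qs) - m')" using g by blast
  have "s * r \<in> skew n 0" using skew_mult[OF f'(2) g'(2)] by simp
  then show "f * g \<in> A_pow n (m + m')"
    unfolding A_pow_eq_span
    by (intro cpoly.span_base CollectI exI[of _ "s * r"] exI[of _ "ps @ qs"])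
      (use f' g' in \<open>auto simp: ac_simps\<close>)
qed

lemma A_pow_1: "A_pow n 1 = skew n 1"
proof -
  have "{prod_list ps | ps. length ps = 1 \<and> set ps \<subseteq> skew n 1} = skew n 1"
  proof (intro equalityI subsetI)
    fix p assume "p \<in> skew n 1"
    then show "p \<in> {prod_list ps | ps. length ps = 1 \<and> set ps \<subseteq> skew n 1}"
      by (intro CollectI exI[of _ "[p]"]) simp
  qed (auto simp: length_Suc_conv)
  then show ?thesis
    using A_pow_pos[of 1 n] subspace_skew[of n 1] by (simp add: cpoly.span_eq_iff)
qed

lemma A_pow_le_1: "e \<le> 1 \<Longrightarrow> A_pow n (int e) = skew n e"
  using A_pow_0[of n] A_pow_1[of n] by (cases "e = 0") (auto simp: le_Suc_eq)

lemma keys_mult_degree: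
  assumes "t \<in> keys (p * q :: cpoly)"
  obtains r s where "r \<in> keys p" "s \<in> keys q" "t = r + s"
  using assms keys_mult[of p q] by blast

lemma subspace_A_pow_ge: "cpoly.subspace (A_pow_ge n m k)"
proof (rule cpoly.subspaceI)
  show "0 \<in> A_pow_ge n m k" by (simp add: A_pow_ge_def cpoly.subspace_0[OF subspace_A_pow])
  show "p + q \<in> A_pow_ge n m k" if "p \<in> A_pow_ge n m k" "q \<in> A_pow_ge n m k" for p q
    using that keys_add[of p q] cpoly.subspace_add[OF subspace_A_pow] by (fastforce simp: A_pow_ge_def)
  show "cscale c p \<in> A_pow_ge n m k" if "p \<in> A_pow_ge n m k" for c p
    using that cpoly.subspace_scale[OF subspace_A_pow]
    by (auto simp: A_pow_ge_def in_keys_iff lookup_cscale)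
qed

lemma A_pow_ge_mult:
  assumes "p \<in> A_pow_ge n m k" "q \<in> A_pow_ge n m' k'"
  shows "p * q \<in> A_pow_ge n (m + m') (k + k')"
  unfolding A_pow_ge_def
proof (intro CollectI conjI ballI)
  show "p * q \<in> A_pow n (m + m')" using assms by (intro A_pow_mult) (auto simp: A_pow_ge_def)
  fix t i assume t: "t \<in> keys (p * q)" and i: "i \<in> {1..n}"
  then obtain r s where "r \<in> keys p" "s \<in> keys q" "t = r + s" by (elim keys_mult_degree)
  then have "k \<le> int (lookup r (X i)) + int (lookup r (Y i))" "k' \<le> int (lookup s (X i)) + int (lookup s (Y i))"
    using assms i by (auto simp: A_pow_ge_def)
  then show "k + k' \<le> int (lookup t (X i)) + int (lookup t (Y i))"
    using \<open>t = r + s\<close> by (simp add: lookup_add)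
qed

lemma A_pow_ge_prod:
  assumes "finite I" "\<And>c. c \<in> I \<Longrightarrow> p c \<in> A_pow_ge n (m c) (k c)"
  shows "(\<Prod>c\<in>I. p c) \<in> A_pow_ge n (\<Sum>c\<in>I. m c) (\<Sum>c\<in>I. k c)"
  using assms
proof (induction I rule: finite_induct)
  case empty
  then show ?case by (simp add: A_pow_ge_def one_skew A_pow_0)
next
  case (insert c I)
  then show ?case by (simp add: A_pow_ge_mult)
qed

lemma A_pow_ge_subset_poly_ring: "A_pow_ge n (int m) k \<subseteq> poly_ring n"
  using A_pow_subset_skew[of n m] by (auto simp: A_pow_ge_def skew_def)

lemma orbit_sum_A_pow_ge:
  assumes e: "e \<le> 1" and k: "\<And>i. i \<in> {1..n} \<Longrightarrow> k \<le> lookup t (X i) + lookup t (Y i)"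
    and t: "keys t \<subseteq> coords n"
  shows "orbit_sum n e t \<in> A_pow_ge n (int e) (int k)"
  unfolding A_pow_ge_def
proof (intro CollectI conjI ballI)
  show "orbit_sum n e t \<in> A_pow n (int e)"
    using orbit_sum_skew[OF t] e by (simp add: A_pow_le_1)
  fix s i assume "s \<in> keys (orbit_sum n e t)" and i: "i \<in> {1..n}"
  then obtain \<sigma> where \<sigma>: "\<sigma> permutes {1..n}" "s = perm \<sigma> t" using keys_orbit_sum by blast
  have "\<sigma> i \<in> {1..n}" using permutes_in_image[OF \<sigma>(1)] i by blast
  then show "int k \<le> int (lookup s (X i)) + int (lookup s (Y i))"
    using k[of "\<sigma> i"] \<sigma> permutes_inj[OF \<sigma>(1)] by simp
qed

lemma A_pow_ge_subset_span_lead: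
  assumes W: "W \<subseteq> A_pow_ge n (int m) k"
    and lead: "\<And>p. p \<in> A_pow_ge n (int m) k \<Longrightarrow> p \<noteq> 0 \<Longrightarrow> \<exists>w\<in>W. w \<noteq> 0 \<and> lead w = lead p"
  shows "A_pow_ge n (int m) k \<subseteq> cpoly.span W"
proof (rule subspace_eqI_lead[OF subspace_A_pow_ge A_pow_ge_subset_poly_ring])
  fix p assume "p \<in> A_pow_ge n (int m) k" "p \<noteq> 0"
  then show "\<exists>w\<in>A_pow_ge n (int m) k \<inter> cpoly.span W. w \<noteq> 0 \<and> lead w = lead p"
    using lead[of p] W cpoly.span_superset[of W] by blast
qed simp

lemma lead_prod:
  fixes f :: "'i \<Rightarrow> cpoly"
  assumes "\<And>l. l \<in> L \<Longrightarrow> f l \<noteq> 0"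
  shows "lead (\<Prod>l\<in>L. f l) = (\<Sum>l\<in>L. lead (f l))"
  using assms
  by (intro poly_mapping_eqI) (simp add: lookup_lead_prod lookup_sum)

lemma lead_in_coords:
  assumes "p \<in> A_pow_ge n (int m) k" "p \<noteq> 0"
  shows "keys (lead p) \<subseteq> coords n"
  using assms A_pow_ge_subset_poly_ring[of n m k] lead_in_keys[of p] by (auto simp: poly_ring_def)

lemma coords_monom_eqI:
  assumes "keys s \<subseteq> coords n" "keys t \<subseteq> coords n"
    "\<And>i. i \<in> {1..n} \<Longrightarrow> lookup s (X i) = lookup t (X i)" "\<And>i. i \<in> {1..n} \<Longrightarrow> lookup s (Y i) = lookup t (Y i)"
  shows "s = t"
proof (rule poly_mapping_eqI)
  fix v show "lookup s v = lookup t v"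
  proof (cases "v \<in> coords n")
    case True
    then show ?thesis using assms(3,4) by (cases v) auto
  next
    case False
    then have "lookup s v = 0" "lookup t v = 0" using assms(1,2) by (auto simp flip: not_in_keys_iff_lookup_eq_zero)
    then show ?thesis by simp
  qed
qed

text \<open>
  For \<open>e = 1\<close> this decomposes \<open>A\<^sup>M\<^bsub>\<ge>k\<^esub>(n)\<close> into \<open>M\<close> antisymmetric factors; for \<open>e = 0\<close> and \<open>M = k\<close> it decomposes
  \<open>S\<^bsub>\<ge>k\<^esub>\<close> into \<open>k\<close> factors, with all \<open>\<lfloor>(k + c) / M\<rfloor> = 1\<close>.  The bounds for leading monomials are exactly what
  \<open>column_decomposition\<close> requires, and the product of the orbit sums of the columns has the given leading monomial.
\<close>

theorem A_pow_ge_span_columns: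
  assumes M: "M > 0" and e: "e \<le> 1"
  shows "A_pow_ge n (int (e * M)) (int k) \<subseteq> cpoly.span {\<Prod>c<M. f c | f.
    \<forall>c<M. f c \<in> A_pow_ge n (int e) (int ((k + c) div M))}" (is "_ \<subseteq> cpoly.span ?W")
proof (rule A_pow_ge_subset_span_lead)
  show "?W \<subseteq> A_pow_ge n (int (e * M)) (int k)"
  proof
    fix w assume "w \<in> ?W"
    then obtain f where w: "w = (\<Prod>c<M. f c)" "\<forall>c<M. f c \<in> A_pow_ge n (int e) (int ((k + c) div M))"
      by blast
    have "w \<in> A_pow_ge n (\<Sum>c<M. int e) (\<Sum>c<M. int ((k + c) div M))"
      unfolding w(1) using w(2) by (intro A_pow_ge_prod) auto
    then show "w \<in> A_pow_ge n (int (e * M)) (int k)"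
      using sum_div_shift[OF M, of k] by (simp add: mult.commute flip: of_nat_sum)
  qed
  fix p assume p: "p \<in> A_pow_ge n (int (e * M)) (int k)" "p \<noteq> 0"
  then have pA: "p \<in> A_pow n (int (e * M))" by (simp add: A_pow_ge_def)
  then have skew: "p \<in> skew n (e * M)" using A_pow_subset_skew by blast
  have key: "k \<le> lookup t (X i) + lookup t (Y i)" if "t \<in> keys p" "i \<in> {1..n}" for t i
    using p(1) that by (force simp: A_pow_ge_def)
  define a where "a i = lookup (lead p) (X i)" for i
  define b where "b i = lookup (lead p) (Y i)" for i
  have sorted: "gap_sorted n 0 (lead p)" by (rule lead_gap_sorted[OF skew p(2)])
  have "(k - a i) + e * (\<Sum>l\<in>{i<..n}. M - (a i - a l)) \<le> b i" if i: "i \<in> {1..n}" for i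
  proof -
    have "(k - a i) + (\<Sum>l\<in>{i<..n}. e * M - (a i - a l)) \<le> b i"
      unfolding a_def b_def by (rule lead_bound[OF pA p(2) i key[OF _ i]])
    then show ?thesis using e by (cases "e = 0") (auto simp: le_Suc_eq)
  qed
  moreover have "b j + e * M \<le> b i" if "i \<in> {1..n}" "j \<in> {1..n}" "i < j" "a i = a j" for i j
    using lead_block_bound[OF pA p(2) that(1-3)] that(4) by (simp add: a_def b_def)
  moreover have "a j \<le> a i" if "i \<in> {1..n}" "j \<in> {1..n}" "i < j" for i j
    using sorted that unfolding gap_sorted_def a_def by force
  ultimately obtain A B :: "nat \<Rightarrow> nat \<Rightarrow> nat"
    where A: "\<And>i. i \<in> {1..n} \<Longrightarrow> (\<Sum>c<M. A c i) = a i" and B: "\<And>i. i \<in> {1..n} \<Longrightarrow> (\<Sum>c<M. B c i) = b i"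
      and deg: "\<And>c i. i \<in> {1..n} \<Longrightarrow> (k + c) div M \<le> A c i + B c i"
      and gap: "\<And>c i. i \<in> {1..n} \<Longrightarrow> Suc i \<in> {1..n} \<Longrightarrow>
        A c (Suc i) < A c i \<or> A c (Suc i) = A c i \<and> B c (Suc i) + e \<le> B c i"
    using column_decomposition[OF M, of n a k e b] by blast
  define t where "t c = point_monom n (A c) (B c)" for c
  have t: "keys (t c) \<subseteq> coords n" "gap_sorted n e (t c)" for c
  proof -
    show "keys (t c) \<subseteq> coords n" by (simp add: t_def keys_point_monom)
    show "gap_sorted n e (t c)"
    proof (rule gap_sortedI)
      fix i assume i: "i \<in> {1..n}" "Suc i \<in> {1..n}"
      show "lookup (t c) (X (Suc i)) < lookup (t c) (X i) \<or> lookup (t c) (X (Suc i)) = lookup (t c) (X i)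
          \<and> lookup (t c) (Y (Suc i)) + e \<le> lookup (t c) (Y i)"
        using gap[OF i, of c] i by (simp add: t_def)
    qed
  qed
  define f where "f c = orbit_sum n e (t c)" for c
  have f: "f c \<noteq> 0" "lead (f c) = t c" for c
    using lead_orbit_sum[OF t e] by (auto simp: f_def)
  have "f c \<in> A_pow_ge n (int e) (int ((k + c) div M))" for c
    unfolding f_def using deg t by (intro orbit_sum_A_pow_ge[OF e]) (auto simp: t_def)
  then have "(\<Prod>c<M. f c) \<in> ?W" by blast
  moreover have "(\<Prod>c<M. f c) \<noteq> 0" using f by simp
  moreover have "lead (\<Prod>c<M. f c) = lead p"
  proof -
    have "(\<Sum>c<M. t c) = lead p"
    proof (rule coords_monom_eqI)
      show "keys (\<Sum>c<M. t c) \<subseteq> coords n"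
        using t(1) by (fastforce simp: in_keys_iff lookup_sum)
      show "keys (lead p) \<subseteq> coords n" by (rule lead_in_coords[OF p])
    qed (simp_all add: lookup_sum t_def A B a_def b_def)
    then show ?thesis using f by (simp add: lead_prod)
  qed
  ultimately show "\<exists>w\<in>?W. w \<noteq> 0 \<and> lead w = lead p" by blast
qed

text \<open>
  Let \<open>(a, b)\<close> be the leading monomial.  Choose a threshold \<open>v \<le> k\<close>, lower the first coordinate of the points
  with \<open>a\<^sub>i > v\<close> by one, and the second coordinate of the others; the latter is positive as \<open>a\<^sub>i + b\<^sub>i > k\<close>.  The result is
  still strictly decreasing unless points with \<open>a\<^sub>i = v\<close> and with \<open>a\<^sub>i = v + 1\<close> are moved onto the same vertical
  line.  So take for \<open>v\<close> a number that is not among the \<open>a\<^sub>i\<close>.  If there is none below \<open>k + 1 \<ge> n\<close>, then the \<open>a\<^sub>i\<close>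
  are exactly \<open>0, \<dots>, k\<close>, and \<open>v = k\<close> works because no \<open>a\<^sub>i\<close> exceeds it.
\<close>

theorem antisymmetric_ge_span_shift:
  assumes n: "n \<le> Suc k"
  shows "A_pow_ge n 1 (int (Suc k)) \<subseteq>
    cpoly.span {p * r | p r. p \<in> A_pow_ge n 1 (int k) \<and> r \<in> A_pow_ge n 0 1}" (is "_ \<subseteq> cpoly.span ?W")
proof -
  have "A_pow_ge n (int 1) (int (Suc k)) \<subseteq> cpoly.span ?W"
  proof (rule A_pow_ge_subset_span_lead)
    show "?W \<subseteq> A_pow_ge n (int 1) (int (Suc k))"
    proof
      fix w assume "w \<in> ?W"
      then obtain p r where "w = p * r" "p \<in> A_pow_ge n 1 (int k)" "r \<in> A_pow_ge n 0 1" by blast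
      then show "w \<in> A_pow_ge n (int 1) (int (Suc k))"
        using A_pow_ge_mult[of p n 1 "int k" r 0 1] by (simp add: add.commute)
    qed
    fix p assume p: "p \<in> A_pow_ge n (int 1) (int (Suc k))" "p \<noteq> 0"
    then have pA: "p \<in> A_pow n (int 1)" by (simp add: A_pow_ge_def)
    then have skew: "p \<in> skew n 1" using A_pow_subset_skew by blast
    define a where "a i = lookup (lead p) (X i)" for i
    define b where "b i = lookup (lead p) (Y i)" for i
    have deg: "Suc k \<le> a i + b i" if "i \<in> {1..n}" for i
      using p(1) that lead_in_keys[OF p(2)] by (force simp: A_pow_ge_def a_def b_def)
    have gap: "a j < a i \<or> a j = a i \<and> b j + 1 \<le> b i"
      if ij: "i \<in> {1..n}" "j \<in> {1..n}" "i < j" for i j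
      using lead_gap_sorted[OF skew p(2)] lead_block_bound[OF pA p(2) ij] ij
      unfolding gap_sorted_def a_def b_def by force
    obtain v where v: "v \<le> k" "(\<forall>i\<in>{1..n}. a i \<noteq> v) \<or> (\<forall>i\<in>{1..n}. a i \<le> v)"
    proof (cases "{..k} \<subseteq> a ` {1..n}")
      case True
      have "card (a ` {1..n}) \<le> card {..k}"
        using card_image_le[of "{1..n}" a] n by simp
      then have "a ` {1..n} = {..k}" using True by (metis card_seteq finite_atLeastAtMost finite_imageI)
      then show thesis using that[of k] by blast
    next
      case False
      then show thesis using that by (metis atMost_iff imageI subsetI)
    qed
    define high where "high i \<longleftrightarrow> v < a i" for i
    define q where "q = point_monom n (\<lambda>i. if high i then a i - 1 else a i) (\<lambda>i. if high i then b i else b i - 1)"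
    define r where "r = point_monom n (\<lambda>i. if high i then 1 else 0) (\<lambda>i. if high i then 0 else 1)"
    have b_pos: "b i > 0" if "i \<in> {1..n}" "\<not> high i" for i
      using deg[OF that(1)] that(2) v(1) by (simp add: high_def)
    have qc: "keys q \<subseteq> coords n" and rc: "keys r \<subseteq> coords n" by (simp_all add: q_def r_def keys_point_monom)
    have q: "gap_sorted n 1 q"
      unfolding gap_sorted_def
    proof (intro ballI impI)
      fix i j assume ij: "i \<in> {1..n}" "j \<in> {1..n}" "i < j"
      show "lookup q (X j) < lookup q (X i) \<or> lookup q (X j) = lookup q (X i) \<and> lookup q (Y j) + 1 \<le> lookup q (Y i)"
      proof -
        have "a j \<noteq> v \<or> a i \<le> v" using v(2) ij by auto
        then show ?thesis
          using gap[OF ij] ij b_pos[of i] b_pos[of j] by (auto simp: q_def high_def)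
      qed
    qed
    have r: "gap_sorted n 0 r"
      unfolding gap_sorted_def
    proof (intro ballI impI)
      fix i j assume ij: "i \<in> {1..n}" "j \<in> {1..n}" "i < j"
      show "lookup r (X j) < lookup r (X i) \<or> lookup r (X j) = lookup r (X i) \<and> lookup r (Y j) + 0 \<le> lookup r (Y i)"
        using gap[OF ij] ij by (auto simp: r_def high_def)
    qed
    have lead_q: "orbit_sum n 1 q \<noteq> 0" "lead (orbit_sum n 1 q) = q"
      using lead_orbit_sum[OF qc q] by auto
    have lead_r: "orbit_sum n 0 r \<noteq> 0" "lead (orbit_sum n 0 r) = r"
      using lead_orbit_sum[OF rc r] by auto
    have "orbit_sum n 1 q \<in> A_pow_ge n (int 1) (int k)"
    proof (rule orbit_sum_A_pow_ge[OF _ _ qc])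
      fix i assume i: "i \<in> {1..n}"
      then show "k \<le> lookup q (X i) + lookup q (Y i)"
        using deg[OF i] b_pos[OF i] by (auto simp: q_def high_def)
    qed simp
    moreover have "orbit_sum n 0 r \<in> A_pow_ge n (int 0) (int 1)"
      by (rule orbit_sum_A_pow_ge[OF _ _ rc]) (auto simp: r_def)
    ultimately have "orbit_sum n 1 q * orbit_sum n 0 r \<in> ?W" by auto
    moreover have "lead (orbit_sum n 1 q * orbit_sum n 0 r) = lead p"
    proof -
      have "q + r = lead p"
      proof (rule coords_monom_eqI[OF _ lead_in_coords[OF p]])
        show "keys (q + r) \<subseteq> coords n" using qc rc keys_add[of q r] by blast
        fix i assume i: "i \<in> {1..n}"
        then show "lookup (q + r) (X i) = lookup (lead p) (X i)"
          by (auto simp: lookup_add q_def r_def high_def a_def)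
        show "lookup (q + r) (Y i) = lookup (lead p) (Y i)"
          using i b_pos[OF i] by (auto simp: lookup_add q_def r_def b_def)
      qed
      then show ?thesis using lead_q lead_r by (simp add: lead_mult)
    qed
    moreover have "orbit_sum n 1 q * orbit_sum n 0 r \<noteq> 0" using lead_q lead_r by simp
    ultimately show "\<exists>w\<in>?W. w \<noteq> 0 \<and> lead w = lead p" by blast
  qed
  then show ?thesis by simp
qed

section \<open>Generation of section rings\<close>

lemma subring_generated_algebra: "subring_containing C (generated_algebra C G)"
  unfolding generated_algebra_def by (rule hull_in) (auto simp: subring_containing_def)

lemma generated_algebra_superset: "G \<subseteq> generated_algebra C G"
  unfolding generated_algebra_def by (rule hull_subset)

lemma generated_algebra_minimal: "subring_containing C T \<Longrightarrow> G \<subseteq> T \<Longrightarrow> generated_algebra C G \<subseteq> T"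
  unfolding generated_algebra_def by (rule hull_minimal)

lemma subring_containing_sum:
  assumes "subring_containing C T" "\<And>x. x \<in> A \<Longrightarrow> f x \<in> T"
  shows "(\<Sum>x\<in>A. f x) \<in> T"
  using assms by (induction A rule: infinite_finite_induct) (auto simp: subring_containing_def)

lemma subring_containing_prod:
  fixes f :: "_ \<Rightarrow> 'r::comm_ring_1"
  assumes "subring_containing C T" "\<And>x. x \<in> A \<Longrightarrow> f x \<in> T"
  shows "(\<Prod>x\<in>A. f x) \<in> T"
  using assms by (induction A rule: infinite_finite_induct) (auto simp: subring_containing_def)

lemma subring_containing_power:
  "subring_containing C T \<Longrightarrow> x \<in> T \<Longrightarrow> x ^ d \<in> T"
  by (induction d) (auto simp: subring_containing_def)

lemma subring_containing_mult: "subring_containing C T \<Longrightarrow> x \<in> T \<Longrightarrow> y \<in> T \<Longrightarrow> x * y \<in> T"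
  by (simp add: subring_containing_def)

lemma subspace_H0: "cpoly.subspace (H0 n L)"
  unfolding H0_def by (rule subspace_A_pow_ge)

lemma H0_mult: "p \<in> H0 n L \<Longrightarrow> q \<in> H0 n L' \<Longrightarrow> p * q \<in> H0 n (L + L')"
  by (simp add: H0_def A_pow_ge_mult)

lemma one_H0: "k \<le> 0 \<Longrightarrow> m \<le> 0 \<Longrightarrow> even m \<Longrightarrow> 1 \<in> H0 n (k, m)"
proof -
  assume *: "k \<le> 0" "m \<le> 0" "even m"
  then have "skew n (nat (- m)) = skew n 0" by (intro skew_cong) (simp add: even_nat_iff)
  then show ?thesis using * by (simp add: H0_def A_pow_ge_def A_pow_nonpos one_skew)
qed

lemma const_H0: "single 0 c \<in> H0 n (0, 0)"
  using cpoly.subspace_scale[OF subspace_H0 one_H0[of 0 0 n], of c] by (simp add: cscale_def)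

lemma subring_section_ring:
  fixes \<phi> :: "'g::comm_monoid_add \<Rightarrow> line_bundle"
  assumes \<phi>: "\<phi> 0 = 0" "\<And>d e. \<phi> (d + e) = \<phi> d + \<phi> e"
  shows "subring_containing (single 0 ` H0 n (0, 0)) (section_ring n \<phi>)"
proof -
  note sub = cpoly.subspace_0[OF subspace_H0] cpoly.subspace_add[OF subspace_H0]
    cpoly.subspace_neg[OF subspace_H0] cpoly.subspace_sum[OF subspace_H0]
  have zero: "\<phi> 0 = (0, 0)" using \<phi>(1) by (simp add: zero_prod_def)
  have "single 0 p \<in> section_ring n \<phi>" if "p \<in> H0 n (0, 0)" for p
    using that by (auto simp: section_ring_def lookup_single when_def zero sub)
  moreover have "1 \<in> section_ring n \<phi>"
    using one_H0[of 0 0 n] by (auto simp: section_ring_def lookup_one when_def zero sub)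
  moreover have "F * G \<in> section_ring n \<phi>" if F: "F \<in> section_ring n \<phi>" and G: "G \<in> section_ring n \<phi>" for F G
    unfolding section_ring_def
  proof (intro CollectI allI)
    fix k
    have "(lookup F d * lookup G e when d + e = k) \<in> H0 n (\<phi> k)" for d e
      using F G H0_mult[of "lookup F d" n "\<phi> d" "lookup G e" "\<phi> e"] \<phi>(2)
      by (auto simp: when_def sub section_ring_def)
    then show "lookup (F * G) k \<in> H0 n (\<phi> k)"
      unfolding lookup_mult_keys by (intro sub)
  qed
  ultimately show ?thesis
    unfolding subring_containing_def
    by (auto simp: section_ring_def lookup_add sub)
qed

text \<open>
  Constants are global functions, so the polynomials that, placed in degree \<open>d\<close>, belong to a subalgebra form a
  linear subspace.
\<close>

lemma single_span_mem:
  fixes d :: "'g::comm_monoid_add"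
  assumes T: "subring_containing (single 0 ` H0 n (0, 0)) T"
    and p: "p \<in> cpoly.span W" and W: "\<And>w. w \<in> W \<Longrightarrow> single d w \<in> T"
  shows "single d p \<in> T"
proof -
  have "cpoly.subspace {p. single d p \<in> T}"
  proof (rule cpoly.subspaceI)
    fix c q assume "q \<in> {p. single d p \<in> T}"
    then have "single 0 (single 0 c) * single d q \<in> T"
      using T const_H0 by (intro subring_containing_mult[OF T]) (auto simp: subring_containing_def)
    then show "cscale c q \<in> {p. single d p \<in> T}" by (simp add: mult_single cscale_def)
  qed (use T in \<open>auto simp: subring_containing_def single_add\<close>)
  then have "cpoly.span W \<subseteq> {p. single d p \<in> T}"
    using W by (intro cpoly.span_minimal) auto
  then show ?thesis using p by blast
qed

lemma generates_section_ringI: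
  fixes \<phi> :: "'g::comm_monoid_add \<Rightarrow> line_bundle"
  assumes \<phi>: "\<phi> 0 = 0" "\<And>d e. \<phi> (d + e) = \<phi> d + \<phi> e"
    and G: "G \<subseteq> section_ring n \<phi>"
    and gen: "\<And>T d p. subring_containing (single 0 ` H0 n (0, 0)) T \<Longrightarrow> G \<subseteq> T \<Longrightarrow>
      p \<in> H0 n (\<phi> d) \<Longrightarrow> single d p \<in> T"
  shows "generates_section_ring n \<phi> G"
  unfolding generates_section_ring_def
proof
  let ?T = "generated_algebra (single 0 ` H0 n (0, 0)) G"
  show "?T \<subseteq> section_ring n \<phi>"
    using subring_section_ring[OF \<phi>] G by (rule generated_algebra_minimal)
  show "section_ring n \<phi> \<subseteq> ?T"
  proof
    fix F assume F: "F \<in> section_ring n \<phi>"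
    have "(\<Sum>d\<in>keys F. single d (lookup F d)) \<in> ?T"
      using F gen[OF subring_generated_algebra generated_algebra_superset]
      by (intro subring_containing_sum[OF subring_generated_algebra]) (auto simp: section_ring_def)
    then show "F \<in> ?T" by (simp flip: poly_eq_sum_single)
  qed
qed

lemma sections_in_degree_subset: "sections_in_degree n \<phi> d \<subseteq> section_ring n \<phi>"
  by (auto simp: sections_in_degree_def section_ring_def lookup_single when_def cpoly.subspace_0[OF subspace_H0])

lemma single_prod:
  fixes D :: "'i \<Rightarrow> 'g::comm_monoid_add" and f :: "'i \<Rightarrow> 'b::comm_semiring_1"
  shows "(\<Prod>c\<in>A. single (D c) (f c)) = single (\<Sum>c\<in>A. D c) (\<Prod>c\<in>A. f c)"
  by (induction A rule: infinite_finite_induct) (simp_all add: mult_single)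

lemma single_power_one: "single d (1::cpoly) ^ e = single (\<Sum>c<e. d) 1"
  for d :: "'g::comm_monoid_add"
  using single_prod[of "\<lambda>_. d" "\<lambda>_. 1" "{..<e}"] by simp

text \<open>
  How the spanning theorem is used: place column \<open>c\<close> in degree \<open>D c\<close>.
\<close>

lemma single_columns_mem:
  fixes D :: "nat \<Rightarrow> 'g::comm_monoid_add"
  assumes T: "subring_containing (single 0 ` H0 n (0, 0)) T"
    and M: "M > 0" and e: "e \<le> 1" and p: "p \<in> A_pow_ge n (int (e * M)) (int k)"
    and D: "\<And>c f. c < M \<Longrightarrow> f \<in> A_pow_ge n (int e) (int ((k + c) div M)) \<Longrightarrow> single (D c) f \<in> T"
  shows "single (\<Sum>c<M. D c) p \<in> T"
proof (rule single_span_mem[OF T])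
  let ?W = "{\<Prod>c<M. f c | f. \<forall>c<M. f c \<in> A_pow_ge n (int e) (int ((k + c) div M))}"
  show "p \<in> cpoly.span ?W"
    using A_pow_ge_span_columns[OF M e, of n k] p by blast
  fix w assume "w \<in> ?W"
  then obtain f where "w = (\<Prod>c<M. f c)" "\<forall>c<M. f c \<in> A_pow_ge n (int e) (int ((k + c) div M))" by blast
  then show "single (\<Sum>c<M. D c) w \<in> T"
    using D by (auto simp flip: single_prod intro!: subring_containing_prod[OF T])
qed

subsection \<open>Consecutive pairs\<close>

text \<open>
  In degree \<open>(d1, d2)\<close> there are \<open>d1 + d2\<close> columns, and \<open>k = i (d1 + d2) + d2\<close>; so \<open>\<lfloor>(k + c) / M\<rfloor>\<close> equals \<open>i\<close> for the
  first \<open>d1\<close> columns and \<open>i + 1\<close> for the other \<open>d2\<close>.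
\<close>

lemma generates_pair_antisymmetric:
  fixes n i :: nat and \<phi> :: "nat \<times> nat \<Rightarrow> line_bundle"
  defines "\<phi> \<equiv> \<lambda>(d1, d2). tensor_power (int i, 1) d1 + tensor_power (int (Suc i), 1) d2"
  shows "generates_section_ring n \<phi> (sections_in_degree n \<phi> (1, 0) \<union> sections_in_degree n \<phi> (0, 1))"
proof (rule generates_section_ringI)
  show "\<phi> 0 = 0" "\<And>d e. \<phi> (d + e) = \<phi> d + \<phi> e"
    by (auto simp: \<phi>_def tensor_power_def zero_prod_def algebra_simps)
  show "sections_in_degree n \<phi> (1, 0) \<union> sections_in_degree n \<phi> (0, 1) \<subseteq> section_ring n \<phi>"
    using sections_in_degree_subset by blast
  fix T and d :: "nat \<times> nat" and p
  assume T: "subring_containing (single 0 ` H0 n (0, 0)) T"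
    and G: "sections_in_degree n \<phi> (1, 0) \<union> sections_in_degree n \<phi> (0, 1) \<subseteq> T"
    and p: "p \<in> H0 n (\<phi> d)"
  obtain d1 d2 where d: "d = (d1, d2)" by (cases d)
  have gen: "single (1, 0) f \<in> T" if "f \<in> A_pow_ge n 1 (int i)" for f
    using that G by (auto simp: sections_in_degree_def \<phi>_def tensor_power_def H0_def)
  have gen': "single (0, 1) f \<in> T" if "f \<in> A_pow_ge n 1 (int (Suc i))" for f
    using that G by (auto simp: sections_in_degree_def \<phi>_def tensor_power_def H0_def)
  show "single d p \<in> T"
  proof (cases "d1 + d2 = 0")
    case True
    then have "d = 0" by (simp add: d zero_prod_def)
    moreover from this have "p \<in> H0 n (0, 0)" using p by (simp add: \<phi>_def tensor_power_def zero_prod_def)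
    ultimately show ?thesis using T by (auto simp: subring_containing_def)
  next
    case False
    define M where "M = d1 + d2"
    define k where "k = i * M + d2"
    define D :: "nat \<Rightarrow> nat \<times> nat" where "D c = (if c < d1 then (1, 0) else (0, 1))" for c
    have kc: "(k + c) div M = (if c < d1 then i else Suc i)" if "c < M" for c
    proof -
      have "(k + c) div M = i + (d2 + c) div M" using False by (simp add: k_def M_def add.assoc)
      moreover have "(d2 + c) div M = (if c < d1 then 0 else 1)"
        using that by (auto simp: M_def div_eq_0_iff intro!: div_nat_eqI)
      ultimately show ?thesis by simp
    qed
    have "single (\<Sum>c<M. D c) p \<in> T"
    proof (rule single_columns_mem[OF T, where e = 1])
      show "p \<in> A_pow_ge n (int (1 * M)) (int k)"
        using p by (simp add: H0_def d \<phi>_def tensor_power_def k_def M_def algebra_simps)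
      show "single (D c) f \<in> T" if "c < M" "f \<in> A_pow_ge n (int 1) (int ((k + c) div M))" for c f
        using that(2) gen gen' unfolding kc[OF that(1)] by (simp add: D_def split: if_splits)
    qed (use False in \<open>simp_all add: M_def\<close>)
    also have "(\<Sum>c<M. D c) = d"
    proof -
      have *: "{..<d1 + d2} \<inter> {c. c < d1} = {..<d1}" "{..<d1 + d2} \<inter> - {c. c < d1} = {d1..<d1 + d2}"
        by auto
      have "fst (\<Sum>c<M. D c) = (\<Sum>c<d1 + d2. if c < d1 then 1 else 0)"
        "snd (\<Sum>c<M. D c) = (\<Sum>c<d1 + d2. if c < d1 then 0 else 1)"
        unfolding fst_sum snd_sum M_def by (intro sum.cong; simp add: D_def)+
      then show ?thesis by (intro prod_eqI) (simp_all add: d sum.If_cases *)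
    qed
    finally show ?thesis .
  qed
qed

lemma single_symmetric_mem:
  fixes d :: "'g::comm_monoid_add"
  assumes T: "subring_containing (single 0 ` H0 n (0, 0)) T"
    and gen: "\<And>f. f \<in> A_pow_ge n 0 1 \<Longrightarrow> single d f \<in> T"
    and p: "p \<in> A_pow_ge n 0 (int l)"
  shows "single (\<Sum>c<l. d) p \<in> T"
proof (cases "l = 0")
  case True
  then show ?thesis using p T by (auto simp: subring_containing_def H0_def)
next
  case False
  show ?thesis
  proof (rule single_columns_mem[OF T, where e = 0])
    show "single d f \<in> T" if "c < l" "f \<in> A_pow_ge n (int 0) (int ((l + c) div l))" for c f
      using that gen by simp
  qed (use p False in simp_all)
qed

lemma single_antisymmetric_mem:
  fixes d d' :: "'g::comm_monoid_add"
  assumes T: "subring_containing (single 0 ` H0 n (0, 0)) T" and n: "n \<ge> 1"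
    and gen: "\<And>f. f \<in> A_pow_ge n 0 1 \<Longrightarrow> single d' f \<in> T"
    and gen': "\<And>f. f \<in> A_pow_ge n 1 (int (n - 1)) \<Longrightarrow> single d f \<in> T"
    and p: "p \<in> A_pow_ge n 1 (int (n - 1 + l))"
  shows "single (d + (\<Sum>c<l. d')) p \<in> T"
  using p
proof (induction l arbitrary: p)
  case 0
  then show ?case using gen' by simp
next
  case (Suc l)
  have le: "n \<le> Suc (n - 1 + l)" by simp
  show ?case
  proof (rule single_span_mem[OF T subsetD[OF antisymmetric_ge_span_shift[OF le]]])
    show "p \<in> A_pow_ge n 1 (int (Suc (n - 1 + l)))" using Suc(2) by simp
    fix w assume "w \<in> {q * r | q r. q \<in> A_pow_ge n 1 (int (n - 1 + l)) \<and> r \<in> A_pow_ge n 0 1}"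
    then obtain q r where w: "w = q * r" "q \<in> A_pow_ge n 1 (int (n - 1 + l))" "r \<in> A_pow_ge n 0 1" by blast
    have "single (d + (\<Sum>c<l. d')) q * single d' r \<in> T"
      using Suc(1)[OF w(2)] gen[OF w(3)] by (rule subring_containing_mult[OF T])
    then show "single (d + (\<Sum>c<Suc l. d')) w \<in> T" by (simp add: mult_single w(1) add.assoc)
  qed
qed

text \<open>
  For \<open>d1 > 0\<close> column \<open>c\<close> lies in \<open>A\<^bsub>\<ge>n-1+l\<^esub>\<close> with \<open>l = \<lfloor>(d2 + c) / d1\<rfloor>\<close>, and it splits off \<open>l\<close> factors from
  \<open>S\<^bsub>\<ge>1\<^esub>\<close>.  The numbers \<open>l\<close> add up to \<open>d2\<close>.
\<close>

lemma generates_pair_last: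
  fixes n :: nat and \<phi> :: "nat \<times> nat \<Rightarrow> line_bundle"
  assumes n: "n \<ge> 1"
  defines "\<phi> \<equiv> \<lambda>(d1, d2). tensor_power (int (n - 1), 1) d1 + tensor_power (1, 0) d2"
  shows "generates_section_ring n \<phi> (sections_in_degree n \<phi> (1, 0) \<union> sections_in_degree n \<phi> (0, 1))"
proof (rule generates_section_ringI)
  show "\<phi> 0 = 0" "\<And>d e. \<phi> (d + e) = \<phi> d + \<phi> e"
    by (auto simp: \<phi>_def tensor_power_def zero_prod_def algebra_simps)
  show "sections_in_degree n \<phi> (1, 0) \<union> sections_in_degree n \<phi> (0, 1) \<subseteq> section_ring n \<phi>"
    using sections_in_degree_subset by blast
  fix T and d :: "nat \<times> nat" and p
  assume T: "subring_containing (single 0 ` H0 n (0, 0)) T"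
    and G: "sections_in_degree n \<phi> (1, 0) \<union> sections_in_degree n \<phi> (0, 1) \<subseteq> T"
    and p: "p \<in> H0 n (\<phi> d)"
  obtain d1 d2 where d: "d = (d1, d2)" by (cases d)
  have gen: "single (1, 0) f \<in> T" if "f \<in> A_pow_ge n 1 (int (n - 1))" for f
    using that G by (auto simp: sections_in_degree_def \<phi>_def tensor_power_def H0_def)
  have gen': "single (0, 1) f \<in> T" if "f \<in> A_pow_ge n 0 1" for f
    using that G by (auto simp: sections_in_degree_def \<phi>_def tensor_power_def H0_def)
  have sum_pair: "(\<Sum>c<l. (0, Suc 0)) = (0 :: nat, l)" for l
    by (intro prod_eqI) (simp_all add: fst_sum snd_sum)
  show "single d p \<in> T"
  proof (cases "d1 = 0")
    case True
    then have "p \<in> A_pow_ge n 0 (int d2)"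
      using p by (simp add: H0_def d \<phi>_def tensor_power_def)
    from single_symmetric_mem[OF T gen' this] show ?thesis by (simp add: d True sum_pair)
  next
    case False
    define k where "k = (n - 1) * d1 + d2"
    have "single (\<Sum>c<d1. (1, (d2 + c) div d1)) p \<in> T"
    proof (rule single_columns_mem[OF T, where e = 1])
      have "int k = int d1 * int (n - 1) + int d2" by (simp add: k_def mult.commute)
      then show "p \<in> A_pow_ge n (int (1 * d1)) (int k)"
        using p by (simp add: H0_def d \<phi>_def tensor_power_def)
      fix c f assume f: "f \<in> A_pow_ge n (int 1) (int ((k + c) div d1))"
      have "(k + c) div d1 = n - 1 + (d2 + c) div d1" using False by (simp add: k_def add.assoc)
      then have "f \<in> A_pow_ge n 1 (int (n - 1 + (d2 + c) div d1))" using f by simp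
      from single_antisymmetric_mem[OF T n gen' gen this] show "single (1, (d2 + c) div d1) f \<in> T"
        by (simp add: sum_pair)
    qed (use False in simp_all)
    also have "(\<Sum>c<d1. (1, (d2 + c) div d1)) = d"
      using False by (intro prod_eqI) (simp_all add: fst_sum snd_sum d sum_div_shift)
    finally show ?thesis .
  qed
qed

subsection \<open>Powers of a single line bundle\<close>

text \<open>
  The columns with the same residue \<open>g\<close> modulo \<open>d\<close> are \<open>c = s d + g\<close> with \<open>s < \<mu>\<close>.  Their degree bounds
  are \<open>\<lfloor>(k + s) / \<mu>\<rfloor>\<close>, which add up to \<open>k\<close> by Hermite's identity, in each of the \<open>d\<close> groups.
\<close>

lemma A_pow_ge_span_groups:
  assumes d: "d > 0" and \<mu>: "\<mu> > 0" and e: "e \<le> 1"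
  shows "A_pow_ge n (int (e * (d * \<mu>))) (int (d * k)) \<subseteq>
    cpoly.span {\<Prod>g<d. h g | h. \<forall>g<d. h g \<in> A_pow_ge n (int (e * \<mu>)) (int k)}" (is "_ \<subseteq> cpoly.span ?W")
proof -
  have "{\<Prod>c<d * \<mu>. f c | f. \<forall>c<d * \<mu>. f c \<in> A_pow_ge n (int e) (int ((d * k + c) div (d * \<mu>)))} \<subseteq> ?W"
  proof
    fix w assume "w \<in> {\<Prod>c<d * \<mu>. f c | f. \<forall>c<d * \<mu>. f c \<in> A_pow_ge n (int e) (int ((d * k + c) div (d * \<mu>)))}"
    then obtain f where w: "w = (\<Prod>c<d * \<mu>. f c)"
      and f: "\<And>c. c < d * \<mu> \<Longrightarrow> f c \<in> A_pow_ge n (int e) (int ((d * k + c) div (d * \<mu>)))" by blast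
    define h where "h g = (\<Prod>s<\<mu>. f (s * d + g))" for g
    have "w = (\<Prod>s<\<mu>. \<Prod>c\<in>{s * d..<s * d + d}. f c)"
      unfolding w by (simp only: prod.nat_group mult.commute)
    also have "\<dots> = (\<Prod>s<\<mu>. \<Prod>g<d. f (s * d + g))"
      by (rule prod.cong[OF refl], subst prod.atLeastLessThan_shift_0) (simp add: lessThan_atLeast0)
    also have "\<dots> = (\<Prod>g<d. h g)" unfolding h_def by (rule prod.swap)
    finally have "w = (\<Prod>g<d. h g)" .
    moreover have "h g \<in> A_pow_ge n (int (e * \<mu>)) (int k)" if g: "g < d" for g
    proof -
      have "f (s * d + g) \<in> A_pow_ge n (int e) (int ((k + s) div \<mu>))" if s: "s < \<mu>" for s
      proof -
        have "Suc s * d \<le> \<mu> * d" using s by (intro mult_le_mono1) simp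
        then have "s * d + g < d * \<mu>" using g by (simp add: mult.commute)
        moreover have "(d * k + (s * d + g)) div (d * \<mu>) = (k + s) div \<mu>"
        proof -
          have "(d * k + (s * d + g)) div d = k + s"
            using g by (simp add: div_nat_eqI algebra_simps)
          then show ?thesis by (simp add: div_mult2_eq)
        qed
        ultimately show ?thesis using f by metis
      qed
      then have "h g \<in> A_pow_ge n (\<Sum>s<\<mu>. int e) (\<Sum>s<\<mu>. int ((k + s) div \<mu>))"
        unfolding h_def by (intro A_pow_ge_prod) auto
      then show ?thesis
        using sum_div_shift[OF \<mu>, of k] by (simp add: mult.commute flip: of_nat_sum)
    qed
    ultimately show "w \<in> ?W" by blast
  qed
  then show ?thesis
    using A_pow_ge_span_columns[of "d * \<mu>" e n "d * k"] d \<mu> e cpoly.span_mono by (meson order_trans nat_0_less_mult_iff)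
qed

text \<open>
  For \<open>m > 0\<close> the sections are grouped as products of \<open>m\<close> antisymmetric polynomials.  For \<open>m = 0\<close> and \<open>k > 0\<close> they
  are grouped as products of \<open>k\<close> symmetric ones.  For \<open>m = k = 0\<close> all degrees contain the same functions, and the
  polynomial \<open>1\<close> in degree \<open>1\<close> connects them.
\<close>

lemma generates_powers:
  assumes km: "k \<ge> 0" "m \<ge> 0"
  shows "generates_section_ring n (tensor_power (k, m)) (sections_in_degree n (tensor_power (k, m)) 1)"
proof (rule generates_section_ringI)
  show "tensor_power (k, m) 0 = 0" "\<And>d e. tensor_power (k, m) (d + e) = tensor_power (k, m) d + tensor_power (k, m) e"
    by (auto simp: tensor_power_def zero_prod_def algebra_simps)
  show "sections_in_degree n (tensor_power (k, m)) 1 \<subseteq> section_ring n (tensor_power (k, m))"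
    by (rule sections_in_degree_subset)
  fix T and d :: nat and p
  assume T: "subring_containing (single 0 ` H0 n (0, 0)) T"
    and G: "sections_in_degree n (tensor_power (k, m)) 1 \<subseteq> T"
    and p: "p \<in> H0 n (tensor_power (k, m) d)"
  have gen: "single 1 f \<in> T" if "f \<in> A_pow_ge n m k" for f
    using that G by (auto simp: sections_in_degree_def tensor_power_def H0_def)
  have gens: "single d p \<in> T" if e: "e \<le> 1" and \<mu>: "\<mu> > 0" "int (e * \<mu>) = m" and d: "d > 0" for e \<mu>
  proof (rule single_span_mem[OF T])
    let ?W = "{\<Prod>g<d. h g | h. \<forall>g<d. h g \<in> A_pow_ge n (int (e * \<mu>)) (int (nat k))}"
    have dm: "int (e * (d * \<mu>)) = int d * m" by (simp flip: \<mu>(2))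
    have dk: "int (d * nat k) = int d * k" using km by simp
    then have "p \<in> A_pow_ge n (int (e * (d * \<mu>))) (int (d * nat k))"
      using p unfolding dm dk by (simp add: H0_def tensor_power_def)
    then show "p \<in> cpoly.span ?W"
      using A_pow_ge_span_groups[OF d \<mu>(1) e] by blast
    fix w assume "w \<in> ?W"
    then obtain h where "w = (\<Prod>g<d. h g)" "\<forall>g<d. h g \<in> A_pow_ge n m k" using \<mu>(2) km by auto
    then have "(\<Prod>g<d. single 1 (h g)) \<in> T" "w = (\<Prod>g<d. h g)"
      using gen by (auto intro!: subring_containing_prod[OF T])
    then show "single d w \<in> T" by (simp add: single_prod)
  qed
  consider "d = 0" | "d > 0" "m > 0" | "d > 0" "m = 0" "k > 0" | "m = 0" "k = 0" using km by linarith
  then show "single d p \<in> T"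
  proof cases
    case 1
    then show ?thesis using p T by (auto simp: subring_containing_def tensor_power_def)
  next
    case 2
    then show ?thesis by (intro gens[of 1 "nat m"]) simp_all
  next
    case 3
    then show ?thesis by (intro gens[of 0 "nat k"]) simp_all
  next
    case 4
    then have "single 0 p \<in> T" using p T by (auto simp: subring_containing_def tensor_power_def)
    moreover have "single 1 1 ^ d \<in> T"
      using one_H0[of 0 0 n] by (intro subring_containing_power[OF T] gen) (simp add: 4 H0_def)
    ultimately have "single 0 p * single 1 1 ^ d \<in> T" by (rule subring_containing_mult[OF T])
    then show ?thesis by (simp add: single_power_one mult_single)
  qed
qed

subsection \<open>The total coordinate ring\<close>

lemma generating_bidegrees_eq:
  "generating_bidegrees n = (\<lambda>i. (int i, 1)) ` {..<n} \<union> {(1, 0), (-1, 0), (0, -2)}"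
  by (auto simp: generating_bidegrees_def main_bundles_def)

text \<open>
  Powers of \<open>s_E\<close> and \<open>s_B\<close> reduce to \<open>k \<ge> 0\<close> and \<open>m \<ge> 0\<close>, where the columns are elements of \<open>A\<^bsub>\<ge>l\<^esub>\<close>: generators
  if \<open>l < n\<close>, and otherwise products of an element of \<open>A\<^bsub>\<ge>n-1\<^esub>\<close> and elements of \<open>S\<^bsub>\<ge>1\<^esub>\<close>.
\<close>

lemma generates_total:
  assumes n: "n \<ge> 1"
  shows "generates_section_ring n (\<lambda>L. L) (\<Union>L\<in>generating_bidegrees n. cox_generators n L)"
proof (rule generates_section_ringI)
  let ?G = "\<Union>L\<in>generating_bidegrees n. cox_generators n L"
  have "s_E \<in> section_ring n (\<lambda>L. L)" "s_B \<in> section_ring n (\<lambda>L. L)"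
    using one_H0[of "-1" 0 n] one_H0[of 0 "-2" n]
    by (auto simp: s_E_def s_B_def section_ring_def lookup_single when_def cpoly.subspace_0[OF subspace_H0])
  then show "?G \<subseteq> section_ring n (\<lambda>L. L)"
    using sections_in_degree_subset[of n "\<lambda>L. L"] by (fastforce simp: cox_generators_def split: if_splits)
  fix T and L :: line_bundle and p
  assume T: "subring_containing (single 0 ` H0 n (0, 0)) T" and G: "?G \<subseteq> T" and p: "p \<in> H0 n L"
  have sub: "cox_generators n L \<subseteq> T" if "L \<in> generating_bidegrees n" for L using G that by blast
  have gen: "single (int i, 1) f \<in> T" if "f \<in> A_pow_ge n 1 (int i)" "i < n" for i f
    using that sub[of "(int i, 1)"]
    by (auto simp: cox_generators_def sections_in_degree_def H0_def generating_bidegrees_eq)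
  have gen': "single (1, 0) f \<in> T" if "f \<in> A_pow_ge n 0 1" for f
    using that sub[of "(1, 0)"]
    by (auto simp: cox_generators_def sections_in_degree_def H0_def generating_bidegrees_eq)
  have s: "s_E \<in> T" "s_B \<in> T"
    using sub[of "(-1, 0)"] sub[of "(0, -2)"] by (auto simp: cox_generators_def generating_bidegrees_eq)
  have sum_pair: "(\<Sum>c<l. (x, y)) = (int l * x, int l * y)" for l x y
    by (intro prod_eqI) (simp_all add: fst_sum snd_sum)
  have sym: "single (int l, 0) f \<in> T" if "f \<in> A_pow_ge n 0 (int l)" for l f
    using single_symmetric_mem[OF T gen' that] by (simp add: sum_pair)
  have anti: "single (int l, 1) f \<in> T" if f: "f \<in> A_pow_ge n 1 (int l)" for l f
  proof (cases "l < n")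
    case True
    then show ?thesis using gen f by simp
  next
    case False
    then have l: "n - 1 + (l - (n - 1)) = l" by simp
    then have "f \<in> A_pow_ge n 1 (int (n - 1 + (l - (n - 1))))" using f by simp
    from single_antisymmetric_mem[OF T n gen' gen this, of "n - 1"]
    show ?thesis using n False by (simp add: sum_pair)
  qed
  have nonneg: "single (int l, int j) f \<in> T" if f: "f \<in> A_pow_ge n (int j) (int l)" for l j f
  proof (cases "j = 0")
    case True
    then show ?thesis using sym f by simp
  next
    case False
    have "single (\<Sum>c<j. (int ((l + c) div j), 1)) f \<in> T"
      by (rule single_columns_mem[OF T, where e = 1]) (use False f anti in simp_all)
    also have "(\<Sum>c<j. (int ((l + c) div j), 1)) = (int l, int j)"
      using False sum_div_shift[of j l] by (intro prod_eqI) (simp_all add: fst_sum snd_sum flip: of_nat_sum)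
    finally show ?thesis .
  qed
  have nonneg_k: "single (int l, m) f \<in> T" if f: "f \<in> A_pow_ge n m (int l)" for l m f
  proof (cases "m \<ge> 0")
    case True
    then show ?thesis using nonneg[of f "nat m" l] f by simp
  next
    case False
    \<comment> \<open>For \<open>m < 0\<close> the space depends only on the parity of \<open>m\<close>, and \<open>s_B\<^sup>j\<close> leads from \<open>m mod 2\<close> down to \<open>m\<close>.\<close>
    define j where "j = nat ((m mod 2 - m) div 2)"
    have m: "m + 2 * int j = m mod 2"
    proof -
      have "even (m mod 2 - m)" by presburger
      moreover have "m mod 2 - m \<ge> 0" using False by simp
      ultimately show ?thesis by (simp add: j_def)
    qed
    have "A_pow n m = A_pow n (m mod 2)"
    proof (cases "even m")
      case True
      then have "skew n (nat (- m)) = skew n 0" using False by (intro skew_cong) (simp add: even_nat_iff)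
      then show ?thesis using True False by (simp add: A_pow_nonpos A_pow_0 even_iff_mod_2_eq_zero)
    next
      case odd: False
      then have "skew n (nat (- m)) = skew n 1" using False by (intro skew_cong) (simp add: even_nat_iff)
      then show ?thesis using odd False by (simp add: A_pow_nonpos A_pow_1 odd_iff_mod_2_eq_one)
    qed
    then have "f \<in> A_pow_ge n (int (nat (m mod 2))) (int l)" using f by (simp add: A_pow_ge_def)
    from subring_containing_mult[OF T nonneg[OF this] subring_containing_power[OF T s(2), of j]]
    have "single ((int l, int (nat (m mod 2))) + (int j * 0, int j * - 2)) f \<in> T"
      by (simp only: s_B_def single_power_one mult_single sum_pair mult_1_right)
    moreover have "(int l, int (nat (m mod 2))) + (int j * 0, int j * - 2) = (int l, m)"
      using m by simp
    ultimately show ?thesis by simp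
  qed
  obtain k m where L: "L = (k, m)" by (cases L)
  show "single L p \<in> T"
  proof (cases "k \<ge> 0")
    case True
    then show ?thesis using nonneg_k[of p m "nat k"] p by (simp add: L H0_def)
  next
    case False
    have "p \<in> A_pow_ge n m (int 0)" using p by (auto simp: L H0_def A_pow_ge_def)
    from subring_containing_mult[OF T nonneg_k[OF this] subring_containing_power[OF T s(1), of "nat (- k)"]]
    show ?thesis using False by (simp add: s_E_def single_power_one mult_single sum_pair L)
  qed
qed simp_all

section \<open>Minimality\<close>

lemma not_generates:
  assumes "subring_containing (single 0 ` H0 n (0, 0)) T" "G \<subseteq> T" "p \<in> H0 n (\<phi> d)" "single d p \<notin> T"
  shows "\<not> generates_section_ring n \<phi> G"
proof
  assume "generates_section_ring n \<phi> G"
  then have "section_ring n \<phi> \<subseteq> T"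
    using generated_algebra_minimal[OF assms(1,2)] by (simp add: generates_section_ring_def)
  moreover have "single d p \<in> section_ring n \<phi>"
    using assms(3) sections_in_degree_subset[of n \<phi> d] by (auto simp: sections_in_degree_def)
  ultimately show False using assms(4) by blast
qed

lemma cox_generators_single:
  "F \<in> cox_generators n L \<Longrightarrow> \<exists>f\<in>H0 n L. F = single L f"
  using one_H0[of "-1" 0 n] one_H0[of 0 "-2" n]
  by (auto simp: cox_generators_def s_E_def s_B_def sections_in_degree_def split: if_splits)

text \<open>
  A generator is certainly needed if its degree lies outside the monoid generated by the degrees of the others.
\<close>

lemma subring_support:
  fixes M :: "'g::comm_monoid_add set"
  assumes "0 \<in> M" "\<And>d e. d \<in> M \<Longrightarrow> e \<in> M \<Longrightarrow> d + e \<in> M"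
  shows "subring_containing (single 0 ` H0 n (0, 0)) {F. keys F \<subseteq> M}"
proof -
  have "keys (F * G) \<subseteq> M" if "keys F \<subseteq> M" "keys G \<subseteq> M" for F G :: "'g \<Rightarrow>\<^sub>0 cpoly"
    using keys_mult[of F G] that assms(2) by blast
  moreover have "keys (F + G) \<subseteq> M" if "keys F \<subseteq> M" "keys G \<subseteq> M" for F G :: "'g \<Rightarrow>\<^sub>0 cpoly"
    using keys_add[of F G] that by blast
  moreover have "keys (- F) \<subseteq> M" if "keys F \<subseteq> M" for F :: "'g \<Rightarrow>\<^sub>0 cpoly"
    using that by (auto simp: in_keys_iff)
  ultimately show ?thesis using assms(1) by (auto simp: subring_containing_def split: if_splits)
qed

lemma not_generates_support:
  assumes "0 \<in> M" "\<And>d e. d \<in> M \<Longrightarrow> e \<in> M \<Longrightarrow> d + e \<in> M"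
    and "D \<subseteq> M" "L \<notin> M" "p \<in> H0 n L" "p \<noteq> 0"
  shows "\<not> generates_section_ring n (\<lambda>L. L) (\<Union>L'\<in>D. cox_generators n L')"
proof (rule not_generates[OF subring_support[of M]])
  show "(\<Union>L'\<in>D. cox_generators n L') \<subseteq> {F. keys F \<subseteq> M}"
    using assms(3) by (auto dest!: cox_generators_single split: if_splits)
qed (use assms in auto)

subsection \<open>First derivatives where two points coincide\<close>

text \<open>
  The restriction to the locus where the second point coincides with the first one.
\<close>

definition merge :: "monom \<Rightarrow> monom" where
  "merge = move (Y 2) (Y 1) \<circ> move (X 2) (X 1)"

definition point_degree :: "monom \<Rightarrow> nat \<Rightarrow> nat" where
  "point_degree t l = lookup t (X l) + lookup t (Y l)"

text \<open>
  The derivation \<open>x\<^sub>1 \<partial>/\<partial>x\<^sub>1\<close>, followed by the restriction to that locus.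
\<close>

definition dx :: "cpoly \<Rightarrow> cpoly" where
  "dx = wpush (\<lambda>t. of_nat (lookup t (X 1))) merge"

lemma merge_add: "merge (s + t) = merge s + merge t"
  by (simp add: merge_def move_add)

lemma lookup_merge:
  "lookup (merge t) (X l) = (if l = 2 then 0 else if l = 1 then lookup t (X 1) + lookup t (X 2) else lookup t (X l))"
  "lookup (merge t) (Y l) = (if l = 2 then 0 else if l = 1 then lookup t (Y 1) + lookup t (Y 2) else lookup t (Y l))"
  by (simp_all add: merge_def lookup_move)

lemma point_degree_merge:
  "point_degree (merge t) 1 = point_degree t 1 + point_degree t 2"
  "l \<ge> 3 \<Longrightarrow> point_degree (merge t) l = point_degree t l"
  "point_degree (merge t) (Suc 0) = point_degree t 1 + point_degree t 2"
  by (simp_all add: point_degree_def lookup_merge)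

lemma point_degree_add: "point_degree (s + t) l = point_degree s l + point_degree t l"
  by (simp add: point_degree_def lookup_add)

lemma push_merge_mult: "push merge (p * q) = push merge p * push merge q"
  by (simp add: push_mult merge_add)

lemma dx_mult: "dx (p * q) = dx p * push merge q + push merge p * dx q"
  using wpush_Leibniz[of merge "\<lambda>t. lookup t (X 1)" 1 p q]
  by (simp add: dx_def merge_add lookup_add)

lemma push_merge_skew: "n \<ge> 2 \<Longrightarrow> f \<in> skew n 1 \<Longrightarrow> push merge f = 0"
  using push_merge_antisymmetric[of f n 1 2] by (simp add: merge_def skew_1)

text \<open>
  A condition on the elements of degree \<open>L = (k, m)\<close> of a subring, expressed in terms of the monomials that are \<open>ok\<close> or
  \<open>good\<close> for \<open>k\<close>.  Only the parity of \<open>m\<close> enters, as multiplication by \<open>s_B\<close> preserves it.  For odd \<open>m\<close> the restriction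
  vanishes, so the derivative of a product with an element of even degree is the derivative of the factor with odd
  \<open>m\<close> times the restriction of the other one; and a product of two elements with odd \<open>m\<close> restricts to zero.
\<close>

definition diagonal_condition ::
    "(int \<Rightarrow> monom \<Rightarrow> bool) \<Rightarrow> (int \<Rightarrow> monom \<Rightarrow> bool) \<Rightarrow> line_bundle \<Rightarrow> cpoly \<Rightarrow> bool" where
  "diagonal_condition ok good L f \<longleftrightarrow>
    (if even (snd L) then \<forall>w\<in>keys (push merge f). ok (fst L) w
     else push merge f = 0 \<and> (\<forall>w\<in>keys (dx f). good (fst L) w))"

lemma diagonal_condition_0: "diagonal_condition ok good L 0"
  by (simp add: diagonal_condition_def dx_def)

lemma diagonal_condition_add:
  assumes "diagonal_condition ok good L f" "diagonal_condition ok good L g"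
  shows "diagonal_condition ok good L (f + g)"
  using assms keys_add[of "push merge f" "push merge g"] keys_add[of "dx f" "dx g"]
  by (fastforce simp: diagonal_condition_def wpush_add dx_def)

lemma diagonal_condition_uminus:
  "diagonal_condition ok good L f \<Longrightarrow> diagonal_condition ok good L (- f)"
  by (simp add: diagonal_condition_def wpush_uminus dx_def in_keys_iff)

lemma diagonal_condition_mult:
  assumes ok: "\<And>k k' w w'. ok k w \<Longrightarrow> ok k' w' \<Longrightarrow> ok (k + k') (w + w')"
    and good: "\<And>k k' w w'. good k w \<Longrightarrow> ok k' w' \<Longrightarrow> good (k + k') (w + w')"
    and f: "diagonal_condition ok good L f" and g: "diagonal_condition ok good L' g"
  shows "diagonal_condition ok good (L + L') (f * g)"
proof -
  have odd_even: "diagonal_condition ok good (L + L') (f * g)"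
    if f: "diagonal_condition ok good L f" "odd (snd L)"
      and g: "diagonal_condition ok good L' g" "even (snd L')" for L L' f g
  proof -
    have "push merge f = 0" using f by (simp add: diagonal_condition_def)
    then have "push merge (f * g) = 0" "dx (f * g) = dx f * push merge g"
      by (simp_all add: push_merge_mult dx_mult)
    moreover have "good (fst L + fst L') w" if "w \<in> keys (dx f * push merge g)" for w
      using keys_mult[of "dx f" "push merge g"] that f g good by (auto simp: diagonal_condition_def)
    ultimately show ?thesis using f g by (simp add: diagonal_condition_def)
  qed
  consider "odd (snd L)" "even (snd L')" | "even (snd L)" "odd (snd L')"
    | "even (snd L)" "even (snd L')" | "odd (snd L)" "odd (snd L')" by blast
  then show ?thesis
  proof cases
    case 1
    then show ?thesis using odd_even f g by blast
  next
    case 2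
    then show ?thesis using odd_even[OF g _ f] by (simp add: ac_simps)
  next
    case 3
    then show ?thesis
      using keys_mult[of "push merge f" "push merge g"] f g ok
      by (auto simp: diagonal_condition_def push_merge_mult)
  next
    case 4
    then show ?thesis using f by (simp add: diagonal_condition_def push_merge_mult)
  qed
qed

text \<open>
  Since all generators of degree \<open>(j, 1)\<close> are antisymmetric and thus vanish on the locus of coincidence, it remains to
  check that their derivatives, and the restrictions of the symmetric generators, have admissible monomials.
\<close>

lemma not_generates_diagonal:
  assumes n: "n \<ge> 2"
    and ok: "\<And>k k' w w'. ok k w \<Longrightarrow> ok k' w' \<Longrightarrow> ok (k + k') (w + w')" "\<And>k w. k \<le> 0 \<Longrightarrow> ok k w"
    and good: "\<And>k k' w w'. good k w \<Longrightarrow> ok k' w' \<Longrightarrow> good (k + k') (w + w')"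
    and D: "D \<subseteq> generating_bidegrees n"
    and sym: "\<And>f t. (1, 0) \<in> D \<Longrightarrow> f \<in> A_pow_ge n 0 1 \<Longrightarrow> t \<in> keys f \<Longrightarrow> ok 1 (merge t)"
    and anti: "\<And>j f t. (int j, 1) \<in> D \<Longrightarrow> f \<in> A_pow_ge n 1 (int j) \<Longrightarrow> t \<in> keys f \<Longrightarrow> good (int j) (merge t)"
    and p: "p \<in> H0 n L" "\<not> diagonal_condition ok good L p"
  shows "\<not> generates_section_ring n (\<lambda>L. L) (\<Union>L'\<in>D. cox_generators n L')"
proof (rule not_generates)
  let ?T = "{F. \<forall>L. diagonal_condition ok good L (lookup F L)}"
  have single: "single L f \<in> ?T" if "diagonal_condition ok good L f" for L f
    using that diagonal_condition_0 by (auto simp: lookup_single when_def)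
  have const: "single 0 f \<in> ?T" for f
    using ok(2) by (intro single) (simp add: diagonal_condition_def)
  have "F * G \<in> ?T" if F: "F \<in> ?T" and G: "G \<in> ?T" for F G
  proof (intro CollectI allI)
    fix L
    have sum: "diagonal_condition ok good L (\<Sum>x\<in>A. h x)"
      if "\<And>x. x \<in> A \<Longrightarrow> diagonal_condition ok good L (h x)" for A :: "line_bundle set" and h
      using that by (induction A rule: infinite_finite_induct)
        (simp_all add: diagonal_condition_0 diagonal_condition_add)
    have "diagonal_condition ok good L (lookup F d * lookup G e when d + e = L)" for d e
    proof -
      have "diagonal_condition ok good d (lookup F d)" "diagonal_condition ok good e (lookup G e)"
        using F G by blast+
      then have "diagonal_condition ok good (d + e) (lookup F d * lookup G e)"
        using ok(1) good by (intro diagonal_condition_mult)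
      then show ?thesis by (cases "d + e = L") (simp_all only: when_def refl if_True if_False diagonal_condition_0)
    qed
    then show "diagonal_condition ok good L (lookup (F * G) L)"
      unfolding lookup_mult_keys by (intro sum)
  qed
  moreover have "1 \<in> ?T" using const[of 1] by (simp only: single_one)
  ultimately show "subring_containing (single 0 ` H0 n (0, 0)) ?T"
    using const unfolding subring_containing_def
    by (auto simp: lookup_add diagonal_condition_0 intro: diagonal_condition_add diagonal_condition_uminus)
  show "(\<Union>L'\<in>D. cox_generators n L') \<subseteq> ?T"
  proof
    fix F assume "F \<in> (\<Union>L'\<in>D. cox_generators n L')"
    then obtain L where L: "L \<in> D" "F \<in> cox_generators n L" by blast
    then obtain f where f: "F = single L f" "f \<in> H0 n L" using cox_generators_single by blast
    have "L \<in> generating_bidegrees n" using L D by blast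
    then consider (anti) j where "L = (int j, 1)" | (sym) "L = (1, 0)"
      | (E) "L = (-1, 0)" | (B) "L = (0, -2)"
      by (auto simp: generating_bidegrees_eq)
    then show "F \<in> ?T"
    proof cases
      case (anti j)
      then have A: "f \<in> A_pow_ge n 1 (int j)" using f(2) by (simp add: H0_def)
      then have "f \<in> skew n 1" by (simp add: A_pow_ge_def A_pow_1)
      moreover have "good (int j) w" if "w \<in> keys (dx f)" for w
        using keys_wpush[of "\<lambda>t. of_nat (lookup t (X 1))" merge f] that assms(7)[of j f] A L anti
        unfolding dx_def by blast
      ultimately show ?thesis
        unfolding f(1) using anti n
        by (intro single) (simp add: diagonal_condition_def push_merge_skew)
    next
      case sym
      then have A: "f \<in> A_pow_ge n 0 1" using f(2) by (simp add: H0_def)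
      have "ok 1 w" if "w \<in> keys (push merge f)" for w
        using keys_wpush[of "\<lambda>_. 1" merge f] that assms(6)[of f] A L sym by blast
      then show ?thesis
        unfolding f(1) using sym by (intro single) (simp add: diagonal_condition_def)
    next
      case E
      then show ?thesis
        unfolding f(1) using ok(2) by (intro single) (simp add: diagonal_condition_def)
    next
      case B
      then show ?thesis
        unfolding f(1) using ok(2) by (intro single) (simp add: diagonal_condition_def)
    qed
  qed
  show "p \<in> H0 n L" by (rule p)
  show "single L p \<notin> ?T" using p(2) by (metis (mono_tags, lifting) lookup_single_eq mem_Collect_eq)
qed

subsection \<open>Sections that are not products\<close>

lemma antisymmetric_distinct_points:
  assumes f: "f \<in> skew n 1" "t \<in> keys f" and ij: "i \<in> {1..n}" "j \<in> {1..n}" "i \<noteq> j"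
  shows "lookup t (X i) \<noteq> lookup t (X j) \<or> lookup t (Y i) \<noteq> lookup t (Y j)"
proof (rule ccontr)
  assume eq: "\<not> ?thesis"
  let ?\<tau> = "Transposition.transpose i j"
  have \<tau>: "?\<tau> permutes {1..n}" using ij by (intro permutes_swap_id) auto
  have inj: "inj ?\<tau>" using \<tau> by (rule permutes_inj)
  have "perm ?\<tau> t = t"
    using inj eq by (intro monom_eqI) (auto simp: transpose_def)
  then have "lookup f t = - lookup f t"
    using lookup_skew[OF f(1) \<tau>, of t] ij by (simp add: sign_swap_id)
  then show False using f(2) by (simp add: in_keys_iff)
qed

definition abscissa :: "nat \<Rightarrow> nat" where
  "abscissa l = (if l = 1 then 1 else if l = 2 then 0 else l - 1)"

lemma abscissa_inj: "l \<ge> 1 \<Longrightarrow> l' \<ge> 1 \<Longrightarrow> abscissa l = abscissa l' \<Longrightarrow> l = l'"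
  unfolding abscissa_def by presburger

text \<open>
  For \<open>n \<ge> 2\<close> the points have the distinct first coordinates \<open>0, \<dots>, n - 1\<close>, and if \<open>i < n\<close>, then those with
  first coordinate at most \<open>i\<close> have degree \<open>i\<close>.  The first two points, which will be merged, are \<open>(1, i - 1)\<close> and \<open>(0, i)\<close>, or \<open>(1, 0)\<close> and \<open>(0, 0)\<close> if
  \<open>i = 0\<close>.
\<close>

definition staircase :: "nat \<Rightarrow> nat \<Rightarrow> monom" where
  "staircase n i = point_monom n abscissa (\<lambda>l. i - abscissa l)"

lemma lookup_staircase:
  "l \<in> {1..n} \<Longrightarrow> lookup (staircase n i) (X l) = abscissa l"
  "l \<in> {1..n} \<Longrightarrow> lookup (staircase n i) (Y l) = i - abscissa l"
  by (simp_all add: staircase_def)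

lemma lookup_staircase_inj:
  assumes "l \<in> {1..n}" "l' \<in> {1..n}" "lookup (staircase n i) (X l) = lookup (staircase n i) (X l')"
  shows "l = l'"
  using assms abscissa_inj[of l l'] by (simp add: lookup_staircase)

lemma lookup_orbit_sum_staircase: "lookup (orbit_sum n 1 (staircase n i)) (staircase n i) = 1"
proof -
  have "\<sigma> = id" if \<sigma>: "\<sigma> permutes {1..n}" "perm \<sigma> (staircase n i) = staircase n i" for \<sigma>
  proof
    fix l
    have "lookup (staircase n i) (X (\<sigma> l)) = lookup (staircase n i) (X l)"
      using arg_cong[OF \<sigma>(2), of "\<lambda>r. lookup r (X l)"] permutes_inj[OF \<sigma>(1)] by simp
    then show "\<sigma> l = id l"
      using permutes_in_image[OF \<sigma>(1), of l] permutes_not_in[OF \<sigma>(1), of l] lookup_staircase_inj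
      by (cases "l \<in> {1..n}") auto
  qed
  then have *: "{\<sigma>. \<sigma> permutes {1..n} \<and> perm \<sigma> (staircase n i) = staircase n i} = {id}"
    by (auto simp: permutes_id)
  have "lookup (orbit_sum n 1 (staircase n i)) (staircase n i) =
      (\<Sum>\<sigma> | \<sigma> permutes {1..n} \<and> perm \<sigma> (staircase n i) = staircase n i. of_int (sign \<sigma>))"
    unfolding orbit_sum_def lookup_sum lookup_single when_def
    by (subst sum.inter_filter[symmetric]) (simp_all add: finite_permutations)
  then show ?thesis unfolding * by (simp add: sign_id)
qed

lemma orbit_sum_staircase_H0: "orbit_sum n 1 (staircase n i) \<in> H0 n (int i, 1)"
proof -
  have "orbit_sum n 1 (staircase n i) \<in> A_pow_ge n (int 1) (int i)"
    by (rule orbit_sum_A_pow_ge) (simp_all add: lookup_staircase, simp add: staircase_def keys_point_monom)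
  then show ?thesis by (simp add: H0_def)
qed

text \<open>
  Among the terms of the alternant, only the identity and the exchange of the first two points lead to this merged
  monomial, and the exchanged term has \<open>x\<^sub>1\<close>-exponent \<open>0\<close>.  So the derivative does not cancel.
\<close>

lemma merge_staircase_keys_dx:
  assumes n: "n \<ge> 2"
  shows "merge (staircase n i) \<in> keys (dx (orbit_sum n 1 (staircase n i)))"
proof -
  let ?P = "staircase n i" and ?p = "orbit_sum n 1 (staircase n i)"
  have "of_nat (lookup t (X 1)) * lookup ?p t = (if t = ?P then 1 else 0)"
    if t: "t \<in> keys ?p" "merge t = merge ?P" for t
  proof (cases "lookup t (X 1) = 0")
    case True
    moreover have "lookup ?P (X 1) = 1" using n by (simp add: lookup_staircase abscissa_def)
    ultimately show ?thesis by auto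
  next
    case False
    obtain \<sigma> where \<sigma>: "\<sigma> permutes {1..n}" "t = perm \<sigma> ?P" using t(1) keys_orbit_sum by blast
    have inj: "inj \<sigma>" using \<sigma>(1) by (rule permutes_inj)
    have "lookup t (X 1) + lookup t (X 2) = 1"
      using arg_cong[OF t(2), of "\<lambda>r. lookup r (X 1)"] n
      by (simp add: lookup_merge lookup_staircase abscissa_def)
    then have "lookup t (X 1) = 1" "lookup t (X 2) = 0" using False by auto
    moreover have "lookup t (X l) = lookup ?P (X l)" if "l \<noteq> 1" "l \<noteq> 2" for l
      using arg_cong[OF t(2), of "\<lambda>r. lookup r (X l)"] that by (simp add: lookup_merge)
    ultimately have X: "lookup t (X l) = lookup ?P (X l)" for l
      using n by (cases "l = 1"; cases "l = 2") (auto simp: lookup_staircase abscissa_def)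
    have "\<sigma> l = l" for l
    proof (cases "l \<in> {1..n}")
      case True
      then have "\<sigma> l \<in> {1..n}" using permutes_in_image[OF \<sigma>(1)] by blast
      then show ?thesis
        using X[of l] True inj lookup_staircase_inj[of "\<sigma> l" n l i] by (simp add: \<sigma>(2))
    qed (use permutes_not_in[OF \<sigma>(1)] in simp)
    then have "\<sigma> = id" by auto
    then have "t = ?P" using \<sigma>(2) by simp
    then show ?thesis
      using lookup_orbit_sum_staircase[of n i] n by (simp add: lookup_staircase abscissa_def)
  qed
  then have "lookup (dx ?p) (merge ?P) = (\<Sum>t | t \<in> keys ?p \<and> merge t = merge ?P. if t = ?P then 1 else 0)"
    unfolding dx_def lookup_wpush by (intro sum.cong) auto
  also have "\<dots> = 1"
    using lookup_orbit_sum_staircase[of n i] by (simp add: in_keys_iff)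
  finally show ?thesis by (simp add: in_keys_iff)
qed

lemma not_diagonal_condition_staircase:
  assumes "n \<ge> 2" "\<not> good (int i) (merge (staircase n i))"
  shows "\<not> diagonal_condition ok good (int i, 1) (orbit_sum n 1 (staircase n i))"
  using merge_staircase_keys_dx[OF assms(1), of i] assms(2) by (auto simp: diagonal_condition_def)

lemma antisymmetric_degree_card:
  assumes f: "f \<in> skew n 1" "t \<in> keys f" and S: "S \<subseteq> {1..n}" "\<And>l. l \<in> S \<Longrightarrow> point_degree t l = j"
  shows "card S \<le> Suc j"
proof -
  have "inj_on (\<lambda>l. lookup t (X l)) S"
  proof (rule inj_onI, rule ccontr)
    fix l l' assume l: "l \<in> S" "l' \<in> S" "lookup t (X l) = lookup t (X l')" "l \<noteq> l'"
    then have "lookup t (Y l) = lookup t (Y l')"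
      using S(2)[of l] S(2)[of l'] by (simp add: point_degree_def)
    moreover have "l \<in> {1..n}" "l' \<in> {1..n}" using l S(1) by blast+
    ultimately show False using antisymmetric_distinct_points[OF f] l by blast
  qed
  moreover have "(\<lambda>l. lookup t (X l)) ` S \<subseteq> {..j}"
    using S(2) by (force simp: point_degree_def)
  ultimately have "card S \<le> card {..j}" by (intro card_inj_on_le) auto
  then show ?thesis by simp
qed

text \<open>
  For \<open>n = 1\<close> no other generator has \<open>m > 0\<close>.  For \<open>n \<ge> 2\<close> and \<open>i = 0\<close> the other antisymmetric generators have
  points of positive degree, so the merged point has degree at least \<open>2\<close>, whereas that of the alternant has degree
  \<open>1\<close>.  For \<open>i \<ge> 1\<close> a monomial is bad for \<open>k \<le> i\<close> if the merged point and at least \<open>i - 1\<close> others attain the minimal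
  degrees \<open>2k\<close> and \<open>k\<close>.  Multiplying by monomials of degree at least \<open>k'\<close> cannot turn a good monomial into a bad
  one for \<open>k + k'\<close>, because equality in the sum forces equality in the summands.  An antisymmetric generator with bad
  monomials for \<open>j \<le> i\<close> would have \<open>i + 1\<close> distinct points of degree \<open>j\<close>, which forces \<open>j = i\<close>.
\<close>

lemma minimal_antisymmetric:
  assumes n: "n \<ge> 1" and i: "i < n"
  shows "\<not> generates_section_ring n (\<lambda>L. L)
    (\<Union>L'\<in>generating_bidegrees n - {(int i, 1)}. cox_generators n L')"
proof -
  let ?p = "orbit_sum n 1 (staircase n i)"
  have p: "?p \<in> H0 n (int i, 1)" "?p \<noteq> 0"
    using lookup_orbit_sum_staircase[of n i] orbit_sum_staircase_H0 by auto
  consider "n = 1" | "n \<ge> 2" "i = 0" | "n \<ge> 2" "i \<ge> 1" using n by linarith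
  then show ?thesis
  proof cases
    case 1
    show ?thesis
      by (rule not_generates_support[of "{L. snd L \<le> 0}", OF _ _ _ _ p])
        (use 1 i in \<open>auto simp: generating_bidegrees_eq\<close>)
  next
    case 2
    show ?thesis
    proof (rule not_generates_diagonal[where ok = "\<lambda>_ _. True" and good = "\<lambda>_ w. point_degree w 1 \<ge> 2",
          OF _ _ _ _ _ _ _ p(1)])
      fix j f t assume j: "(int j, 1) \<in> generating_bidegrees n - {(int i, 1)}"
        and f: "f \<in> A_pow_ge n 1 (int j)" "t \<in> keys f"
      then have "int (point_degree t 1) \<ge> int j" "int (point_degree t 2) \<ge> int j"
        using 2 by (auto simp: A_pow_ge_def point_degree_def)
      moreover have "j \<ge> 1" using j 2 by (cases j) auto
      ultimately show "2 \<le> point_degree (merge t) 1" unfolding point_degree_merge by simp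
    next
      show "\<not> diagonal_condition (\<lambda>_ _. True) (\<lambda>_ w. point_degree w 1 \<ge> 2) (int i, 1) ?p"
        using 2 by (intro not_diagonal_condition_staircase)
          (simp_all add: point_degree_merge, simp add: point_degree_def lookup_merge lookup_staircase abscissa_def)
    qed (use 2 in \<open>auto simp: point_degree_add\<close>)
  next
    case 3
    define ok :: "int \<Rightarrow> monom \<Rightarrow> bool" where
      "ok k w \<longleftrightarrow> 2 * k \<le> int (point_degree w 1) \<and> (\<forall>l\<in>{3..n}. k \<le> int (point_degree w l))" for k w
    define S where "S k w = {l\<in>{3..n}. int (point_degree w l) = k}" for k w
    define good :: "int \<Rightarrow> monom \<Rightarrow> bool" where
      "good k w \<longleftrightarrow> ok k w \<and> (k \<le> int i \<longrightarrow> \<not> (int (point_degree w 1) = 2 * k \<and> i - 1 \<le> card (S k w)))" for k w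
    show ?thesis
    proof (rule not_generates_diagonal[where ok = ok and good = good, OF _ _ _ _ _ _ _ p(1)])
      show ok: "ok (k + k') (w + w')" if "ok k w" "ok k' w'" for k k' w w'
        using that by (fastforce simp: ok_def point_degree_add)
      show "ok k w" if "k \<le> 0" for k w using that by (auto simp: ok_def)
      show "good (k + k') (w + w')" if g: "good k w" "ok k' w'" for k k' w w'
        unfolding good_def
      proof (intro conjI impI notI)
        show "ok (k + k') (w + w')" using g ok by (simp add: good_def)
        assume k: "k + k' \<le> int i" and *: "int (point_degree (w + w') 1) = 2 * (k + k') \<and> i - 1 \<le> card (S (k + k') (w + w'))"
        have ok: "ok k w" "ok k' w'" using g by (auto simp: good_def)
        have "int (point_degree w 1) = 2 * k" "0 \<le> k'"
          using ok * by (auto simp: ok_def point_degree_add)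
        moreover have "S (k + k') (w + w') \<subseteq> S k w"
        proof
          fix l assume l: "l \<in> S (k + k') (w + w')"
          then have "k \<le> int (point_degree w l)" "k' \<le> int (point_degree w' l)"
            using ok by (simp_all add: S_def ok_def)
          then show "l \<in> S k w" using l by (simp add: S_def point_degree_add)
        qed
        then have "card (S (k + k') (w + w')) \<le> card (S k w)"
          by (intro card_mono) (auto simp: S_def)
        ultimately show False using g(1) k * by (simp add: good_def)
      qed
      show "ok 1 (merge t)" if f: "f \<in> A_pow_ge n 0 1" "t \<in> keys f" for f t
      proof -
        have "point_degree t l \<ge> 1" if "l \<in> {1..n}" for l
          using f that by (force simp: A_pow_ge_def point_degree_def)
        then have "1 \<le> point_degree t 1" "1 \<le> point_degree t 2" "\<forall>l\<in>{3..n}. 1 \<le> point_degree t l"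
          using 3 by simp_all
        then show ?thesis unfolding ok_def point_degree_merge(1) by (simp add: point_degree_merge(2))
      qed
      show "good (int j) (merge t)" if j: "(int j, 1) \<in> generating_bidegrees n - {(int i, 1)}"
        and f: "f \<in> A_pow_ge n 1 (int j)" "t \<in> keys f" for j f t
      proof -
        have skew: "f \<in> skew n 1" using f(1) by (simp add: A_pow_ge_def A_pow_1)
        have deg: "j \<le> point_degree t l" if "l \<in> {1..n}" for l
          using f that by (force simp: A_pow_ge_def point_degree_def)
        have deg12: "j \<le> point_degree t 1" "j \<le> point_degree t 2" using deg 3 by simp_all
        have "\<forall>l\<in>{3..n}. j \<le> point_degree t l" using deg by simp
        then have "ok (int j) (merge t)"
          unfolding ok_def point_degree_merge(1) using deg12 by (simp add: point_degree_merge(2))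
        moreover have False
          if le: "int j \<le> int i" and eq: "int (point_degree (merge t) 1) = 2 * int j"
            and card: "i - 1 \<le> card (S (int j) (merge t))"
        proof -
          have S: "S (int j) (merge t) \<subseteq> {3..n}" "finite (S (int j) (merge t))" by (auto simp: S_def)
          let ?S = "{1, 2} \<union> S (int j) (merge t)"
          have "point_degree t 1 = j" "point_degree t 2 = j"
            using eq deg12 by (simp_all add: point_degree_merge)
          then have "card ?S \<le> Suc j"
            using S(1) 3 by (intro antisymmetric_degree_card[OF skew f(2)]) (auto simp: S_def point_degree_merge)
          moreover have "card ?S = 2 + card (S (int j) (merge t))"
            using S by (subst card_Un_disjoint) auto
          ultimately have "i \<le> j" using card 3 by simp
          then show False using le j by auto
        qed
        ultimately show ?thesis unfolding good_def by blast
      qed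
      show "\<not> diagonal_condition ok good (int i, 1) ?p"
      proof (rule not_diagonal_condition_staircase)
        have deg: "point_degree (staircase n i) l = i" if "l \<in> {1..Suc i}" for l
          using that i 3 by (auto simp: point_degree_def lookup_staircase abscissa_def)
        have "{3..Suc i} \<subseteq> S (int i) (merge (staircase n i))"
          using deg i by (auto simp: S_def point_degree_merge)
        then have "card {3..Suc i} \<le> card (S (int i) (merge (staircase n i)))"
          by (intro card_mono) (auto simp: S_def)
        then show "\<not> good (int i) (merge (staircase n i))"
          using deg[of 1] deg[of 2] 3 by (simp add: good_def point_degree_merge)
      qed (use 3 in simp)
    qed (use 3 in auto)
  qed
qed

text \<open>
  For \<open>n = 1\<close> no other generator has \<open>k > 0\<close>.  For \<open>n \<ge> 2\<close> the product of the \<open>x\<^sub>i\<close> does not vanish where two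
  points coincide.  An element of degree \<open>(1, 0)\<close> obtained from the other generators does, since a generator with
  \<open>k > 0\<close> has to enter, and those are antisymmetric.
\<close>

lemma minimal_symmetric:
  assumes n: "n \<ge> 1"
  shows "\<not> generates_section_ring n (\<lambda>L. L)
    (\<Union>L'\<in>generating_bidegrees n - {(1, 0)}. cox_generators n L')"
proof -
  define t where "t = point_monom n (\<lambda>_. 1) (\<lambda>_. 0)"
  define p :: cpoly where "p = single t 1"
  have tc: "keys t \<subseteq> coords n" by (simp add: t_def keys_point_monom)
  have "t = perm \<sigma> s \<longleftrightarrow> t = s" if \<sigma>: "\<sigma> permutes {1..n}" for \<sigma> s
  proof -
    have "perm \<sigma> t = t"
      using permutes_in_image[OF \<sigma>] permutes_inj[OF \<sigma>] by (intro monom_eqI) (simp_all add: t_def del: atLeastAtMost_iff)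
    then show ?thesis using perm_inv(2)[OF permutes_bij[OF \<sigma>]] by metis
  qed
  then have "p \<in> skew n 0"
    using tc by (intro skewI) (simp_all add: p_def lookup_single when_def poly_ring_def)
  then have p: "p \<in> H0 n (1, 0)" "p \<noteq> 0"
    using lookup_single_eq[of t "1::complex"] by (auto simp: H0_def A_pow_ge_def A_pow_0 p_def t_def simp del: lookup_single_eq)
  show ?thesis
  proof (cases "n = 1")
    case True
    show ?thesis
      by (rule not_generates_support[of "{L. fst L \<le> 0}", OF _ _ _ _ p])
        (use True in \<open>auto simp: generating_bidegrees_eq\<close>)
  next
    case False
    show ?thesis
      by (rule not_generates_diagonal[where ok = "\<lambda>k _. k \<le> 0" and good = "\<lambda>_ _. True", OF _ _ _ _ _ _ _ p(1)])
        (use False n in \<open>auto simp: diagonal_condition_def p_def\<close>)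
  qed
qed

lemma minimal_canonical:
  "\<not> generates_section_ring n (\<lambda>L. L) (\<Union>L'\<in>generating_bidegrees n - {(-1, 0)}. cox_generators n L')"
  "\<not> generates_section_ring n (\<lambda>L. L) (\<Union>L'\<in>generating_bidegrees n - {(0, -2)}. cox_generators n L')"
proof -
  show "\<not> generates_section_ring n (\<lambda>L. L) (\<Union>L'\<in>generating_bidegrees n - {(-1, 0)}. cox_generators n L')"
    by (rule not_generates_support[where M = "{L. fst L \<ge> 0}" and L = "(-1, 0)" and p = 1, OF _ _ _ _ one_H0])
      (auto simp: generating_bidegrees_eq)
  show "\<not> generates_section_ring n (\<lambda>L. L) (\<Union>L'\<in>generating_bidegrees n - {(0, -2)}. cox_generators n L')"
    by (rule not_generates_support[where M = "{L. snd L \<ge> 0}" and L = "(0, -2)" and p = 1, OF _ _ _ _ one_H0])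
      (auto simp: generating_bidegrees_eq)
qed

lemma main_bundles_nth:
  "length (main_bundles n) = Suc n" "i < n \<Longrightarrow> main_bundles n ! i = (int i, 1)" "main_bundles n ! n = (1, 0)"
  by (simp_all add: main_bundles_def nth_append)

theorem theorem1p5:
  fixes n :: nat
  assumes "n \<ge> 1"
  shows "minimally_generates_total_ring n (generating_bidegrees n) (cox_generators n)
    \<and> (\<forall>i. Suc i < length (main_bundles n) \<longrightarrow>
        (let L1 = main_bundles n ! i; L2 = main_bundles n ! Suc i;
             \<phi> = (\<lambda>(d1, d2). tensor_power L1 d1 + tensor_power L2 d2) :: nat \<times> nat \<Rightarrow> line_bundle
         in generates_section_ring n \<phi>
              (sections_in_degree n \<phi> (1, 0) \<union> sections_in_degree n \<phi> (0, 1))))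
    \<and> (\<forall>k m :: int. k \<ge> 0 \<longrightarrow> m \<ge> 0 \<longrightarrow>
        (let \<phi> = tensor_power (k, m)
         in generates_section_ring n \<phi> (sections_in_degree n \<phi> 1)))"
proof (intro conjI allI impI)
  have "\<not> generates_section_ring n (\<lambda>L. L) (\<Union>L'\<in>generating_bidegrees n - {L}. cox_generators n L')"
    if "L \<in> generating_bidegrees n" for L
    using that minimal_antisymmetric[OF assms] minimal_symmetric[OF assms] minimal_canonical[of n]
    unfolding generating_bidegrees_eq[of n, THEN eqset_imp_iff] by blast
  then show "minimally_generates_total_ring n (generating_bidegrees n) (cox_generators n)"
    using generates_total[OF assms] by (simp add: minimally_generates_total_ring_def)
next
  fix i assume i: "Suc i < length (main_bundles n)"
  show "let L1 = main_bundles n ! i; L2 = main_bundles n ! Suc i;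
             \<phi> = (\<lambda>(d1, d2). tensor_power L1 d1 + tensor_power L2 d2) :: nat \<times> nat \<Rightarrow> line_bundle
         in generates_section_ring n \<phi>
              (sections_in_degree n \<phi> (1, 0) \<union> sections_in_degree n \<phi> (0, 1))"
  proof (cases "Suc i < n")
    case True
    then show ?thesis
      using generates_pair_antisymmetric[of n i] by (simp only: Let_def main_bundles_nth Suc_lessD)
  next
    case False
    then have "Suc i = n" "i = n - 1" using i by (simp_all add: main_bundles_nth)
    then show ?thesis
      using generates_pair_last[OF assms] assms by (simp only: Let_def main_bundles_nth)
  qed
next
  fix k m :: int assume "k \<ge> 0" "m \<ge> 0"
  then show "let \<phi> = tensor_power (k, m) in generates_section_ring n \<phi> (sections_in_degree n \<phi> 1)"
    unfolding Let_def by (rule generates_powers)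
qed

end
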